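(* Let $k$ be a field, $k'$ a finite extension of $k$, and $L=k'((t))((u))$. For any $f,g\in L^*$ (viewed as elements of $GL(L/k)$ acting on $L$ by multiplication; they commute) one has $$\langle f,g\rangle_L=[k':k]\cdot \nu_L(f,g).$$
   Context: Notation. $k$ is a field (with the discrete topology), $k'/k$ finite, $L=k'((t))((u))$, $\bar L=k'((t))$. For $n\in\mathbb Z$ put $\mathcal O_n=u^nk'((t))[[u]]$. Topological vector spaces. A topological $k$-vector space is linearly compact if it is complete and Hausdorff, has a base of neighbourhoods of $0$ consisting of vector subspaces, and every open subspace has finite codimension; it is linearly locally compact if it has a base of neighbourhoods of $0$ consisting of open linearly compact subspaces. For $m<n$, $\mathcal O_m/\mathcal O_n$ is linearly locally compact with base of neighbourhoods of $0$ the images of $t^lu^mk'[[t,u]]$, $l\in\mathbb Z$. $L$ carries the topology whose base of neighbourhoods of $0$ consists of the subspaces $\sum_i t^{l_i}k'[[t]]u^i+\mathcal O_m$ ($l_i,m\in\mathbb Z$). $End(L/k)$ is the set of $k$-linear maps $A:L\to L$ such that: (1) for every $n$ there is $m$ with $A\mathcal O_n\subset\mathcal O_m$; (2) for every $m$ there is $n$ with $A\mathcal O_n\subset \mathcal O_m$; (3) whenever $n_1<n_2$, $m_1<m_2$ and $A\mathcal O_{n_i}\subset\mathcal O_{m_i}$ ($i=1,2$), the induced map $\mathcal O_{n_1}/\mathcal O_{n_2}\to\mathcal O_{m_1}/\mathcal O_{m_2}$ is continuous. $GL(L/k)=End(L/k)^*$; each $g\in GL(L/k)$ acts continuously on $L$,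 and $L^*\subset GL(L/k)$ via multiplication. Dimension theories. For a linearly locally compact $V$ and open linearly compact subspaces $A,B\subset V$ put $[A\mid B]_1=\dim_k B/(A\cap B)-\dim_k A/(A\cap B)$. A dimension theory on $V$ is a function $d$ from open linearly compact subspaces of $V$ to $\mathbb Z$ with $d(B)=d(A)+[A\mid B]_1$ for all $A,B$; the set $\mathrm{Dim}(V)$ of these is a $\mathbb Z$-torsor ($\mathbb Z$ acts by adding constants). For an exact sequence $0\to V_1\to V\to V_2\to0$ with $V_1$ closed (induced topology on $V_1$, quotient topology on $V_2$) there is a canonical isomorphism $\mathrm{Dim}(V_1)\otimes_{\mathbb Z}\mathrm{Dim}(V_2)\to\mathrm{Dim}(V)$, $(d_1\otimes d_2)(U)=d_1(U\cap V_1)+d_2(U/(U\cap V_1))$. Relative torsors. For closed subspaces $W_1,W_2\subset L$ and a closed subspace $W\subset W_1\cap W_2$ with $W_1/W$, $W_2/W$ linearly locally compact, put $[W_1\mid W_2;W]_2=\mathrm{Hom}_{\mathbb Z}(\mathrm{Dim}(W_1/W),\mathrm{Dim}(W_2/W))$ (morphisms of $\mathbb Z$-torsors). For $W'\subset W$ with the same property these torsors are canonically identified via $\mathrm{Dim}(W_i/W')\cong\mathrm{Dim}(W_i/W)\otimes\mathrm{Dim}(W/W')$; the inverse limit of this system is the $\mathbb Z$-torsor $[W_1\mid W_2]_2$. Composition of homomorphisms gives canonical isomorphisms $[W_1\mid W_2]_2\otimes_{\mathbb Z}[W_2\mid W_3]_2\to[W_1\mid W_3]_2$, and each $g\in GL(L/k)$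 induces $d\mapsto g(d)$, $[W_1\mid W_2]_2\to[gW_1\mid gW_2]_2$. Central extension. Let $W=\mathcal O_0=k'((t))[[u]]$. $\widehat{GL}_W$ is the set of pairs $(g,d)$ with $g\in GL(L/k)$, $d\in[W\mid gW]_2$, with multiplication $(g_1,d_1)(g_2,d_2)=(g_1g_2,d_1\cdot g_1(d_2))$; it is a central extension $0\to\mathbb Z\to\widehat{GL}_W\to GL(L/k)\to1$. For commuting $a,b\in GL(L/k)$, $\langle a,b\rangle_L\in\mathbb Z$ is the commutator $[a',b']$ of arbitrary lifts $a',b'\in\widehat{GL}_W$. Symbol. $\nu_2:L^*\to\mathbb Z$ is the $u$-adic valuation; $\nu_1(b)=\nu_{\bar L}(\overline{bu^{-\nu_2(b)}})$, where the bar is the residue map to $\bar L$ and $\nu_{\bar L}$ is the $t$-adic valuation of $\bar L$. $\nu_L(f,g)=\nu_1(f)\nu_2(g)-\nu_1(g)\nu_2(f)$.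
   Formalization: The commutator is taken as [x,y] = y x y⁻¹ x⁻¹: with the stated conventions both usual ones (x y x⁻¹ y⁻¹ and x⁻¹ y⁻¹ x y) give ⟨t,u⟩_L = −[k':k] while ν_L(t,u) = 1, so the displayed formula would fail by a sign. *)

theory Defs
  imports
    "HOL-Analysis.Analysis"
    "HOL-Algebra.AbelCoset"
    "HOL-Algebra.Module"
    "HOL-Computational_Algebra.Formal_Laurent_Series"
begin

section \<open>Topological vector spaces with carrier\<close>

text \<open>
  Spaces carry explicit carriers because subquotients of the Laurent series field are needed;
  the points of a quotient are cosets. The scalar field is the type \<open>'k\<close> with the discrete
  topology. The fields \<open>mult\<close> and \<open>one\<close> inherited from the record of modules are never used.
\<close>

record ('k, 'v) tvs = "('k, 'v) module" +
  vtop :: "'v topology"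

definition nbhd_topology :: "('k, 'v, 'm) module_scheme \<Rightarrow> 'v set set \<Rightarrow> 'v topology" where
  "nbhd_topology V \<B> =
     topology (\<lambda>U. U \<subseteq> carrier V \<and> (\<forall>x\<in>U. \<exists>N\<in>\<B>. N +>\<^bsub>V\<^esub> x \<subseteq> U))"

definition vsubspace :: "('k, 'v, 'm) module_scheme \<Rightarrow> 'v set \<Rightarrow> bool" where
  "vsubspace V U \<longleftrightarrow> U \<subseteq> carrier V \<and> \<zero>\<^bsub>V\<^esub> \<in> U \<and>
     (\<forall>x\<in>U. \<forall>y\<in>U. x \<oplus>\<^bsub>V\<^esub> y \<in> U) \<and> (\<forall>c. \<forall>x\<in>U. c \<odot>\<^bsub>V\<^esub> x \<in> U)"

definition sub_tvs :: "('k, 'v) tvs \<Rightarrow> 'v set \<Rightarrow> ('k, 'v) tvs" where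
  "sub_tvs V U = V\<lparr>carrier := U, vtop := subtopology (vtop V) U\<rparr>"

text \<open>In \<open>smult\<close> the summand \<open>Y\<close> matters only for the scalar \<open>0\<close>.\<close>

definition quot_tvs :: "('k, 'v) tvs \<Rightarrow> 'v set \<Rightarrow> ('k, 'v set) tvs" where
  "quot_tvs V Y = \<lparr>carrier = a_rcosets\<^bsub>V\<^esub> Y, mult = undefined, one = undefined,
     zero = Y, add = (\<lambda>A B. A <+>\<^bsub>V\<^esub> B), smult = (\<lambda>c A. ((\<lambda>a. c \<odot>\<^bsub>V\<^esub> a) ` A) <+>\<^bsub>V\<^esub> Y),
     vtop = topology (\<lambda>S. S \<subseteq> a_rcosets\<^bsub>V\<^esub> Y \<and> openin (vtop V) {x \<in> carrier V. Y +>\<^bsub>V\<^esub> x \<in> S})\<rparr>"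

lemma openin_quot_tvs:
  "openin (vtop (quot_tvs V Y)) S \<longleftrightarrow>
     S \<subseteq> a_rcosets\<^bsub>V\<^esub> Y \<and> openin (vtop V) {x \<in> carrier V. Y +>\<^bsub>V\<^esub> x \<in> S}"
proof -
  let ?P = "\<lambda>S. S \<subseteq> a_rcosets\<^bsub>V\<^esub> Y \<and> openin (vtop V) {x \<in> carrier V. Y +>\<^bsub>V\<^esub> x \<in> S}"
  have "istopology ?P"
    unfolding istopology_def
  proof (intro conjI allI impI)
    fix S T assume ST: "?P S" "?P T"
    have "{x \<in> carrier V. Y +>\<^bsub>V\<^esub> x \<in> S \<inter> T} =
          {x \<in> carrier V. Y +>\<^bsub>V\<^esub> x \<in> S} \<inter> {x \<in> carrier V. Y +>\<^bsub>V\<^esub> x \<in> T}" by auto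
    then show "S \<inter> T \<subseteq> a_rcosets\<^bsub>V\<^esub> Y"
      and "openin (vtop V) {x \<in> carrier V. Y +>\<^bsub>V\<^esub> x \<in> S \<inter> T}"
      using ST by auto
  next
    fix \<K> assume \<K>: "\<forall>S\<in>\<K>. ?P S"
    have "{x \<in> carrier V. Y +>\<^bsub>V\<^esub> x \<in> \<Union>\<K>} = (\<Union>S\<in>\<K>. {x \<in> carrier V. Y +>\<^bsub>V\<^esub> x \<in> S})" by auto
    then show "\<Union>\<K> \<subseteq> a_rcosets\<^bsub>V\<^esub> Y"
      and "openin (vtop V) {x \<in> carrier V. Y +>\<^bsub>V\<^esub> x \<in> \<Union>\<K>}"
      using \<K> by auto
  qed
  then show ?thesis
    by (simp add: quot_tvs_def topology_inverse')
qed

definition vbasis :: "('k, 'v, 'm) module_scheme \<Rightarrow> 'v set \<Rightarrow> bool" where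
  "vbasis V S \<longleftrightarrow> S \<subseteq> carrier V \<and> finite S \<and>
     (\<forall>v\<in>carrier V. \<exists>!c. c \<in> S \<rightarrow>\<^sub>E (UNIV :: 'k set) \<and> v = (\<Oplus>\<^bsub>V\<^esub>s\<in>S. c s \<odot>\<^bsub>V\<^esub> s))"

definition fin_dimensional :: "('k, 'v, 'm) module_scheme \<Rightarrow> bool" where
  "fin_dimensional V \<longleftrightarrow> (\<exists>S. vbasis V S)"

definition vdim :: "('k, 'v, 'm) module_scheme \<Rightarrow> nat" where
  "vdim V = (THE n. \<exists>S. vbasis V S \<and> card S = n)"

text \<open>Every Cauchy filter on the carrier converges.\<close>

definition complete_tvs :: "('k, 'v) tvs \<Rightarrow> bool" where
  "complete_tvs V \<longleftrightarrow>
     (\<forall>F. F \<noteq> bot \<and> eventually (\<lambda>x. x \<in> carrier V) F \<and>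
        (\<forall>N. openin (vtop V) N \<and> \<zero>\<^bsub>V\<^esub> \<in> N \<longrightarrow>
          (\<exists>M. M \<subseteq> carrier V \<and> eventually (\<lambda>x. x \<in> M) F \<and> (\<forall>x\<in>M. \<forall>y\<in>M. x \<ominus>\<^bsub>V\<^esub> y \<in> N)))
        \<longrightarrow> (\<exists>l. limitin (vtop V) (\<lambda>x. x) l F))"

definition linearly_compact :: "('k, 'v) tvs \<Rightarrow> bool" where
  "linearly_compact V \<longleftrightarrow> complete_tvs V \<and> Hausdorff_space (vtop V) \<and>
     (\<forall>N. openin (vtop V) N \<and> \<zero>\<^bsub>V\<^esub> \<in> N \<longrightarrow>
        (\<exists>U. vsubspace V U \<and> openin (vtop V) U \<and> U \<subseteq> N)) \<and>
     (\<forall>U. vsubspace V U \<and> openin (vtop V) U \<longrightarrow> fin_dimensional (quot_tvs V U))"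

definition open_lin_compact :: "('k, 'v) tvs \<Rightarrow> 'v set set" where
  "open_lin_compact V =
     {U. vsubspace V U \<and> openin (vtop V) U \<and> linearly_compact (sub_tvs V U)}"

definition linearly_locally_compact :: "('k, 'v) tvs \<Rightarrow> bool" where
  "linearly_locally_compact V \<longleftrightarrow>
     (\<forall>N. openin (vtop V) N \<and> \<zero>\<^bsub>V\<^esub> \<in> N \<longrightarrow> (\<exists>U\<in>open_lin_compact V. U \<subseteq> N))"


section \<open>Dimension theories\<close>

definition rel_dim :: "('k, 'v) tvs \<Rightarrow> 'v set \<Rightarrow> 'v set \<Rightarrow> int" where
  "rel_dim V A B = int (vdim (quot_tvs (sub_tvs V B) (A \<inter> B)))
                 - int (vdim (quot_tvs (sub_tvs V A) (A \<inter> B)))"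

definition Dim :: "('k, 'v) tvs \<Rightarrow> ('v set \<Rightarrow> int) set" where
  "Dim V = {d \<in> open_lin_compact V \<rightarrow>\<^sub>E UNIV.
     \<forall>A\<in>open_lin_compact V. \<forall>B\<in>open_lin_compact V. d B = d A + rel_dim V A B}"

definition dim_shift :: "('k, 'v) tvs \<Rightarrow> int \<Rightarrow> ('v set \<Rightarrow> int) \<Rightarrow> ('v set \<Rightarrow> int)" where
  "dim_shift V n d = (\<lambda>U\<in>open_lin_compact V. d U + n)"

definition dim_hom :: "('k, 'v) tvs \<Rightarrow> ('k, 'w) tvs \<Rightarrow> (('v set \<Rightarrow> int) \<Rightarrow> ('w set \<Rightarrow> int)) set" where
  "dim_hom V V' = {h \<in> Dim V \<rightarrow>\<^sub>E Dim V'.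
     \<forall>d\<in>Dim V. \<forall>n. h (dim_shift V n d) = dim_shift V' n (h d)}"

definition subquot :: "('k, 'v) tvs \<Rightarrow> 'v set \<Rightarrow> 'v set \<Rightarrow> ('k, 'v set) tvs" where
  "subquot V X Y = quot_tvs (sub_tvs V X) Y"

text \<open>
  The canonical map for \<open>0 \<rightarrow> Y/Z \<rightarrow> X/Z \<rightarrow> X/Y \<rightarrow> 0\<close>, where \<open>Z \<subseteq> Y \<subseteq> X\<close>: the quotient of
  \<open>U\<close> by \<open>U \<inter> Y/Z\<close> is regarded as the image of \<open>U\<close> in \<open>X/Y\<close>.
\<close>

definition dim_tensor ::
  "('k, 'v) tvs \<Rightarrow> 'v set \<Rightarrow> 'v set \<Rightarrow> 'v set \<Rightarrow> ('v set set \<Rightarrow> int) \<Rightarrow> ('v set set \<Rightarrow> int) \<Rightarrow> 'v set set \<Rightarrow> int"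
where
  "dim_tensor V X Y Z d1 d2 = (\<lambda>U\<in>open_lin_compact (subquot V X Z).
     d1 (U \<inter> carrier (subquot V Y Z)) + d2 ((\<lambda>A. A <+>\<^bsub>V\<^esub> Y) ` U))"


section \<open>Relative torsors\<close>

definition admissible :: "('k, 'v) tvs \<Rightarrow> 'v set \<Rightarrow> 'v set \<Rightarrow> 'v set set" where
  "admissible V W1 W2 = {W. vsubspace V W \<and> closedin (vtop V) W \<and> W \<subseteq> W1 \<inter> W2 \<and>
     linearly_locally_compact (subquot V W1 W) \<and> linearly_locally_compact (subquot V W2 W)}"

type_synonym 'v rel_elt = "'v set \<Rightarrow> ('v set set \<Rightarrow> int) \<Rightarrow> ('v set set \<Rightarrow> int)"

text \<open>
  Elements of the inverse limit: families of torsor morphisms, compatible with the identification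
  \<open>h \<mapsto> h \<otimes> id\<close> of \<open>Hom(Dim(W1/W), Dim(W2/W))\<close> with \<open>Hom(Dim(W1/W'), Dim(W2/W'))\<close>.
\<close>

definition rel_torsor :: "('k, 'v) tvs \<Rightarrow> 'v set \<Rightarrow> 'v set \<Rightarrow> 'v rel_elt set" where
  "rel_torsor V W1 W2 =
     {h \<in> (\<Pi>\<^sub>E W\<in>admissible V W1 W2. dim_hom (subquot V W1 W) (subquot V W2 W)).
        \<forall>W\<in>admissible V W1 W2. \<forall>W'\<in>admissible V W1 W2. W' \<subseteq> W \<longrightarrow>
          (\<forall>d\<in>Dim (subquot V W1 W). \<forall>e\<in>Dim (subquot V W W').
             h W' (dim_tensor V W1 W W' e d) = dim_tensor V W2 W W' e (h W d))}"

text \<open>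
  A subspace admissible for \<open>(W1, W3)\<close> need not lie in \<open>W2\<close>, so the product is determined by its
  components at the subspaces admissible for both factors.
\<close>

definition rel_comp ::
  "('k, 'v) tvs \<Rightarrow> 'v set \<Rightarrow> 'v set \<Rightarrow> 'v set \<Rightarrow> 'v rel_elt \<Rightarrow> 'v rel_elt \<Rightarrow> 'v rel_elt"
where
  "rel_comp V W1 W2 W3 h h' = (THE c. c \<in> rel_torsor V W1 W3 \<and>
     (\<forall>W\<in>admissible V W1 W2 \<inter> admissible V W2 W3. \<forall>d\<in>Dim (subquot V W1 W).
        c W d = h' W (h W d)))"

text \<open>The element of \<open>[W|W]\<close> given by translation by \<open>n\<close>.\<close>

definition rel_int :: "('k, 'v) tvs \<Rightarrow> 'v set \<Rightarrow> int \<Rightarrow> 'v rel_elt" where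
  "rel_int V W n = (\<lambda>X\<in>admissible V W W. \<lambda>d\<in>Dim (subquot V W X). dim_shift (subquot V W X) n d)"

text \<open>Transport of structure \<open>Dim(X/Y) \<rightarrow> Dim(gX/gY)\<close> along a bijection \<open>g\<close>.\<close>

definition dim_push ::
  "('k, 'v) tvs \<Rightarrow> ('v \<Rightarrow> 'v) \<Rightarrow> 'v set \<Rightarrow> 'v set \<Rightarrow> ('v set set \<Rightarrow> int) \<Rightarrow> ('v set set \<Rightarrow> int)"
where
  "dim_push V g X Y d =
     (\<lambda>U\<in>open_lin_compact (subquot V (g ` X) (g ` Y)). d ((\<lambda>A. g -` A) ` U))"

definition rel_push ::
  "('k, 'v) tvs \<Rightarrow> ('v \<Rightarrow> 'v) \<Rightarrow> 'v set \<Rightarrow> 'v set \<Rightarrow> 'v rel_elt \<Rightarrow> 'v rel_elt"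
where
  "rel_push V g W1 W2 h =
     (\<lambda>X\<in>admissible V (g ` W1) (g ` W2). \<lambda>d\<in>Dim (subquot V (g ` W1) X).
        dim_push V g W2 (g -` X) (h (g -` X) (dim_push V (inv_into UNIV g) (g ` W1) X d)))"


section \<open>The two-dimensional local field\<close>

text \<open>
  A finite extension of fields is a homomorphism \<open>\<iota>\<close> from \<open>'k\<close> to \<open>'a\<close> making \<open>'a\<close> a
  finite-dimensional space over \<open>'k\<close>.
\<close>

definition finite_extension :: "('k::field \<Rightarrow> 'a::field) \<Rightarrow> bool" where
  "finite_extension \<iota> \<longleftrightarrow> \<iota> 1 = 1 \<and> (\<forall>x y. \<iota> (x + y) = \<iota> x + \<iota> y) \<and> (\<forall>x y. \<iota> (x * y) = \<iota> x * \<iota> y) \<and>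
     (\<exists>B. finite B \<and> module.span (\<lambda>c x. \<iota> c * x) B = UNIV)"

definition ext_degree :: "('k::field \<Rightarrow> 'a::field) \<Rightarrow> nat" where
  "ext_degree \<iota> = vector_space.dim (\<lambda>c x. \<iota> c * x) (UNIV :: 'a set)"

text \<open>
  The field \<open>k'((t))((u))\<close> is \<open>'a fls fls\<close>; the outer variable is \<open>u\<close>, so that
  \<open>fls_const fls_X\<close> is \<open>t\<close> and \<open>fls_X\<close> is \<open>u\<close>. For \<open>'b = 'a fls\<close> the set below
  is \<open>u\<^sup>n k'((t))[[u]]\<close>, for \<open>'b = 'a\<close> it is \<open>t\<^sup>n k'[[t]]\<close>.
\<close>

definition fls_lattice :: "int \<Rightarrow> 'b::field fls set" where
  "fls_lattice n = range (\<lambda>p. fls_X_intpow n * fps_to_fls p)"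

abbreviation \<O> :: "int \<Rightarrow> 'a::field fls fls set" where
  "\<O> \<equiv> fls_lattice"

text \<open>The subspace \<open>\<Sum>\<^sub>i t\<^bsup>l i\<^esup> k'[[t]] u\<^sup>i + \<O> m\<close>.\<close>

definition L_nbhd :: "(int \<Rightarrow> int) \<Rightarrow> int \<Rightarrow> 'a::field fls fls set" where
  "L_nbhd l m = {f + g | f g. (\<forall>i. fls_nth f i \<in> fls_lattice (l i)) \<and> g \<in> \<O> m}"

definition L_scale :: "('k::field \<Rightarrow> 'a::field) \<Rightarrow> 'k \<Rightarrow> 'a fls fls \<Rightarrow> 'a fls fls" where
  "L_scale \<iota> c x = fls_const (fls_const (\<iota> c)) * x"

definition L_module :: "('k::field \<Rightarrow> 'a::field) \<Rightarrow> ('k, 'a fls fls) module" where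
  "L_module \<iota> = \<lparr>carrier = UNIV, mult = (*), one = 1, zero = 0, add = (+), smult = L_scale \<iota>\<rparr>"

definition L_tvs :: "('k::field \<Rightarrow> 'a::field) \<Rightarrow> ('k, 'a fls fls) tvs" where
  "L_tvs \<iota> = module.extend (L_module \<iota>)
     (tvs.fields (nbhd_topology (L_module \<iota>) {L_nbhd l m | l m. True}))"

text \<open>
  \<open>\<O> m / \<O> n\<close> for \<open>m < n\<close>, with the images of \<open>t\<^sup>l u\<^sup>m k'[[t,u]]\<close> as base of
  neighbourhoods of \<open>0\<close>.
\<close>

definition power_series2 :: "'a::field fls fls set" where
  "power_series2 = {f \<in> \<O> 0. \<forall>i. fls_nth f i \<in> fls_lattice 0}"

definition L_quot_nbhd :: "('k::field \<Rightarrow> 'a::field) \<Rightarrow> int \<Rightarrow> int \<Rightarrow> int \<Rightarrow> 'a fls fls set set" where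
  "L_quot_nbhd \<iota> m n l =
     (\<lambda>h. \<O> n +>\<^bsub>L_tvs \<iota>\<^esub> (fls_const (fls_X_intpow l) * fls_X_intpow m * h)) ` power_series2"

definition L_quot :: "('k::field \<Rightarrow> 'a::field) \<Rightarrow> int \<Rightarrow> int \<Rightarrow> ('k, 'a fls fls set) tvs" where
  "L_quot \<iota> m n = (subquot (L_tvs \<iota>) (\<O> m) (\<O> n))
     \<lparr>vtop := nbhd_topology (subquot (L_tvs \<iota>) (\<O> m) (\<O> n)) (range (L_quot_nbhd \<iota> m n))\<rparr>"

definition L_End :: "('k::field \<Rightarrow> 'a::field) \<Rightarrow> ('a fls fls \<Rightarrow> 'a fls fls) set" where
  "L_End \<iota> = {A. Vector_Spaces.linear (L_scale \<iota>) (L_scale \<iota>) A \<and>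
     (\<forall>n. \<exists>m. A ` \<O> n \<subseteq> \<O> m) \<and>
     (\<forall>m. \<exists>n. A ` \<O> n \<subseteq> \<O> m) \<and>
     (\<forall>n1 n2 m1 m2. n1 < n2 \<and> m1 < m2 \<and> A ` \<O> n1 \<subseteq> \<O> m1 \<and> A ` \<O> n2 \<subseteq> \<O> m2 \<longrightarrow>
        continuous_map (vtop (L_quot \<iota> n1 n2)) (vtop (L_quot \<iota> m1 m2))
          (\<lambda>C. A ` C <+>\<^bsub>L_tvs \<iota>\<^esub> \<O> m2))}"

definition L_GL :: "('k::field \<Rightarrow> 'a::field) \<Rightarrow> ('a fls fls \<Rightarrow> 'a fls fls) set" where
  "L_GL \<iota> = Units \<lparr>carrier = L_End \<iota>, mult = (\<circ>), one = id\<rparr>"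


section \<open>The central extension and its commutator pairing\<close>

definition GL_hat ::
  "('k::field \<Rightarrow> 'a::field) \<Rightarrow> (('a fls fls \<Rightarrow> 'a fls fls) \<times> 'a fls fls rel_elt) monoid"
where
  "GL_hat \<iota> = \<lparr>
     carrier = {(g, d). g \<in> L_GL \<iota> \<and> d \<in> rel_torsor (L_tvs \<iota>) (\<O> 0) (g ` \<O> 0)},
     mult = (\<lambda>(g1, d1) (g2, d2). (g1 \<circ> g2,
       rel_comp (L_tvs \<iota>) (\<O> 0) (g1 ` \<O> 0) ((g1 \<circ> g2) ` \<O> 0) d1
         (rel_push (L_tvs \<iota>) g1 (\<O> 0) (g2 ` \<O> 0) d2))),
     one = (id, rel_int (L_tvs \<iota>) (\<O> 0) 0)\<rparr>"

definition central :: "('k::field \<Rightarrow> 'a::field) \<Rightarrow> int \<Rightarrow> ('a fls fls \<Rightarrow> 'a fls fls) \<times> 'a fls fls rel_elt" where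
  "central \<iota> n = (id, rel_int (L_tvs \<iota>) (\<O> 0) n)"

text \<open>
  The order of the factors fixes the sign of the pairing. Let \<open>x\<close>, \<open>y\<close> be lifts of \<open>t\<close>, \<open>u\<close>.
  Multiplication by \<open>t\<inverse>\<close> lowers dimension theories on \<open>\<O> 0 / \<O> 1\<close> by \<open>[k':k]\<close>, so \<open>t\<close>
  acts on \<open>[\<O> 0 | \<O> 1]\<close> as translation by \<open>-[k':k]\<close>, that is, \<open>x y x\<inverse> y\<inverse> = -[k':k]\<close>. The
  normalisation in which the value at \<open>t\<close> and \<open>u\<close> is \<open>+[k':k]\<close> is \<open>[x,y] = y x y\<inverse> x\<inverse>\<close>.
\<close>

definition commutator :: "('g, 'm) monoid_scheme \<Rightarrow> 'g \<Rightarrow> 'g \<Rightarrow> 'g" where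
  "commutator G x y = y \<otimes>\<^bsub>G\<^esub> x \<otimes>\<^bsub>G\<^esub> inv\<^bsub>G\<^esub> y \<otimes>\<^bsub>G\<^esub> inv\<^bsub>G\<^esub> x"

definition L_pairing ::
  "('k::field \<Rightarrow> 'a::field) \<Rightarrow> ('a fls fls \<Rightarrow> 'a fls fls) \<Rightarrow> ('a fls fls \<Rightarrow> 'a fls fls) \<Rightarrow> int"
where
  "L_pairing \<iota> a b = (THE n. \<forall>x\<in>carrier (GL_hat \<iota>). \<forall>y\<in>carrier (GL_hat \<iota>).
     fst x = a \<and> fst y = b \<longrightarrow> commutator (GL_hat \<iota>) x y = central \<iota> n)"


section \<open>The symbol\<close>

definition nu2 :: "'a::field fls fls \<Rightarrow> int" where
  "nu2 f = fls_subdegree f"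

definition nu1 :: "'a::field fls fls \<Rightarrow> int" where
  "nu1 f = fls_subdegree (fls_nth (f * fls_X_intpow (- nu2 f)) 0)"

definition nuL :: "'a::field fls fls \<Rightarrow> 'a fls fls \<Rightarrow> int" where
  "nuL f g = nu1 f * nu2 g - nu1 g * nu2 f"

end

theory Submission
  imports Defs
begin

text \<open>
  Write \<open>D = [k':k]\<close>. The poset of subspaces admissible for \<open>(\<O> m, \<O> n)\<close> has the greatest element
  \<open>\<O> (max m n)\<close>, and any element of \<open>[\<O> m | \<O> n]\<close> is determined by its component there or at any
  \<open>\<O> p\<close> with \<open>p \<ge> max m n\<close>. Evaluating dimension theories on \<open>\<O> m / \<O> p\<close> at the lattice of series
  whose coefficients of \<open>u\<^sup>i\<close>, \<open>i < p\<close>, lie in \<open>k'[[t]]\<close> therefore gives bijections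
  \<open>[\<O> m | \<O> n] \<rightarrow> \<int>\<close> that turn composition into addition. Multiplication by \<open>f\<close> maps \<open>\<O> m\<close> to
  \<open>\<O> (m + \<nu>\<^sub>2 f)\<close>; on each layer \<open>\<O> j / \<O> (j + 1)\<close> it is multiplication by the leading coefficient of
  \<open>f\<close>, which moves \<open>k'[[t]]\<close> to \<open>t\<^sup>a k'[[t]]\<close> with \<open>a = \<nu>\<^sub>1 f\<close>, a change of dimension by \<open>- D a\<close>. Hence
  \<open>f\<close> translates \<open>[\<O> m | \<O> n]\<close> by \<open>- D a (n - m)\<close>, the lifts of \<open>f\<close> and \<open>g\<close> multiply by
  \<open>(f, x) (g, y) = (f g, x + y - D \<nu>\<^sub>1(f) \<nu>\<^sub>2(g))\<close>, and the commutator can be read off.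
\<close>

section \<open>Codimension\<close>

text \<open>The points of \<open>\<O> m / \<O> p\<close> are cosets, and \<open>rel_dim\<close> even
  takes cosets of cosets. Subspaces of quotients are therefore replaced by their preimages in
  \<open>L\<close>, and dimensions by codimensions of pairs of subspaces of \<open>L\<close>;
  additivity along exact sequences becomes the modular law and the second isomorphism theorem. The
  product \<open>rel_comp\<close> is a definite description over all admissible subspaces, so a
  morphism given at one index has to be extended to the whole system. This works because tensoring
  with a fixed \<open>e\<close> in \<open>Dim (Y/Z)\<close> is a bijection from
  \<open>Dim (X/Y)\<close> to \<open>Dim (X/Z)\<close> when \<open>X/Z\<close> is linearly locally
  compact: a component is carried up to \<open>W1 \<inter> W2\<close> by cancelling
  \<open>e\<close>, and down to any other index by tensoring. Multiplication by \<open>f\<close>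
  does not respect the reference lattices, even up to a power of \<open>t\<close>, since the higher
  coefficients of \<open>f\<close> mix the powers of \<open>u\<close>. Only single layers see the
  leading coefficient alone. The sign of the pairing comes from the order of the factors in
  \<open>commutator\<close>, which antisymmetrises the cocycle with \<open>g\<close> in
  front.\<close>

locale kspace = vector_space scale
  for scale :: "'k::field \<Rightarrow> 'b::ab_group_add \<Rightarrow> 'b"
begin

definition qbasis :: "'b set \<Rightarrow> 'b set \<Rightarrow> 'b set \<Rightarrow> bool" where
  "qbasis P N T \<longleftrightarrow> finite T \<and> independent T \<and> T \<subseteq> P \<and> span T \<inter> N \<subseteq> {0} \<and>
     (\<forall>x\<in>P. \<exists>y\<in>span T. x - y \<in> N)"

text \<open>A relation rather than a number: it also asserts that \<open>P / N\<close> is finite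
  dimensional, which the total function \<open>cod\<close> cannot express.\<close>

definition has_cod :: "'b set \<Rightarrow> 'b set \<Rightarrow> nat \<Rightarrow> bool" where
  "has_cod P N n \<longleftrightarrow> subspace P \<and> subspace N \<and> N \<subseteq> P \<and> (\<exists>T. qbasis P N T \<and> card T = n)"

lemma subspace_set_plus: "subspace A \<Longrightarrow> subspace B \<Longrightarrow> subspace (A + B)"
  using subspace_sums[of A B] by (simp add: set_plus_def Bex_def conj_ac)

lemma set_plus_supset_left: "subspace B \<Longrightarrow> A \<subseteq> A + B"
  by (metis add.right_neutral set_plus_intro subsetI subspace_0)

lemma set_plus_supset_right: "subspace A \<Longrightarrow> B \<subseteq> A + B"
  by (metis add.left_neutral set_plus_intro subsetI subspace_0)

lemma set_plus_least: "subspace C \<Longrightarrow> A \<subseteq> C \<Longrightarrow> B \<subseteq> C \<Longrightarrow> A + B \<subseteq> C"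
  by (auto elim!: set_plus_elim intro: subspace_add)

lemma set_plus_absorb: "subspace A \<Longrightarrow> subspace B \<Longrightarrow> A \<subseteq> B \<Longrightarrow> A + B = B"
  by (simp add: set_plus_least set_plus_supset_right subset_antisym)

text \<open>Dedekind's modular law, the source of most identities between intersections and images
  in subquotients.\<close>

lemma subspace_modular:
  assumes "subspace N" "subspace Y" "N \<subseteq> Y"
  shows "(N + B) \<inter> Y = N + (B \<inter> Y)"
proof (intro equalityI subsetI)
  fix x assume "x \<in> (N + B) \<inter> Y"
  then obtain n b where nb: "n \<in> N" "b \<in> B" "x = n + b" "n + b \<in> Y"
    by (auto elim: set_plus_elim)
  then have "b \<in> Y" using subspace_diff[OF assms(2), of "n + b" n] assms(3) by auto
  then show "x \<in> N + (B \<inter> Y)" using nb by auto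
next
  fix x assume "x \<in> N + (B \<inter> Y)"
  then show "x \<in> (N + B) \<inter> Y" using assms
    by (auto elim!: set_plus_elim intro: subspace_add)
qed

text \<open>Replace each vector of \<open>B\<close> by a representative in \<open>span T\<close> of
  its class modulo \<open>N\<close>. Since \<open>span B\<close> meets \<open>N\<close> only in
  \<open>0\<close>, this is injective and preserves independence, and the exchange bound applies
  inside \<open>span T\<close>.\<close>

lemma independent_mod_bound:
  assumes T: "finite T" and N: "subspace N" and B: "independent B" "span B \<inter> N \<subseteq> {0}"
    and sp: "\<forall>x\<in>B. \<exists>y\<in>span T. x - y \<in> N"
  shows "finite B \<and> card B \<le> card T"
proof -
  obtain \<phi> where \<phi>: "\<And>x. x \<in> B \<Longrightarrow> \<phi> x \<in> span T \<and> x - \<phi> x \<in> N"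
    using bchoice[OF sp[unfolded Bex_def]] by blast
  have inj: "inj_on \<phi> B"
  proof (rule inj_onI)
    fix a b assume ab: "a \<in> B" "b \<in> B" "\<phi> a = \<phi> b"
    have "(a - \<phi> a) - (b - \<phi> b) \<in> N" using \<phi> ab subspace_diff[OF N] by blast
    then have "a - b \<in> N" using ab by simp
    moreover have "a - b \<in> span B" using ab by (simp add: span_base span_diff)
    ultimately show "a = b" using B by auto
  qed
  have "independent (\<phi> ` B)"
    unfolding independent_explicit_module
  proof (intro allI impI)
    fix S u v assume S: "finite S" "S \<subseteq> \<phi> ` B" "(\<Sum>v\<in>S. scale (u v) v) = 0" "v \<in> S"
    obtain S' where S': "S' \<subseteq> B" "inj_on \<phi> S'" "S = \<phi> ` S'"
      using S(2) subset_image_inj by metis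
    have fin: "finite S'" using S S' finite_imageD by blast
    have z: "(\<Sum>b\<in>S'. scale (u (\<phi> b)) (\<phi> b)) = 0"
      using S(3) S' by (simp add: sum.reindex)
    have "(\<Sum>b\<in>S'. scale (u (\<phi> b)) b) = (\<Sum>b\<in>S'. scale (u (\<phi> b)) (b - \<phi> b))"
      using z by (simp add: scale_right_diff_distrib sum_subtractf)
    moreover have "\<dots> \<in> N" using N S' \<phi> by (intro subspace_sum subspace_scale) auto
    moreover have "(\<Sum>b\<in>S'. scale (u (\<phi> b)) b) \<in> span B"
      using S' by (intro span_sum span_scale span_base) auto
    ultimately have "(\<Sum>b\<in>S'. scale (u (\<phi> b)) b) = 0" using B(2) by auto
    then have "\<forall>b\<in>S'. u (\<phi> b) = 0"
      using independentD[OF B(1) fin S'(1), of "\<lambda>b. u (\<phi> b)"] by blast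
    then show "u v = 0" using S S' by auto
  qed
  moreover have "\<phi> ` B \<subseteq> span T" using \<phi> by auto
  ultimately have "finite (\<phi> ` B)" "card (\<phi> ` B) \<le> card T"
    using independent_span_bound[OF T] by blast+
  then show ?thesis using inj by (simp add: card_image finite_image_iff)
qed

lemma has_cod_unique:
  assumes "has_cod P N m" "has_cod P N n"
  shows "m = n"
proof -
  have le: "m \<le> n" if "has_cod P N m" "has_cod P N n" for m n
  proof -
    obtain S T where "qbasis P N S" "card S = m" "qbasis P N T" "card T = n"
      using \<open>has_cod P N m\<close> \<open>has_cod P N n\<close> unfolding has_cod_def by blast
    moreover have "finite S \<and> card S \<le> card T" if "qbasis P N S" "qbasis P N T"
      by (rule independent_mod_bound[of T N S])
        (use that \<open>has_cod P N m\<close> in \<open>auto simp: qbasis_def has_cod_def\<close>)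
    ultimately show ?thesis by simp
  qed
  show ?thesis using le[OF assms] le[OF assms(2,1)] by simp
qed

text \<open>If a combination of \<open>S\<close> and \<open>T\<close> lies in \<open>M\<close>, so
  does its \<open>S\<close>-part, because \<open>T\<close> lies in \<open>M\<close>; that part
  vanishes and only the condition on \<open>T\<close> remains. This stacks representatives of
  \<open>P / M\<close> on those of \<open>M / N\<close>.\<close>

lemma qbasis_Un:
  assumes M: "subspace M" "subspace N"
    and S: "independent S" "span S \<inter> M \<subseteq> {0}"
    and T: "independent T" "span T \<inter> N \<subseteq> {0}" "T \<subseteq> M" "N \<subseteq> M"
  shows "independent (S \<union> T) \<and> span (S \<union> T) \<inter> N \<subseteq> {0} \<and> S \<inter> T = {}"
proof (intro conjI)
  have TM: "span T \<subseteq> M" using T M by (simp add: span_minimal)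
  show "S \<inter> T = {}"
  proof (rule ccontr)
    assume "S \<inter> T \<noteq> {}"
    then obtain x where x: "x \<in> S" "x \<in> T" by auto
    then have "x = 0" using S T span_base by blast
    then show False using x S(1) dependent_zero by blast
  qed
  then have disj: "S \<inter> T = {}" .
  show "independent (S \<union> T)"
    unfolding independent_explicit_module
  proof (intro allI impI)
    fix F u v assume F: "finite F" "F \<subseteq> S \<union> T" "(\<Sum>v\<in>F. scale (u v) v) = 0" "v \<in> F"
    have "(\<Sum>v\<in>F. scale (u v) v) = (\<Sum>v\<in>F \<inter> S. scale (u v) v) + (\<Sum>v\<in>F \<inter> T. scale (u v) v)"
      using F disj by (subst sum.union_disjoint[symmetric]) (auto simp: Int_Un_distrib[symmetric] Int_absorb2)
    then have eq: "(\<Sum>v\<in>F \<inter> S. scale (u v) v) = - (\<Sum>v\<in>F \<inter> T. scale (u v) v)"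
      using F(3) by (simp add: eq_neg_iff_add_eq_0)
    have inT: "(\<Sum>v\<in>F \<inter> T. scale (u v) v) \<in> span T"
      by (intro span_sum span_scale span_base) auto
    have inS: "(\<Sum>v\<in>F \<inter> S. scale (u v) v) \<in> span S"
      by (intro span_sum span_scale span_base) auto
    have S0: "(\<Sum>v\<in>F \<inter> S. scale (u v) v) = 0"
      using inS inT eq S(2) TM M subspace_neg by (metis IntI singletonD subsetD)
    then have T0: "(\<Sum>v\<in>F \<inter> T. scale (u v) v) = 0" using eq by simp
    show "u v = 0"
      using independentD[OF S(1) _ _ S0, of v] independentD[OF T(1) _ _ T0, of v] F by blast
  qed
  show "span (S \<union> T) \<inter> N \<subseteq> {0}"
  proof
    fix x assume "x \<in> span (S \<union> T) \<inter> N"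
    then obtain a b where ab: "a \<in> span S" "b \<in> span T" "x = a + b" "x \<in> N"
      unfolding span_Un by auto
    have "a = x - b" using ab by simp
    then have "a \<in> M" using ab TM T M subspace_diff by blast
    then have "a = 0" using S ab by auto
    then show "x \<in> {0}" using ab T by auto
  qed
qed

lemma qbasis_Un_spans:
  assumes "subspace N"
    and S: "\<forall>x\<in>P. \<exists>y\<in>span S. x - y \<in> M" and T: "\<forall>x\<in>M. \<exists>y\<in>span T. x - y \<in> N"
  shows "\<forall>x\<in>P. \<exists>y\<in>span (S \<union> T). x - y \<in> N"
proof
  fix x assume "x \<in> P"
  then obtain y where y: "y \<in> span S" "x - y \<in> M" using S by blast
  then obtain z where z: "z \<in> span T" "x - y - z \<in> N" using T by blast
  have "y + z \<in> span (S \<union> T)"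
    using y z span_mono[of S "S \<union> T"] span_mono[of T "S \<union> T"] by (intro span_add) auto
  then show "\<exists>y\<in>span (S \<union> T). x - y \<in> N" using z by (auto simp: diff_diff_eq intro!: bexI[of _ "y + z"])
qed

lemma has_cod_trans:
  assumes "has_cod P M a" "has_cod M N b"
  shows "has_cod P N (a + b)"
proof -
  obtain S T where ST: "qbasis P M S" "card S = a" "qbasis M N T" "card T = b"
    using assms unfolding has_cod_def by blast
  have sub: "subspace P" "subspace M" "subspace N" "N \<subseteq> M" "M \<subseteq> P"
    using assms unfolding has_cod_def by auto
  have u: "independent (S \<union> T) \<and> span (S \<union> T) \<inter> N \<subseteq> {0} \<and> S \<inter> T = {}"
    by (rule qbasis_Un[of M N]) (use ST sub in \<open>auto simp: qbasis_def\<close>)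
  have v: "\<forall>x\<in>P. \<exists>y\<in>span (S \<union> T). x - y \<in> N"
    by (rule qbasis_Un_spans[of N P S M T]) (use ST sub in \<open>auto simp: qbasis_def\<close>)
  have "card (S \<union> T) = a + b" using ST u by (auto simp: card_Un_disjoint qbasis_def)
  moreover have "qbasis P N (S \<union> T)"
    using u v ST sub by (auto simp: qbasis_def)
  ultimately show ?thesis using sub unfolding has_cod_def by blast
qed

text \<open>Extend a basis \<open>C\<close> of \<open>N\<close> to a basis \<open>D\<close> of
  \<open>P\<close> and keep \<open>D - C\<close>. No finiteness enters, so representatives are
  available before a quotient is known to be finite dimensional.\<close>

lemma complement_basis_exists:
  assumes "subspace P" "subspace N" "N \<subseteq> P"
  shows "\<exists>B. independent B \<and> B \<subseteq> P \<and> span B \<inter> N \<subseteq> {0} \<and> (\<forall>x\<in>P. \<exists>y\<in>span B. x - y \<in> N)"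
proof -
  obtain C where C: "C \<subseteq> N" "independent C" "N \<subseteq> span C"
    using maximal_independent_subset[of N] by blast
  have CN: "span C = N" using C assms by (simp add: span_subspace)
  obtain D where D: "C \<subseteq> D" "D \<subseteq> P" "independent D" "P \<subseteq> span D"
    using maximal_independent_subset_extend[of C P] C assms by blast
  have ind: "independent (D - C)" using D independent_mono by blast
  have z: "span (D - C) \<inter> N \<subseteq> {0}"
  proof
    fix x assume x: "x \<in> span (D - C) \<inter> N"
    then have "x \<in> span (D - C)" "x \<in> span C" using CN by auto
    then obtain r s where r: "finite r" "r \<subseteq> D - C" "finite s" "s \<subseteq> C"
      and ex: "\<exists>a b. x = (\<Sum>v\<in>r. scale (a v) v) \<and> x = (\<Sum>v\<in>s. scale (b v) v)"
      unfolding span_explicit by blast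
    then obtain a b where ab: "x = (\<Sum>v\<in>r. scale (a v) v)" "x = (\<Sum>v\<in>s. scale (b v) v)" by blast
    have disj: "r \<inter> s = {}" using r by auto
    \<comment> \<open>The two expansions of \<open>x\<close> are subtracted, which gives a linear
      relation inside the independent set \<open>D\<close>.\<close>
    let ?u = "\<lambda>v. if v \<in> r then a v else - b v"
    have "(\<Sum>v\<in>r \<union> s. scale (?u v) v) = (\<Sum>v\<in>r. scale (?u v) v) + (\<Sum>v\<in>s. scale (?u v) v)"
      using r disj by (simp add: sum.union_disjoint)
    also have "(\<Sum>v\<in>s. scale (?u v) v) = (\<Sum>v\<in>s. - scale (b v) v)"
      using disj by (intro sum.cong) (auto simp: disjoint_iff)
    also have "(\<Sum>v\<in>r. scale (?u v) v) = x" using ab(1) by simp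
    finally have "(\<Sum>v\<in>r \<union> s. scale (?u v) v) = 0" using ab(2) by (simp add: sum_negf)
    then have "\<forall>v\<in>r \<union> s. ?u v = 0"
      using independentD[OF D(3), of "r \<union> s" ?u] r D(1) by blast
    then have "\<forall>v\<in>r. a v = 0" by (metis UnI1)
    then show "x \<in> {0}" using ab(1) by simp
  qed
  have "\<forall>x\<in>P. \<exists>y\<in>span (D - C). x - y \<in> N"
  proof
    fix x assume "x \<in> P"
    then have "x \<in> span ((D - C) \<union> C)" using D by (auto simp: Un_absorb2)
    then obtain y w where "y \<in> span (D - C)" "w \<in> span C" "x = y + w"
      unfolding span_Un by auto
    then show "\<exists>y\<in>span (D - C). x - y \<in> N" using CN by (intro bexI[of _ y]) auto
  qed
  then show ?thesis using ind z D(2) by (intro exI[of _ "D - C"]) auto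
qed

text \<open>Representatives of \<open>P / M\<close> and \<open>M / N\<close> together are
  independent modulo \<open>N\<close>, hence at most as many as the finite set for
  \<open>P / N\<close>. Finiteness of both steps follows, and additivity gives the sum.\<close>

lemma has_cod_split:
  assumes PN: "has_cod P N n" and M: "subspace M" "N \<subseteq> M" "M \<subseteq> P"
  obtains a b where "has_cod P M a" "has_cod M N b" "n = a + b"
proof -
  have sub: "subspace P" "subspace N" using PN unfolding has_cod_def by auto
  obtain T where T: "qbasis P N T" "card T = n" using PN unfolding has_cod_def by auto
  obtain S where S: "independent S" "S \<subseteq> P" "span S \<inter> M \<subseteq> {0}" "\<forall>x\<in>P. \<exists>y\<in>span S. x - y \<in> M"
    using complement_basis_exists[of P M] sub M by blast
  obtain R where R: "independent R" "R \<subseteq> M" "span R \<inter> N \<subseteq> {0}" "\<forall>x\<in>M. \<exists>y\<in>span R. x - y \<in> N"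
    using complement_basis_exists[of M N] sub M by blast
  have u: "independent (S \<union> R) \<and> span (S \<union> R) \<inter> N \<subseteq> {0} \<and> S \<inter> R = {}"
    by (rule qbasis_Un[of M N]) (use S R sub M in auto)
  have "finite (S \<union> R)"
  proof (rule independent_mod_bound[of T N "S \<union> R", THEN conjunct1])
    show "\<forall>x\<in>S \<union> R. \<exists>y\<in>span T. x - y \<in> N"
      using T(1) S(2) R(2) M(3) by (auto simp: qbasis_def)
  qed (use u T sub in \<open>auto simp: qbasis_def\<close>)
  then have f: "finite S" "finite R" by auto
  have "qbasis P M S" "qbasis M N R" using f S R by (simp_all add: qbasis_def)
  then have a: "has_cod P M (card S)" "has_cod M N (card R)"
    using sub M by (auto simp: has_cod_def)
  from has_cod_trans[OF this] have "n = card S + card R" using PN has_cod_unique by blast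
  then show thesis using a that by blast
qed

text \<open>One and the same set of representatives, chosen inside \<open>A\<close>, serves both
  quotients. For the converse direction its finiteness is borrowed from
  \<open>(A + B) / B\<close>.\<close>

lemma has_cod_second_iso:
  assumes "subspace A" "subspace B"
  shows "has_cod (A + B) B n \<longleftrightarrow> has_cod A (A \<inter> B) n"
proof -
  have spans_plus: "\<exists>y\<in>span T. x - y \<in> B"
    if T: "\<forall>x\<in>A. \<exists>y\<in>span T. x - y \<in> A \<inter> B" and x: "x \<in> A + B" for T x
  proof -
    obtain a b where ab: "a \<in> A" "b \<in> B" "x = a + b" using x by (rule set_plus_elim)
    then obtain y where y: "y \<in> span T" "a - y \<in> B" using T by blast
    then have "x - y = (a - y) + b" using ab by (simp add: algebra_simps)
    then show ?thesis using y ab assms subspace_add by metis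
  qed
  show ?thesis
  proof
    assume "has_cod A (A \<inter> B) n"
    then obtain T where T: "qbasis A (A \<inter> B) T" "card T = n" unfolding has_cod_def by blast
    have TA: "span T \<subseteq> A" using T assms by (simp add: qbasis_def span_minimal)
    have 1: "\<exists>y\<in>span T. x - y \<in> B" if "x \<in> A + B" for x
      using T(1) that by (intro spans_plus) (auto simp: qbasis_def)
    have "qbasis (A + B) B T"
      using T TA 1 set_plus_supset_left[of B A] assms by (auto simp: qbasis_def)
    then show "has_cod (A + B) B n" using assms T(2)
      by (auto simp: has_cod_def subspace_set_plus set_plus_supset_right)
  next
    assume AB: "has_cod (A + B) B n"
    obtain T where T: "independent T" "T \<subseteq> A" "span T \<inter> (A \<inter> B) \<subseteq> {0}"
        "\<forall>x\<in>A. \<exists>y\<in>span T. x - y \<in> A \<inter> B"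
      using complement_basis_exists[of A "A \<inter> B"] assms by (auto simp: subspace_inter)
    have TA: "span T \<subseteq> A" using T assms by (simp add: span_minimal)
    note 1 = spans_plus[OF T(4)]
    have TB: "span T \<inter> B \<subseteq> {0}" "T \<subseteq> A + B"
      using T TA set_plus_supset_left[of B A] assms by auto
    obtain S where S: "qbasis (A + B) B S" "card S = n" using AB unfolding has_cod_def by blast
    have fin: "finite T"
      by (rule independent_mod_bound[of S B T, THEN conjunct1]) (use S T TB assms in \<open>auto simp: qbasis_def\<close>)
    then have "qbasis (A + B) B T" "qbasis A (A \<inter> B) T"
      using T TB 1 by (auto simp: qbasis_def)
    then have "has_cod (A + B) B (card T)" "has_cod A (A \<inter> B) (card T)"
      using AB assms unfolding has_cod_def by (auto simp: subspace_inter)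
    then show "has_cod A (A \<inter> B) n" using AB has_cod_unique by blast
  qed
qed

lemma has_cod_image:
  assumes g: "Vector_Spaces.linear scale scale g" "inj g" and PN: "has_cod P N n"
  shows "has_cod (g ` P) (g ` N) n"
proof -
  interpret g: Vector_Spaces.linear scale scale g by (rule g)
  obtain T where T: "qbasis P N T" "card T = n" using PN unfolding has_cod_def by blast
  have "qbasis (g ` P) (g ` N) (g ` T)"
    unfolding qbasis_def
  proof (intro conjI ballI)
    show "independent (g ` T)"
      using T g g.independent_inj_image by (simp add: qbasis_def)
    have "span (g ` T) \<inter> g ` N = g ` (span T \<inter> N)" using g by (simp add: g.span_image image_Int)
    then show "span (g ` T) \<inter> g ` N \<subseteq> {0}" using T unfolding qbasis_def by auto
    fix x assume "x \<in> g ` P"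
    then obtain p where p: "p \<in> P" "x = g p" by auto
    then obtain y where "y \<in> span T" "p - y \<in> N" using T unfolding qbasis_def by blast
    then show "\<exists>y\<in>span (g ` T). x - y \<in> g ` N"
      using p by (intro bexI[of _ "g y"]) (auto simp: g.span_image g.diff[symmetric])
  qed (use T in \<open>auto simp: qbasis_def\<close>)
  moreover have "card (g ` T) = n" using T g by (metis card_image inj_on_subset subset_UNIV)
  ultimately show ?thesis
    using PN g.subspace_image unfolding has_cod_def by blast
qed

lemma has_cod_refl: "subspace P \<Longrightarrow> has_cod P P 0"
  unfolding has_cod_def qbasis_def
  by (auto intro!: exI[of _ "{}"] bexI[of _ 0] simp: subspace_0 independent_empty)

section \<open>Relative dimension of commensurable subspaces\<close>

definition cod :: "'b set \<Rightarrow> 'b set \<Rightarrow> nat" where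
  "cod P N = (THE n. has_cod P N n)"

text \<open>\<open>reldim P Q\<close> is \<open>dim Q - dim P\<close> relative to a common subspace of finite codimension.\<close>

definition reldim :: "'b set \<Rightarrow> 'b set \<Rightarrow> int" where
  "reldim P Q = int (cod Q (P \<inter> Q)) - int (cod P (P \<inter> Q))"

lemma cod_eq: "has_cod P N n \<Longrightarrow> cod P N = n"
  unfolding cod_def using has_cod_unique by blast

text \<open>Any common subspace \<open>K\<close> of finite codimension may replace
  \<open>P \<inter> Q\<close>: the contribution of \<open>(P \<inter> Q) / K\<close>
  cancels.\<close>

lemma reldim_eq:
  assumes "has_cod P K a" "has_cod Q K b"
  shows "reldim P Q = int b - int a"
proof -
  have s: "subspace (P \<inter> Q)" "K \<subseteq> P \<inter> Q" using assms by (auto simp: has_cod_def subspace_inter)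
  obtain a1 a2 where a: "has_cod P (P \<inter> Q) a1" "has_cod (P \<inter> Q) K a2" "a = a1 + a2"
    using has_cod_split[OF assms(1) s] by auto
  obtain b1 b2 where b: "has_cod Q (P \<inter> Q) b1" "has_cod (P \<inter> Q) K b2" "b = b1 + b2"
    using has_cod_split[OF assms(2) s] by auto
  show ?thesis using a b has_cod_unique[OF a(2) b(2)] by (simp add: reldim_def cod_eq)
qed

definition commens :: "'b set \<Rightarrow> 'b set \<Rightarrow> bool" where
  "commens P Q \<longleftrightarrow> (\<exists>a b. has_cod P (P \<inter> Q) a \<and> has_cod Q (P \<inter> Q) b)"

text \<open>\<open>Q / (Q \<inter> N)\<close> is \<open>(Q + N) / N\<close>, a subspace of
  \<open>P / N\<close>.\<close>

lemma has_cod_Int: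
  assumes "has_cod P N a" "subspace Q" "Q \<subseteq> P"
  obtains b where "has_cod Q (Q \<inter> N) b"
proof -
  have N: "subspace N" "N \<subseteq> P" "subspace P" using assms by (auto simp: has_cod_def)
  have QN: "subspace (Q + N)" "N \<subseteq> Q + N" "Q + N \<subseteq> P"
    using N assms by (simp_all add: subspace_set_plus set_plus_supset_right set_plus_least)
  show thesis using has_cod_split[OF assms(1) QN] that has_cod_second_iso[OF assms(2) N(1)] by metis
qed

text \<open>The triple intersection serves as \<open>K\<close>. Comparing all three spaces with one
  \<open>K\<close> makes \<open>reldim\<close> additive.\<close>

lemma commens_common:
  assumes "commens P Q" "commens Q R"
  obtains K a b c where "has_cod P K a" "has_cod Q K b" "has_cod R K c"
proof -
  obtain a b where 1: "has_cod P (P \<inter> Q) a" "has_cod Q (P \<inter> Q) b" using assms(1) by (auto simp: commens_def)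
  obtain c d where 2: "has_cod Q (Q \<inter> R) c" "has_cod R (Q \<inter> R) d" using assms(2) by (auto simp: commens_def)
  have s: "subspace (P \<inter> Q)" "subspace (Q \<inter> R)" using 1 2 by (auto simp: has_cod_def)
  obtain e where e: "has_cod (P \<inter> Q) (P \<inter> Q \<inter> (Q \<inter> R)) e" using has_cod_Int[OF 2(1) s(1)] by blast
  obtain f where f: "has_cod (Q \<inter> R) (Q \<inter> R \<inter> (P \<inter> Q)) f" using has_cod_Int[OF 1(2) s(2)] by blast
  have eq: "Q \<inter> R \<inter> (P \<inter> Q) = P \<inter> Q \<inter> (Q \<inter> R)" by blast
  show thesis
    using that[OF has_cod_trans[OF 1(1) e] has_cod_trans[OF 1(2) e] has_cod_trans[OF 2(2) f[unfolded eq]]] .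
qed

lemma reldim_trans:
  assumes "commens P Q" "commens Q R"
  shows "reldim P R = reldim P Q + reldim Q R"
  by (rule commens_common[OF assms]) (simp add: reldim_eq)

lemma reldim_image:
  assumes g: "Vector_Spaces.linear scale scale g" "inj g" and PQ: "commens P Q"
  shows "reldim (g ` P) (g ` Q) = reldim P Q"
proof -
  obtain a b where 1: "has_cod P (P \<inter> Q) a" "has_cod Q (P \<inter> Q) b" using PQ by (auto simp: commens_def)
  then show ?thesis
    using reldim_eq[OF 1] reldim_eq[OF has_cod_image[OF g 1(1)] has_cod_image[OF g 1(2)]] by simp
qed

text \<open>The chain \<open>K \<subseteq> K + (P \<inter> Y) \<subseteq> P\<close> splits
  \<open>P / K\<close> into the part inside \<open>Y\<close> and the image modulo \<open>Y\<close>;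
  the second isomorphism theorem rewrites both steps.\<close>

lemma has_cod_exact:
  assumes PK: "has_cod P K n" and Y: "subspace Y"
  obtains a b where "has_cod (P \<inter> Y) (K \<inter> Y) a" "has_cod (P + Y) (K + Y) b" "n = a + b"
proof -
  have s: "subspace P" "subspace K" "K \<subseteq> P" using PK by (auto simp: has_cod_def)
  have M: "subspace (K + (P \<inter> Y))" "K \<subseteq> K + (P \<inter> Y)" "K + (P \<inter> Y) \<subseteq> P"
    using s Y by (simp_all add: subspace_set_plus subspace_inter set_plus_supset_left set_plus_least)
  obtain a b where ab: "has_cod P (K + (P \<inter> Y)) b" "has_cod (K + (P \<inter> Y)) K a" "n = b + a"
    using has_cod_split[OF PK M] by blast
  have "has_cod ((P \<inter> Y) + K) K a" using ab by (simp add: add.commute)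
  then have "has_cod (P \<inter> Y) (P \<inter> Y \<inter> K) a"
    using has_cod_second_iso[of "P \<inter> Y" K a] s Y by (simp add: subspace_inter)
  moreover have "P \<inter> Y \<inter> K = K \<inter> Y" using s by blast
  moreover have "has_cod (P + (K + Y)) (K + Y) b"
  proof -
    have "P \<inter> (K + Y) = K + (P \<inter> Y)"
      using subspace_modular[of K P Y] s by (simp add: Int_commute)
    then show ?thesis using ab has_cod_second_iso[of P "K + Y" b] s Y by (simp add: subspace_set_plus)
  qed
  moreover have "P + (K + Y) = P + Y"
    using set_plus_absorb[OF s(2,1,3)] by (metis add.assoc add.commute)
  ultimately show thesis using that[of a b] ab by simp
qed

text \<open>This additivity is what makes the tensor product of two dimension theories a dimension
  theory.\<close>

lemma reldim_exact:
  assumes PQ: "commens P Q" and Y: "subspace Y"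
  shows "reldim P Q = reldim (P \<inter> Y) (Q \<inter> Y) + reldim (P + Y) (Q + Y)"
proof -
  obtain a b where 1: "has_cod P (P \<inter> Q) a" "has_cod Q (P \<inter> Q) b" using PQ by (auto simp: commens_def)
  obtain a1 a2 where a: "has_cod (P \<inter> Y) (P \<inter> Q \<inter> Y) a1" "has_cod (P + Y) (P \<inter> Q + Y) a2" "a = a1 + a2"
    by (rule has_cod_exact[OF 1(1) Y])
  obtain b1 b2 where b: "has_cod (Q \<inter> Y) (P \<inter> Q \<inter> Y) b1" "has_cod (Q + Y) (P \<inter> Q + Y) b2" "b = b1 + b2"
    by (rule has_cod_exact[OF 1(2) Y])
  show ?thesis using reldim_eq[OF 1] reldim_eq[OF a(1) b(1)] reldim_eq[OF a(2) b(2)] a b by simp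
qed

end

section \<open>Presented quotient modules\<close>

lemma coset_conv: "A +>\<^bsub>R\<^esub> x = (\<lambda>a. a \<oplus>\<^bsub>R\<^esub> x) ` A"
  by (auto simp: a_r_coset_def r_coset_def)

lemma set_add_conv: "A <+>\<^bsub>R\<^esub> B = (\<Union>a\<in>A. (\<lambda>b. a \<oplus>\<^bsub>R\<^esub> b) ` B)"
  by (auto simp: set_add_def set_mult_def)

lemma a_rcosets_conv: "a_rcosets\<^bsub>R\<^esub> A = (\<lambda>x. A +>\<^bsub>R\<^esub> x) ` carrier R"
  by (auto simp: A_RCOSETS_def RCOSETS_def a_r_coset_def)

text \<open>
  Spaces of cosets of cosets occur in \<open>rel_dim\<close>; presenting every quotient by subspaces \<open>N \<subseteq> P\<close> of
  one ambient space treats them on the same footing as simple quotients.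
\<close>

locale presented = kspace scale
  for scale :: "'k::field \<Rightarrow> 'b::ab_group_add \<Rightarrow> 'b" +
  fixes P N :: "'b set" and Q :: "('k, 'q, 'm) module_scheme" and \<pi> :: "'b \<Rightarrow> 'q"
  assumes sub: "subspace P" "subspace N" "N \<subseteq> P"
    and carrier_eq: "carrier Q = \<pi> ` P" and zero_eq: "\<zero>\<^bsub>Q\<^esub> = \<pi> 0"
    and add_eq: "x \<in> P \<Longrightarrow> y \<in> P \<Longrightarrow> \<pi> x \<oplus>\<^bsub>Q\<^esub> \<pi> y = \<pi> (x + y)"
    and smult_eq: "x \<in> P \<Longrightarrow> c \<odot>\<^bsub>Q\<^esub> \<pi> x = \<pi> (scale c x)"
    and eq_iff: "x \<in> P \<Longrightarrow> y \<in> P \<Longrightarrow> \<pi> x = \<pi> y \<longleftrightarrow> x - y \<in> N"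
begin

lemma abelian_group: "abelian_group Q"
proof (rule abelian_groupI)
  fix x assume "x \<in> carrier Q"
  then obtain p where p: "p \<in> P" "x = \<pi> p" by (auto simp: carrier_eq)
  then have "\<pi> (- p) \<oplus>\<^bsub>Q\<^esub> x = \<zero>\<^bsub>Q\<^esub>"
    using sub by (simp add: add_eq zero_eq subspace_neg)
  then show "\<exists>y\<in>carrier Q. y \<oplus>\<^bsub>Q\<^esub> x = \<zero>\<^bsub>Q\<^esub>"
    using p sub by (auto simp: carrier_eq subspace_neg)
qed (use sub in \<open>auto simp: carrier_eq zero_eq add_eq subspace_add subspace_0 ac_simps\<close>)

lemma minus_eq:
  assumes "x \<in> P" "y \<in> P"
  shows "\<pi> x \<ominus>\<^bsub>Q\<^esub> \<pi> y = \<pi> (x - y)"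
proof -
  interpret Q: abelian_group Q by (rule abelian_group)
  have "\<pi> (- y) \<oplus>\<^bsub>Q\<^esub> \<pi> y = \<zero>\<^bsub>Q\<^esub>"
    using assms sub by (simp add: add_eq zero_eq subspace_neg)
  then have "\<ominus>\<^bsub>Q\<^esub> \<pi> y = \<pi> (- y)"
    using assms sub by (intro Q.minus_equality) (auto simp: carrier_eq subspace_neg)
  then show ?thesis
    using assms sub by (simp add: a_minus_def add_eq subspace_neg)
qed

lemma finsum_eq:
  assumes "finite S" "\<And>s. s \<in> S \<Longrightarrow> f s \<in> P"
  shows "(\<Oplus>\<^bsub>Q\<^esub>s\<in>S. \<pi> (f s)) = \<pi> (\<Sum>s\<in>S. f s)"
proof -
  interpret Q: abelian_group Q by (rule abelian_group)
  show ?thesis using assms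
  proof (induction S rule: finite_induct)
    case (insert s S)
    have "(\<Oplus>\<^bsub>Q\<^esub>s\<in>insert s S. \<pi> (f s)) = \<pi> (f s) \<oplus>\<^bsub>Q\<^esub> (\<Oplus>\<^bsub>Q\<^esub>s\<in>S. \<pi> (f s))"
      using insert by (intro Q.finsum_insert) (auto simp: carrier_eq)
    also have "\<dots> = \<pi> (f s + (\<Sum>s\<in>S. f s))"
      using insert sub by (simp add: add_eq subspace_sum)
    finally show ?case using insert by simp
  qed (simp add: zero_eq)
qed

context
  fixes S :: "'q set" and \<rho> :: "'q \<Rightarrow> 'b"
  assumes fin: "finite S" and lift: "\<And>s. s \<in> S \<Longrightarrow> \<rho> s \<in> P \<and> \<pi> (\<rho> s) = s"
begin

lemma inj_lift: "inj_on \<rho> S"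
  by (metis inj_onI lift)

lemma comb_eq: "(\<Oplus>\<^bsub>Q\<^esub>s\<in>S. c s \<odot>\<^bsub>Q\<^esub> s) = \<pi> (\<Sum>s\<in>S. scale (c s) (\<rho> s))"
proof -
  interpret Q: abelian_group Q by (rule abelian_group)
  have eq: "c s \<odot>\<^bsub>Q\<^esub> s = \<pi> (scale (c s) (\<rho> s))" if "s \<in> S" for s
    using lift[OF that] smult_eq[of "\<rho> s" "c s"] by simp
  have "(\<Oplus>\<^bsub>Q\<^esub>s\<in>S. c s \<odot>\<^bsub>Q\<^esub> s) = (\<Oplus>\<^bsub>Q\<^esub>s\<in>S. \<pi> (scale (c s) (\<rho> s)))"
    using eq lift sub by (intro Q.finsum_cong') (auto simp: carrier_eq subspace_scale)
  also have "\<dots> = \<pi> (\<Sum>s\<in>S. scale (c s) (\<rho> s))"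
    using lift sub by (intro finsum_eq[OF fin]) (auto simp: subspace_scale)
  finally show ?thesis .
qed

lemma vbasis_iff_comb:
  "vbasis Q S \<longleftrightarrow> (\<forall>x\<in>P. \<exists>!c. c \<in> S \<rightarrow>\<^sub>E UNIV \<and> x - (\<Sum>s\<in>S. scale (c s) (\<rho> s)) \<in> N)"
proof -
  have "S \<subseteq> carrier Q" using lift by (force simp: carrier_eq)
  moreover have "(\<Sum>s\<in>S. scale (c s) (\<rho> s)) \<in> P" for c
    using lift sub by (auto intro!: subspace_sum subspace_scale)
  ultimately show ?thesis
    by (simp add: vbasis_def fin comb_eq carrier_eq eq_iff)
qed

text \<open>Existence of coordinates says that the representatives span \<open>P\<close> modulo
  \<open>N\<close>; uniqueness says both that they are independent and that their span meets
  \<open>N\<close> only in \<open>0\<close>.\<close>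

lemma vbasis_iff_qbasis: "vbasis Q S \<longleftrightarrow> qbasis P N (\<rho> ` S)"
proof
  assume vb: "vbasis Q S"
  have zero: "\<forall>s\<in>S. c s = 0" if "(\<Sum>s\<in>S. scale (c s) (\<rho> s)) \<in> N" for c
  proof -
    \<comment> \<open>Uniqueness of coordinates is used for the zero vector, which has the given
      coefficients as well as the zero ones; restricting to \<open>S\<close> makes both
      extensional.\<close>
    define G where "G c \<longleftrightarrow> c \<in> S \<rightarrow>\<^sub>E UNIV \<and> 0 - (\<Sum>s\<in>S. scale (c s) (\<rho> s)) \<in> N" for c
    have 1: "G (restrict c S)" using that sub by (simp add: G_def subspace_neg)
    have 2: "G (\<lambda>s\<in>S. 0)" using sub by (simp add: G_def subspace_0)
    have "\<exists>!c. G c"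
      using vb sub subspace_0 unfolding vbasis_iff_comb G_def by blast
    then have "restrict c S = (\<lambda>s\<in>S. 0)" using 1 2 by blast
    then show ?thesis by (metis restrict_apply')
  qed
  have comb: "(\<Sum>t\<in>\<rho> ` S. scale (u t) t) = (\<Sum>s\<in>S. scale (u (\<rho> s)) (\<rho> s))" for u
    using inj_lift by (simp add: sum.reindex)
  show "qbasis P N (\<rho> ` S)"
    unfolding qbasis_def
  proof (intro conjI ballI subsetI)
    show "independent (\<rho> ` S)"
    proof -
      have "\<forall>s\<in>S. u (\<rho> s) = 0" if "(\<Sum>s\<in>S. scale (u (\<rho> s)) (\<rho> s)) = 0" for u
        by (rule zero[of "\<lambda>s. u (\<rho> s)"]) (use that sub subspace_0 in auto)
      then show ?thesis using fin by (auto simp: dependent_finite comb)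
    qed
    fix x assume "x \<in> span (\<rho> ` S) \<inter> N"
    then obtain u where "x = (\<Sum>s\<in>S. scale (u (\<rho> s)) (\<rho> s))" "x \<in> N"
      using fin by (auto simp: span_finite comb)
    then show "x \<in> {0}" using zero[of "\<lambda>s. u (\<rho> s)"] by simp
  next
    fix x assume "x \<in> P"
    then obtain c where "x - (\<Sum>s\<in>S. scale (c s) (\<rho> s)) \<in> N"
      using vb unfolding vbasis_iff_comb by blast
    then show "\<exists>y\<in>span (\<rho> ` S). x - y \<in> N"
      by (rule rev_bexI[rotated]) (intro span_sum span_scale span_base imageI)
  qed (use fin lift in auto)
next
  assume qb: "qbasis P N (\<rho> ` S)"
  have comb: "(\<Sum>t\<in>\<rho> ` S. scale (u t) t) = (\<Sum>s\<in>S. scale (u (\<rho> s)) (\<rho> s))" for u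
    using inj_lift by (simp add: sum.reindex)
  show "vbasis Q S"
    unfolding vbasis_iff_comb
  proof (intro ballI ex_ex1I)
    fix x assume "x \<in> P"
    then obtain y where y: "y \<in> span (\<rho> ` S)" "x - y \<in> N" using qb unfolding qbasis_def by blast
    then obtain u where u: "y = (\<Sum>s\<in>S. scale (u (\<rho> s)) (\<rho> s))"
      using fin by (auto simp: span_finite comb)
    have "(\<Sum>s\<in>S. scale ((\<lambda>s\<in>S. u (\<rho> s)) s) (\<rho> s)) = y"
      unfolding u by (intro sum.cong) auto
    then show "\<exists>c. c \<in> S \<rightarrow>\<^sub>E UNIV \<and> x - (\<Sum>s\<in>S. scale (c s) (\<rho> s)) \<in> N"
      using y by (intro exI[of _ "\<lambda>s\<in>S. u (\<rho> s)"]) auto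
  next
    fix x c d
    assume c: "c \<in> S \<rightarrow>\<^sub>E UNIV \<and> x - (\<Sum>s\<in>S. scale (c s) (\<rho> s)) \<in> N"
      and d: "d \<in> S \<rightarrow>\<^sub>E UNIV \<and> x - (\<Sum>s\<in>S. scale (d s) (\<rho> s)) \<in> N"
    \<comment> \<open>The difference of the two coordinate families, transported to the
      representatives, gives a vector in both \<open>N\<close> and the span.\<close>
    let ?u = "\<lambda>t. c (inv_into S \<rho> t) - d (inv_into S \<rho> t)"
    have "(\<Sum>t\<in>\<rho> ` S. scale (?u t) t) = (\<Sum>s\<in>S. scale (c s - d s) (\<rho> s))"
      unfolding comb using inj_lift by (intro sum.cong) auto
    also have "\<dots> = (x - (\<Sum>s\<in>S. scale (d s) (\<rho> s))) - (x - (\<Sum>s\<in>S. scale (c s) (\<rho> s)))"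
      by (simp add: scale_left_diff_distrib sum_subtractf)
    also have "\<dots> \<in> N"
      by (rule subspace_diff[OF sub(2) conjunct2[OF d] conjunct2[OF c]])
    finally have "(\<Sum>t\<in>\<rho> ` S. scale (?u t) t) \<in> N" .
    moreover have "(\<Sum>t\<in>\<rho> ` S. scale (?u t) t) \<in> span (\<rho> ` S)"
      by (intro span_sum span_scale span_base)
    ultimately have "(\<Sum>t\<in>\<rho> ` S. scale (?u t) t) = 0" using qb unfolding qbasis_def by blast
    then have "\<forall>t\<in>\<rho> ` S. ?u t = 0"
      using qb independentD[of "\<rho> ` S" "\<rho> ` S" ?u] unfolding qbasis_def by blast
    then have "\<forall>s\<in>S. c s = d s" using inj_lift by simp
    then show "c = d" using c d by (meson PiE_ext)
  qed
qed

end

text \<open>A basis lifts to representatives by choice. Conversely \<open>\<pi>\<close> is injective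
  on a \<open>qbasis\<close>, since a difference of two of its vectors in \<open>N\<close> is
  \<open>0\<close>. Thus \<open>vdim\<close> inherits uniqueness from
  \<open>has_cod\<close>.\<close>

lemma vbasis_card_iff: "(\<exists>S. vbasis Q S \<and> card S = n) \<longleftrightarrow> has_cod P N n"
proof
  assume "\<exists>S. vbasis Q S \<and> card S = n"
  then obtain S where S: "vbasis Q S" "card S = n" by blast
  have "\<forall>s\<in>S. \<exists>p. p \<in> P \<and> \<pi> p = s" using S by (auto simp: vbasis_def carrier_eq)
  then obtain \<rho> where \<rho>: "\<And>s. s \<in> S \<Longrightarrow> \<rho> s \<in> P \<and> \<pi> (\<rho> s) = s" by metis
  have fin: "finite S" using S by (simp add: vbasis_def)
  have "qbasis P N (\<rho> ` S)" using vbasis_iff_qbasis[OF fin \<rho>] S by blast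
  moreover have "card (\<rho> ` S) = n" using inj_lift[OF fin \<rho>] S by (simp add: card_image)
  ultimately show "has_cod P N n" using sub unfolding has_cod_def by blast
next
  assume "has_cod P N n"
  then obtain T where T: "qbasis P N T" "card T = n" unfolding has_cod_def by blast
  have inj: "inj_on \<pi> T"
  proof (rule inj_onI)
    fix a b assume ab: "a \<in> T" "b \<in> T" "\<pi> a = \<pi> b"
    then have "a - b \<in> N" using T eq_iff unfolding qbasis_def by blast
    moreover have "a - b \<in> span T" using ab by (simp add: span_base span_diff)
    ultimately show "a = b" using T by (auto simp: qbasis_def)
  qed
  have lift: "inv_into T \<pi> s \<in> P \<and> \<pi> (inv_into T \<pi> s) = s" if "s \<in> \<pi> ` T" for s
    using that T inv_into_into[OF that] f_inv_into_f[OF that] by (auto simp: qbasis_def)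
  have fin: "finite (\<pi> ` T)" using T by (simp add: qbasis_def)
  have "inv_into T \<pi> ` (\<pi> ` T) = T" using inj by simp
  then have "vbasis Q (\<pi> ` T)" using vbasis_iff_qbasis[OF fin lift] T by simp
  then show "\<exists>S. vbasis Q S \<and> card S = n" using T inj by (metis card_image)
qed

lemma fin_dimensional_iff: "fin_dimensional Q \<longleftrightarrow> (\<exists>n. has_cod P N n)"
  using vbasis_card_iff unfolding fin_dimensional_def by blast

lemma vdim_eq_cod: "vdim Q = cod P N"
  unfolding vdim_def cod_def vbasis_card_iff ..

lemma vsubspace_image:
  assumes "subspace M" "M \<subseteq> P"
  shows "vsubspace Q (\<pi> ` M)"
  unfolding vsubspace_def
proof (intro conjI ballI allI)
  fix x y assume "x \<in> \<pi> ` M" "y \<in> \<pi> ` M"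
  then obtain a b where "a \<in> M" "b \<in> M" "x = \<pi> a" "y = \<pi> b" by auto
  then show "x \<oplus>\<^bsub>Q\<^esub> y \<in> \<pi> ` M" using assms add_eq[of a b] subspace_add[of M a b] by auto
next
  fix c x assume "x \<in> \<pi> ` M"
  then obtain a where "a \<in> M" "x = \<pi> a" by auto
  then show "c \<odot>\<^bsub>Q\<^esub> x \<in> \<pi> ` M" using assms smult_eq[of a c] subspace_scale[of M a c] by auto
qed (use assms in \<open>auto simp: carrier_eq zero_eq subspace_0\<close>)

text \<open>The full preimage of \<open>U\<close> is taken; it contains \<open>N\<close>, which
  makes \<open>M\<close> unique and lets membership be tested on representatives.\<close>

lemma vsubspace_conv_image:
  assumes "vsubspace Q U"
  obtains M where "subspace M" "N \<subseteq> M" "M \<subseteq> P" "U = \<pi> ` M"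
proof
  let ?M = "{x \<in> P. \<pi> x \<in> U}"
  show "subspace ?M"
  proof (rule subspaceI)
    show "0 \<in> ?M" using assms sub by (simp add: vsubspace_def zero_eq subspace_0)
    show "x + y \<in> ?M" if "x \<in> ?M" "y \<in> ?M" for x y
      using assms sub that add_eq[of x y, symmetric] by (auto simp: vsubspace_def subspace_add)
    show "scale c x \<in> ?M" if "x \<in> ?M" for c x
      using assms sub that smult_eq[of x c, symmetric] by (auto simp: vsubspace_def subspace_scale)
  qed
  show "N \<subseteq> ?M"
  proof
    fix x assume "x \<in> N"
    then have "x \<in> P" "\<pi> x = \<pi> 0" using sub eq_iff[of x 0] by (auto simp: subspace_0)
    then show "x \<in> ?M" using assms by (simp add: vsubspace_def zero_eq)
  qed
  show "U = \<pi> ` ?M" using assms by (auto simp: vsubspace_def carrier_eq)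
qed auto

lemma mem_image_iff:
  assumes "subspace M" "N \<subseteq> M" "M \<subseteq> P" "x \<in> P"
  shows "\<pi> x \<in> \<pi> ` M \<longleftrightarrow> x \<in> M"
proof
  assume "\<pi> x \<in> \<pi> ` M"
  then obtain m where "m \<in> M" "x - m \<in> N" using assms eq_iff by blast
  then have "x - m + m \<in> M" using assms subspace_add by blast
  then show "x \<in> M" by simp
qed auto

end

text \<open>Third isomorphism theorem: a coset of cosets is again labelled by a vector of
  \<open>P\<close>, and labels agree exactly modulo \<open>M\<close>. Iterated quotients thus never
  leave the ambient space.\<close>

lemma presented_quot:
  fixes Q :: "('k::field, 'q) tvs" and scale :: "'k \<Rightarrow> 'b::ab_group_add \<Rightarrow> 'b"
  assumes "presented scale P N Q \<pi>"
    and M: "module.subspace scale M" "N \<subseteq> M" "M \<subseteq> P"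
  shows "presented scale P M (quot_tvs Q (\<pi> ` M)) (\<lambda>x. \<pi> ` M +>\<^bsub>Q\<^esub> \<pi> x)"
proof -
  interpret presented scale P N Q \<pi> by (rule assms)
  \<comment> \<open>A coset becomes the image of a translate of \<open>M\<close>, so that sums of
    cosets can be computed on representatives.\<close>
  have coset: "\<pi> ` M +>\<^bsub>Q\<^esub> \<pi> x = (\<lambda>m. \<pi> (m + x)) ` M" if "x \<in> P" for x
    using that M add_eq unfolding coset_conv image_image by (intro image_cong) auto
  show ?thesis
  proof
    show "subspace P" "subspace M" "M \<subseteq> P" by (fact sub M)+
    show "carrier (quot_tvs Q (\<pi> ` M)) = (\<lambda>x. \<pi> ` M +>\<^bsub>Q\<^esub> \<pi> x) ` P"
      by (simp add: quot_tvs_def a_rcosets_conv carrier_eq image_image)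
    show "\<zero>\<^bsub>quot_tvs Q (\<pi> ` M)\<^esub> = \<pi> ` M +>\<^bsub>Q\<^esub> \<pi> 0"
      using sub by (simp add: quot_tvs_def coset subspace_0)
    fix x assume x: "x \<in> P"
    show "(\<pi> ` M +>\<^bsub>Q\<^esub> \<pi> x) \<oplus>\<^bsub>quot_tvs Q (\<pi> ` M)\<^esub> (\<pi> ` M +>\<^bsub>Q\<^esub> \<pi> y) = \<pi> ` M +>\<^bsub>Q\<^esub> \<pi> (x + y)"
      if y: "y \<in> P" for y
    proof -
      have "\<pi> (m + x) \<oplus>\<^bsub>Q\<^esub> \<pi> (n + y) = \<pi> ((m + n) + (x + y))" if "m \<in> M" "n \<in> M" for m n
        using that x y M sub by (subst add_eq) (auto simp: subspace_add algebra_simps)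
      then have "(\<pi> ` M +>\<^bsub>Q\<^esub> \<pi> x) \<oplus>\<^bsub>quot_tvs Q (\<pi> ` M)\<^esub> (\<pi> ` M +>\<^bsub>Q\<^esub> \<pi> y) =
          (\<Union>m\<in>M. (\<lambda>n. \<pi> ((m + n) + (x + y))) ` M)"
        using x y by (simp add: quot_tvs_def coset set_add_conv image_image)
      also have "\<dots> = (\<lambda>m. \<pi> (m + (x + y))) ` M"
      proof (intro equalityI subsetI)
        fix z assume "z \<in> (\<lambda>m. \<pi> (m + (x + y))) ` M"
        then obtain m where "m \<in> M" "z = \<pi> ((m + 0) + (x + y))" by auto
        then show "z \<in> (\<Union>m\<in>M. (\<lambda>n. \<pi> ((m + n) + (x + y))) ` M)"
          using subspace_0[OF M(1)] by blast
      qed (use M subspace_add in blast)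
      also have "\<dots> = \<pi> ` M +>\<^bsub>Q\<^esub> \<pi> (x + y)" using x y sub by (simp add: coset subspace_add)
      finally show ?thesis .
    qed
    show "c \<odot>\<^bsub>quot_tvs Q (\<pi> ` M)\<^esub> (\<pi> ` M +>\<^bsub>Q\<^esub> \<pi> x) = \<pi> ` M +>\<^bsub>Q\<^esub> \<pi> (scale c x)" for c
    proof -
      have "c \<odot>\<^bsub>Q\<^esub> \<pi> (m + x) \<oplus>\<^bsub>Q\<^esub> \<pi> n = \<pi> ((scale c m + n) + scale c x)" if "m \<in> M" "n \<in> M" for m n
      proof -
        have "c \<odot>\<^bsub>Q\<^esub> \<pi> (m + x) = \<pi> (scale c (m + x))"
          using that x M sub by (intro smult_eq) (auto simp: subspace_add)
        then show ?thesis
          using that x M sub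
          by (subst \<open>c \<odot>\<^bsub>Q\<^esub> \<pi> (m + x) = \<pi> (scale c (m + x))\<close>, subst add_eq)
            (auto simp: subspace_add subspace_scale scale_right_distrib algebra_simps)
      qed
      then have "c \<odot>\<^bsub>quot_tvs Q (\<pi> ` M)\<^esub> (\<pi> ` M +>\<^bsub>Q\<^esub> \<pi> x) =
          (\<Union>m\<in>M. (\<lambda>n. \<pi> ((scale c m + n) + scale c x)) ` M)"
        using x by (simp add: quot_tvs_def coset set_add_conv image_image)
      also have "\<dots> = (\<lambda>m. \<pi> (m + scale c x)) ` M"
      proof (intro equalityI subsetI)
        fix z assume "z \<in> (\<lambda>m. \<pi> (m + scale c x)) ` M"
        then obtain m where "m \<in> M" "z = \<pi> ((scale c 0 + m) + scale c x)" by auto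
        then show "z \<in> (\<Union>m\<in>M. (\<lambda>n. \<pi> ((scale c m + n) + scale c x)) ` M)"
          using subspace_0[OF M(1)] by blast
      qed (use M subspace_add subspace_scale in blast)
      also have "\<dots> = \<pi> ` M +>\<^bsub>Q\<^esub> \<pi> (scale c x)" using x sub by (simp add: coset subspace_scale)
      finally show ?thesis .
    qed
    show "\<pi> ` M +>\<^bsub>Q\<^esub> \<pi> x = \<pi> ` M +>\<^bsub>Q\<^esub> \<pi> y \<longleftrightarrow> x - y \<in> M" if y: "y \<in> P" for y
    proof
      assume "\<pi> ` M +>\<^bsub>Q\<^esub> \<pi> x = \<pi> ` M +>\<^bsub>Q\<^esub> \<pi> y"
      moreover have "\<pi> x \<in> \<pi> ` M +>\<^bsub>Q\<^esub> \<pi> x"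
        using x subspace_0[OF M(1)] by (force simp: coset intro!: image_eqI[of _ _ 0])
      ultimately obtain m where m: "m \<in> M" "\<pi> x = \<pi> (m + y)" using y by (auto simp: coset)
      then have "x - (m + y) \<in> M" using eq_iff[of x "m + y"] x y M sub subspace_add[of P m y] by auto
      then have "x - (m + y) + m \<in> M" using m M subspace_add by blast
      then show "x - y \<in> M" by simp
    next
      assume xy: "x - y \<in> M"
      have "(\<lambda>m. m + x) ` M = (\<lambda>m. m + y) ` M"
      proof (intro equalityI subsetI)
        fix z assume "z \<in> (\<lambda>m. m + x) ` M"
        then obtain m where "m \<in> M" "z = (m + (x - y)) + y" by auto
        then show "z \<in> (\<lambda>m. m + y) ` M" using xy subspace_add[OF M(1)] by blast
      next
        fix z assume "z \<in> (\<lambda>m. m + y) ` M"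
        then obtain m where "m \<in> M" "z = (m - (x - y)) + x" by auto
        then show "z \<in> (\<lambda>m. m + x) ` M" using xy subspace_diff[OF M(1)] by blast
      qed
      then have "\<pi> ` (\<lambda>m. m + x) ` M = \<pi> ` (\<lambda>m. m + y) ` M" by simp
      then show "\<pi> ` M +>\<^bsub>Q\<^esub> \<pi> x = \<pi> ` M +>\<^bsub>Q\<^esub> \<pi> y" using x y by (simp add: coset image_image)
    qed
  qed
qed

section \<open>Linear topologies and linearly compact quotients\<close>

text \<open>A coset without reference to a record. Accordingly \<open>qim Y P\<close> is the image
  of \<open>P\<close> in the quotient by \<open>Y\<close>, whether or not \<open>Y\<close> lies in
  \<open>P\<close>.\<close>

definition cs :: "'b::ab_group_add set \<Rightarrow> 'b \<Rightarrow> 'b set" where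
  "cs Y x = (\<lambda>y. y + x) ` Y"

abbreviation qim :: "'b::ab_group_add set \<Rightarrow> 'b set \<Rightarrow> 'b set set" where
  "qim Y P \<equiv> cs Y ` P"

text \<open>All topological arguments use only a linear topology given by a directed base of
  subspaces. Laurent series enter later, when this locale is instantiated.\<close>

locale lin_tvs = kspace scale
  for scale :: "'k::field \<Rightarrow> 'b::ab_group_add \<Rightarrow> 'b" +
  fixes V :: "('k, 'b) tvs" and Bs :: "'b set set"
  assumes V_simps: "carrier V = UNIV" "\<zero>\<^bsub>V\<^esub> = 0" "add V = (+)" "smult V = scale"
    and Bs_ne: "Bs \<noteq> {}"
    and Bs_sub: "B \<in> Bs \<Longrightarrow> subspace B"
    and Bs_dir: "B \<in> Bs \<Longrightarrow> C \<in> Bs \<Longrightarrow> \<exists>D\<in>Bs. D \<subseteq> B \<inter> C"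
    and openin_V: "openin (vtop V) U \<longleftrightarrow> (\<forall>x\<in>U. \<exists>B\<in>Bs. \<forall>b\<in>B. b + x \<in> U)"
begin

abbreviation "sq \<equiv> subquot V"
abbreviation "tens \<equiv> dim_tensor V"
abbreviation "adm \<equiv> admissible V"

lemma vsubspace_V_iff: "vsubspace V W \<longleftrightarrow> subspace W"
  by (auto simp: vsubspace_def V_simps subspace_def)

lemma topspace_V: "topspace (vtop V) = UNIV"
  using Bs_ne openin_V[of UNIV] openin_subset[of "vtop V" UNIV] by auto

definition rel_open :: "'b set \<Rightarrow> 'b set \<Rightarrow> bool" where
  "rel_open X S \<longleftrightarrow> S \<subseteq> X \<and> (\<forall>x\<in>S. \<exists>B\<in>Bs. \<forall>b\<in>B \<inter> X. b + x \<in> S)"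

text \<open>A relatively open \<open>S\<close> is the trace on \<open>X\<close> of the union of
  those translated base subspaces that witness its openness.\<close>

lemma openin_sub_iff:
  assumes X: "subspace X"
  shows "openin (subtopology (vtop V) X) S \<longleftrightarrow> rel_open X S"
proof
  assume "openin (subtopology (vtop V) X) S"
  then obtain T where T: "openin (vtop V) T" "S = T \<inter> X" by (auto simp: openin_subtopology)
  then show "rel_open X S"
    using X unfolding openin_V rel_open_def by (blast intro: subspace_add)
next
  assume S: "rel_open X S"
  then obtain B where B: "\<And>x. x \<in> S \<Longrightarrow> B x \<in> Bs \<and> (\<forall>b\<in>B x \<inter> X. b + x \<in> S)" unfolding rel_open_def by metis
  have "openin (vtop V) (\<Union>x\<in>S. (\<lambda>b. b + x) ` B x)"
    unfolding openin_V
  proof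
    fix z assume "z \<in> (\<Union>x\<in>S. (\<lambda>b. b + x) ` B x)"
    then obtain x b where x: "x \<in> S" "b \<in> B x" "z = b + x" by auto
    then have sB: "subspace (B x)" "B x \<in> Bs" using B Bs_sub by auto
    have "c + z \<in> (\<Union>x\<in>S. (\<lambda>b. b + x) ` B x)" if c: "c \<in> B x" for c
    proof -
      have "c + b \<in> B x" using x sB c by (simp add: subspace_add)
      then have "c + z \<in> (\<lambda>b. b + x) ` B x" using x by (auto simp: add.assoc intro!: image_eqI[of _ _ "c + b"])
      then show ?thesis using x by blast
    qed
    then show "\<exists>B'\<in>Bs. \<forall>b\<in>B'. b + z \<in> (\<Union>x\<in>S. (\<lambda>b. b + x) ` B x)" using sB by blast
  qed
  moreover have "S = (\<Union>x\<in>S. (\<lambda>b. b + x) ` B x) \<inter> X"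
  proof (intro equalityI subsetI)
    fix z assume z: "z \<in> S"
    then have "0 \<in> B z" using B Bs_sub subspace_0 by blast
    then have "z \<in> (\<lambda>b. b + z) ` B z" by force
    then show "z \<in> (\<Union>x\<in>S. (\<lambda>b. b + x) ` B x) \<inter> X" using z S by (auto simp: rel_open_def)
  next
    fix z assume "z \<in> (\<Union>x\<in>S. (\<lambda>b. b + x) ` B x) \<inter> X"
    then obtain x b where x: "x \<in> S" "b \<in> B x" "z = b + x" "z \<in> X" by auto
    then have "x \<in> X" using S by (auto simp: rel_open_def)
    then have "b \<in> X" using x X subspace_diff[OF X, of z x] by simp
    then show "z \<in> S" using x B by blast
  qed
  ultimately show "openin (subtopology (vtop V) X) S" by (auto simp: openin_subtopology)
qed

text \<open>By translation, openness of a subspace is decided at \<open>0\<close>.\<close>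

lemma rel_open_subspace_iff:
  assumes "subspace M" "subspace X" "M \<subseteq> X"
  shows "rel_open X M \<longleftrightarrow> (\<exists>B\<in>Bs. B \<inter> X \<subseteq> M)"
proof
  assume "rel_open X M"
  then have "\<exists>B\<in>Bs. \<forall>b\<in>B \<inter> X. b + 0 \<in> M" using subspace_0[OF assms(1)] unfolding rel_open_def by blast
  then show "\<exists>B\<in>Bs. B \<inter> X \<subseteq> M" by auto
next
  assume "\<exists>B\<in>Bs. B \<inter> X \<subseteq> M"
  then show "rel_open X M" using assms unfolding rel_open_def by (blast intro: subspace_add)
qed

lemma closedin_V_iff: "closedin (vtop V) W \<longleftrightarrow> (\<forall>x. (\<forall>B\<in>Bs. \<exists>w\<in>W. w - x \<in> B) \<longrightarrow> x \<in> W)"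
proof -
  have "(\<exists>B\<in>Bs. \<forall>b\<in>B. b + x \<notin> W) \<longleftrightarrow> \<not> (\<forall>B\<in>Bs. \<exists>w\<in>W. w - x \<in> B)" for x
    by (metis add_diff_cancel diff_add_cancel)
  then have "closedin (vtop V) W \<longleftrightarrow> (\<forall>x. x \<notin> W \<longrightarrow> \<not> (\<forall>B\<in>Bs. \<exists>w\<in>W. w - x \<in> B))"
    unfolding closedin_def topspace_V openin_V by auto
  then show ?thesis by blast
qed

lemma subquot_simps:
  "carrier (sq X Y) = qim Y X" "\<zero>\<^bsub>sq X Y\<^esub> = Y"
  "add (sq X Y) = (+)"
  "smult (sq X Y) = (\<lambda>c A. scale c ` A + Y)"
  by (auto simp: subquot_def quot_tvs_def sub_tvs_def a_rcosets_conv coset_conv cs_def V_simps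
      set_add_conv set_plus_def fun_eq_iff)

lemma openin_subquot:
  assumes "subspace X"
  shows "openin (vtop (sq X Y)) S \<longleftrightarrow> S \<subseteq> qim Y X \<and> rel_open X {x \<in> X. cs Y x \<in> S}"
  using openin_sub_iff[OF assms]
  by (simp add: subquot_def openin_quot_tvs sub_tvs_def a_rcosets_conv coset_conv cs_def[abs_def] V_simps)

lemma topspace_subquot:
  assumes "subspace X"
  shows "topspace (vtop (sq X Y)) = qim Y X"
proof -
  have "openin (vtop (sq X Y)) (qim Y X)"
    unfolding openin_subquot[OF assms] using assms Bs_ne by (auto simp: rel_open_def subspace_add)
  then show ?thesis
    using openin_subset openin_subquot[OF assms] openin_topspace by (metis subset_antisym)
qed

lemma presented_subquot:
  assumes "subspace X" "subspace Y" "Y \<subseteq> X"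
  shows "presented scale X Y (sq X Y) (cs Y)"
proof -
  have "presented scale X {0} (sub_tvs V X) id"
    using assms by unfold_locales (auto simp: sub_tvs_def V_simps subspace_0)
  from presented_quot[OF this assms(2)] assms
  show ?thesis by (simp add: subquot_def coset_conv sub_tvs_def V_simps cs_def[abs_def] subspace_0)
qed

lemma presented_quot_subquot:
  assumes "subspace P" "subspace Y" "subspace M" "Y \<subseteq> M" "M \<subseteq> P"
  shows "presented scale P M (quot_tvs (sq P Y) (qim Y M))
    (\<lambda>x. qim Y M +>\<^bsub>sq P Y\<^esub> cs Y x)"
  by (rule presented_quot[OF presented_subquot]) (use assms in auto)

lemma cs_eq_iff: "subspace Y \<Longrightarrow> cs Y x = cs Y y \<longleftrightarrow> x - y \<in> Y"
  using presented.eq_iff[OF presented_subquot[of UNIV Y]] by simp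

lemma cs_mem_qim_iff:
  assumes "subspace Y" "subspace M" "Y \<subseteq> M"
  shows "cs Y x \<in> qim Y M \<longleftrightarrow> x \<in> M"
  using presented.mem_image_iff[OF presented_subquot[of UNIV Y]] assms by simp

lemma openin_qim_iff:
  assumes "subspace X" "subspace Y" "subspace P" "Y \<subseteq> P" "P \<subseteq> X"
  shows "openin (vtop (sq X Y)) (qim Y P) \<longleftrightarrow> rel_open X P"
proof -
  have "{x \<in> X. cs Y x \<in> qim Y P} = P" using assms by (auto simp: cs_mem_qim_iff)
  then show ?thesis using assms by (auto simp: openin_subquot)
qed

text \<open>Quotient maps are open: a neighbourhood that works for one representative works for its
  whole coset.\<close>

lemma openin_qim_of_rel_open:
  assumes "subspace X" "subspace Y" "Y \<subseteq> X" "rel_open X S"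
  shows "openin (vtop (sq X Y)) (qim Y S)"
proof -
  have "rel_open X {x \<in> X. cs Y x \<in> qim Y S}"
    unfolding rel_open_def
  proof (intro conjI ballI)
    fix x assume "x \<in> {x \<in> X. cs Y x \<in> qim Y S}"
    then obtain s where s: "x \<in> X" "s \<in> S" "x - s \<in> Y" using assms by (auto simp: cs_eq_iff)
    then obtain B where B: "B \<in> Bs" "\<forall>b\<in>B \<inter> X. b + s \<in> S" using assms unfolding rel_open_def by blast
    have "b + x \<in> X \<and> cs Y (b + x) = cs Y (b + s)" if "b \<in> B \<inter> X" for b
      using s that assms by (auto simp: cs_eq_iff subspace_add)
    then show "\<exists>B\<in>Bs. \<forall>b\<in>B \<inter> X. b + x \<in> {x \<in> X. cs Y x \<in> qim Y S}"
      using B by (intro bexI[of _ B]) auto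
  qed auto
  then show ?thesis using assms by (auto simp: openin_subquot rel_open_def)
qed

text \<open>As \<open>Y\<close> is closed, some base subspace \<open>B\<close> separates
  \<open>x - y\<close> from \<open>Y\<close>; the images of the translates of
  \<open>B \<inter> P\<close> by \<open>x\<close> and \<open>y\<close> are then disjoint.\<close>

lemma Hausdorff_subquot:
  assumes "subspace P" "subspace Y" "Y \<subseteq> P" "closedin (vtop V) Y"
  shows "Hausdorff_space (vtop (sq P Y))"
  unfolding Hausdorff_space_def topspace_subquot[OF assms(1)]
proof (intro allI impI)
  fix a b assume ab: "a \<in> qim Y P \<and> b \<in> qim Y P \<and> a \<noteq> b"
  then obtain x y where xy: "x \<in> P" "y \<in> P" "a = cs Y x" "b = cs Y y" by auto
  then have "x - y \<notin> Y" using ab assms by (simp add: cs_eq_iff)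
  then obtain B where B: "B \<in> Bs" "\<And>w. w \<in> Y \<Longrightarrow> w - (x - y) \<notin> B"
    using assms(4) unfolding closedin_V_iff by blast
  have sB: "subspace B" using B Bs_sub by auto
  let ?N = "\<lambda>z. (\<lambda>b. b + z) ` (B \<inter> P)"
  have op: "openin (vtop (sq P Y)) (qim Y (?N z))" if "z \<in> P" for z
  proof (rule openin_qim_of_rel_open[OF assms(1-3)])
    have "\<forall>c\<in>B \<inter> P. \<forall>b\<in>B \<inter> P. c + (b + z) \<in> ?N z"
      using sB assms(1) by (auto simp: add.assoc[symmetric] subspace_add)
    then show "rel_open P (?N z)" using that B(1) assms unfolding rel_open_def by (auto simp: subspace_add)
  qed
  have mem: "cs Y z \<in> qim Y (?N z)" for z
    using subspace_0[OF sB] subspace_0[OF assms(1)] by (force intro!: imageI image_eqI[of _ _ 0])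
  have "disjnt (qim Y (?N x)) (qim Y (?N y))"
  proof (rule ccontr)
    assume "\<not> ?thesis"
    then obtain b c where bc: "b \<in> B" "c \<in> B" "(b + x) - (c + y) \<in> Y"
      using assms by (auto simp: disjnt_def cs_eq_iff)
    have "(b + x) - (c + y) - (x - y) = b - c" by simp
    then show False using B(2)[OF bc(3)] bc sB subspace_diff by metis
  qed
  then show "\<exists>U Va. openin (vtop (sq P Y)) U \<and> openin (vtop (sq P Y)) Va \<and> a \<in> U \<and> b \<in> Va \<and> disjnt U Va"
    using op xy mem by (intro exI[of _ "qim Y (?N x)"] exI[of _ "qim Y (?N y)"]) simp
qed

lemma subquot_linear_base:
  assumes "subspace P" "subspace Y" "Y \<subseteq> P" "openin (vtop (sq P Y)) N" "Y \<in> N"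
  shows "\<exists>B\<in>Bs. qim Y (B \<inter> P) \<subseteq> N"
proof -
  have "cs Y 0 = Y" by (simp add: cs_def)
  then have "0 \<in> {x \<in> P. cs Y x \<in> N}" using assms by (simp add: subspace_0)
  moreover have "rel_open P {x \<in> P. cs Y x \<in> N}" using assms(4) openin_subquot[OF assms(1)] by blast
  ultimately obtain B where "B \<in> Bs" "\<forall>b\<in>B \<inter> P. b + 0 \<in> {x \<in> P. cs Y x \<in> N}"
    unfolding rel_open_def by blast
  then show ?thesis by (intro bexI[of _ B]) auto
qed

text \<open>
  Completeness and metrizability, through a countable base of subspaces. Cauchy sequences lift
  along quotient maps, so completeness of linearly compact quotients comes for free.
\<close>

definition complete_seq :: "'b set \<Rightarrow> bool" where
  "complete_seq X \<longleftrightarrow> subspace X \<and> (\<exists>B :: nat \<Rightarrow> 'b set.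
     (\<forall>j. subspace (B j) \<and> B j \<subseteq> X \<and> (\<exists>C\<in>Bs. C \<inter> X \<subseteq> B j)) \<and>
     (\<forall>C\<in>Bs. \<exists>j. B j \<subseteq> C) \<and>
     (\<forall>j. B (Suc j) \<subseteq> B j) \<and>
     (\<forall>x. (\<forall>j. x j \<in> X \<and> x (Suc j) - x j \<in> B j) \<longrightarrow> (\<exists>l\<in>X. \<forall>j. l - x j \<in> B j)))"

text \<open>The closedness hypothesis refers to points of \<open>X\<close> only, so that it covers
  closed subspaces of \<open>V\<close> as well as subspaces open in \<open>X\<close>.\<close>

lemma complete_seq_closed:
  assumes X: "complete_seq X" and P: "subspace P" "P \<subseteq> X"
    and cl: "\<And>x. x \<in> X \<Longrightarrow> (\<forall>B\<in>Bs. \<exists>w\<in>P. w - x \<in> B) \<Longrightarrow> x \<in> P"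
  shows "complete_seq P"
proof -
  obtain B :: "nat \<Rightarrow> 'b set" where
    B: "\<And>j. subspace (B j)" "\<And>j. B j \<subseteq> X" "\<And>j. \<exists>C\<in>Bs. C \<inter> X \<subseteq> B j"
      "\<And>C. C \<in> Bs \<Longrightarrow> \<exists>j. B j \<subseteq> C" "\<And>j. B (Suc j) \<subseteq> B j"
      "\<And>x. (\<And>j. x j \<in> X \<and> x (Suc j) - x j \<in> B j) \<Longrightarrow> \<exists>l\<in>X. \<forall>j. l - x j \<in> B j"
    using X unfolding complete_seq_def by metis
  have "\<exists>l\<in>P. \<forall>j. l - x j \<in> B j \<inter> P" if x: "\<forall>j. x j \<in> P \<and> x (Suc j) - x j \<in> B j \<inter> P" for x
  proof -
    obtain l where l: "l \<in> X" "\<And>j. l - x j \<in> B j" using B(6)[of x] x P by blast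
    have "l \<in> P"
    proof (rule cl[OF l(1)], intro ballI)
      fix C assume "C \<in> Bs"
      then obtain j where "B j \<subseteq> C" using B(4) by blast
      moreover have "x j - l \<in> B j" using subspace_neg[OF B(1) l(2), of j] by simp
      ultimately show "\<exists>w\<in>P. w - l \<in> C" using x by blast
    qed
    then show ?thesis using l x P by (auto simp: subspace_diff)
  qed
  moreover have "\<exists>C\<in>Bs. C \<inter> P \<subseteq> B j \<inter> P" for j using B(3)[of j] P by blast
  moreover have "\<exists>j. B j \<inter> P \<subseteq> C" if "C \<in> Bs" for C using B(4)[OF that] by blast
  moreover have "B (Suc j) \<inter> P \<subseteq> B j \<inter> P" for j using B(5)[of j] by blast
  ultimately show ?thesis
    unfolding complete_seq_def using B(1) P
    by (intro conjI exI[of _ "\<lambda>j. B j \<inter> P"]) (auto simp: subspace_inter)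
qed

lemma complete_seq_closedin:
  "complete_seq X \<Longrightarrow> subspace P \<Longrightarrow> P \<subseteq> X \<Longrightarrow> closedin (vtop V) P \<Longrightarrow> complete_seq P"
  by (rule complete_seq_closed) (auto simp: closedin_V_iff)

lemma complete_seq_rel_open:
  assumes "complete_seq X" "subspace P" "P \<subseteq> X" "rel_open X P"
  shows "complete_seq P"
proof (rule complete_seq_closed[OF assms(1-3)])
  fix x assume x: "x \<in> X" "\<forall>B\<in>Bs. \<exists>w\<in>P. w - x \<in> B"
  have X: "subspace X" using assms by (simp add: complete_seq_def)
  obtain B where B: "B \<in> Bs" "B \<inter> X \<subseteq> P" using assms X rel_open_subspace_iff by blast
  then obtain w where w: "w \<in> P" "w - x \<in> B" using x by blast
  then have "w - x \<in> P" using B x X assms by (auto simp: subspace_diff subset_iff)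
  then show "x \<in> P" using w subspace_diff[OF assms(2) w(1), of "w - x"] by simp
qed

text \<open>A Cauchy filter on the quotient is reduced to a Cauchy sequence in \<open>P\<close>:
  with a countable base one representative per stage is enough, corrected step by step by elements
  of \<open>Y\<close>.\<close>

lemma complete_subquot:
  assumes P: "complete_seq P" and Y: "subspace Y" "Y \<subseteq> P"
  shows "complete_tvs (sq P Y)"
  unfolding complete_tvs_def
proof (intro allI impI, elim conjE)
  let ?Q = "sq P Y"
  fix F assume F: "F \<noteq> bot" "\<forall>\<^sub>F x in F. x \<in> carrier ?Q"
    and Cauchy: "\<forall>N. openin (vtop ?Q) N \<and> \<zero>\<^bsub>?Q\<^esub> \<in> N \<longrightarrow>
      (\<exists>M\<subseteq>carrier ?Q. (\<forall>\<^sub>F x in F. x \<in> M) \<and> (\<forall>x\<in>M. \<forall>y\<in>M. x \<ominus>\<^bsub>?Q\<^esub> y \<in> N))"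
  have sP: "subspace P" using P by (simp add: complete_seq_def)
  interpret Q: presented scale P Y ?Q "cs Y" by (rule presented_subquot[OF sP Y])
  obtain B :: "nat \<Rightarrow> 'b set" where
    B: "\<And>j. subspace (B j)" "\<And>j. B j \<subseteq> P" "\<And>j. \<exists>C\<in>Bs. C \<inter> P \<subseteq> B j"
      "\<And>C. C \<in> Bs \<Longrightarrow> \<exists>j. B j \<subseteq> C" "\<And>j. B (Suc j) \<subseteq> B j"
      "\<And>x. (\<And>j. x j \<in> P \<and> x (Suc j) - x j \<in> B j) \<Longrightarrow> \<exists>l\<in>P. \<forall>j. l - x j \<in> B j"
    using P unfolding complete_seq_def by metis
  have YB: "subspace (Y + B j)" "Y \<subseteq> Y + B j" "Y + B j \<subseteq> P" for j
    using subspace_set_plus[OF Y(1) B(1)] set_plus_supset_left[OF B(1)] set_plus_least[OF sP Y(2) B(2)]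
    by auto
  \<comment> \<open>The image of \<open>Y + B j\<close> is a neighbourhood of zero, so the filter
    eventually stays in one translate of it; a point of the small set \<open>M\<close> supplies
    \<open>x j\<close>.\<close>
  have "\<forall>j. \<exists>x. x \<in> P \<and> (\<forall>\<^sub>F z in F. \<exists>p\<in>P. z = cs Y p \<and> p - x \<in> Y + B j)"
  proof
    fix j
    have "rel_open P (Y + B j)"
      using B(3)[of j] set_plus_supset_right[OF Y(1), of "B j"] rel_open_subspace_iff[OF YB(1) sP YB(3)] by blast
    then have "openin (vtop ?Q) (qim Y (Y + B j)) \<and> \<zero>\<^bsub>?Q\<^esub> \<in> qim Y (Y + B j)"
      using openin_qim_iff[OF sP Y(1) YB] subspace_0[OF YB(1)] by (simp add: Q.zero_eq)
    from Cauchy[rule_format, OF this] obtain M where M: "M \<subseteq> carrier ?Q" "\<forall>\<^sub>F x in F. x \<in> M"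
        "\<forall>x\<in>M. \<forall>y\<in>M. x \<ominus>\<^bsub>?Q\<^esub> y \<in> qim Y (Y + B j)"
      by blast
    obtain m where m: "m \<in> M" using M(2) F(1) eventually_happens by blast
    then obtain x where x: "x \<in> P" "m = cs Y x" using M(1) by (auto simp: Q.carrier_eq)
    have "\<exists>p\<in>P. z = cs Y p \<and> p - x \<in> Y + B j" if z: "z \<in> M" for z
    proof -
      obtain p where p: "p \<in> P" "z = cs Y p" using z M(1) by (auto simp: Q.carrier_eq)
      have "cs Y (p - x) \<in> qim Y (Y + B j)" using M(3) z m p x Q.minus_eq by metis
      then show ?thesis using p cs_mem_qim_iff[OF Y(1) YB(1,2)] by blast
    qed
    then show "\<exists>x. x \<in> P \<and> (\<forall>\<^sub>F z in F. \<exists>p\<in>P. z = cs Y p \<and> p - x \<in> Y + B j)"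
      using eventually_mono[OF M(2)] x(1) by (intro exI[of _ x]) auto
  qed
  from choice[OF this] obtain x where x: "\<And>j. x j \<in> P"
    and ev: "\<And>j. \<forall>\<^sub>F z in F. \<exists>p\<in>P. z = cs Y p \<and> p - x j \<in> Y + B j" by auto
  \<comment> \<open>The filter is proper, so the conditions at stages \<open>j\<close> and
    \<open>Suc j\<close> have a common point, which links \<open>x j\<close> with
    \<open>x (Suc j)\<close> modulo \<open>Y + B j\<close>.\<close>
  have "\<exists>y\<in>Y. x (Suc j) - x j - y \<in> B j" for j
  proof -
    obtain z where "\<exists>p\<in>P. z = cs Y p \<and> p - x j \<in> Y + B j" "\<exists>p\<in>P. z = cs Y p \<and> p - x (Suc j) \<in> Y + B (Suc j)"
      using eventually_happens[OF eventually_conj[OF ev[of j] ev[of "Suc j"]]] F(1) by auto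
    then obtain p q where pq: "p - q \<in> Y" "p - x j \<in> Y + B j" "q - x (Suc j) \<in> Y + B (Suc j)"
      using Y by (auto simp: cs_eq_iff)
    have YS: "Y + B (Suc j) \<subseteq> Y + B j" using B(5) by (simp add: set_plus_mono2)
    have "(p - x j) - (p - q) - (q - x (Suc j)) \<in> Y + B j"
      by (rule subspace_diff[OF YB(1) subspace_diff[OF YB(1) pq(2) subsetD[OF YB(2) pq(1)]] subsetD[OF YS pq(3)]])
    then have "x (Suc j) - x j \<in> Y + B j" by simp
    then obtain y b where "y \<in> Y" "b \<in> B j" "x (Suc j) - x j = y + b" by (rule set_plus_elim)
    then show ?thesis by (intro bexI[of _ y]) auto
  qed
  then have "\<forall>j. \<exists>y. y \<in> Y \<and> x (Suc j) - x j - y \<in> B j" by auto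
  from choice[OF this] obtain y where y: "\<And>j. y j \<in> Y" "\<And>j. x (Suc j) - x j - y j \<in> B j" by auto
  \<comment> \<open>Subtracting the accumulated corrections from \<open>Y\<close> keeps the cosets
    and makes the sequence Cauchy in \<open>P\<close> itself.\<close>
  define x' where "x' j = x j - (\<Sum>i<j. y i)" for j
  have sumY: "(\<Sum>i<j. y i) \<in> Y" for j using y Y by (auto intro: subspace_sum)
  have "x' j \<in> P \<and> x' (Suc j) - x' j \<in> B j" for j
    using subspace_diff[OF sP x subsetD[OF Y(2) sumY]] y(2)[of j] by (simp add: x'_def algebra_simps)
  then obtain l where l: "l \<in> P" "\<And>j. l - x' j \<in> B j" using B(6)[of x'] by blast
  have lx: "l - x j \<in> Y + B j" for j
  proof -
    have "l - x j = - (\<Sum>i<j. y i) + (l - x' j)" by (simp add: x'_def)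
    then show ?thesis using set_plus_intro[OF subspace_neg[OF Y(1) sumY[of j]] l(2)[of j]] by argo
  qed
  have "limitin (vtop ?Q) (\<lambda>x. x) (cs Y l) F"
    unfolding limitin_def topspace_subquot[OF sP]
  proof (intro conjI allI impI)
    fix U assume U: "openin (vtop ?Q) U \<and> cs Y l \<in> U"
    have "rel_open P {x \<in> P. cs Y x \<in> U}" using conjunct1[OF U] unfolding openin_subquot[OF sP] by simp
    moreover have "l \<in> {x \<in> P. cs Y x \<in> U}" using U l(1) by simp
    ultimately obtain C where "C \<in> Bs" "\<forall>b\<in>C \<inter> P. b + l \<in> {x \<in> P. cs Y x \<in> U}"
      unfolding rel_open_def by meson
    then have C: "C \<in> Bs" "\<And>b. b \<in> C \<inter> P \<Longrightarrow> cs Y (b + l) \<in> U" by auto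
    obtain j where j: "B j \<subseteq> C" using B(4)[OF C(1)] by blast
    show "\<forall>\<^sub>F z in F. z \<in> U"
      using ev[of j]
    proof (rule eventually_mono)
      fix z assume "\<exists>p\<in>P. z = cs Y p \<and> p - x j \<in> Y + B j"
      then obtain p where p: "p \<in> P" "z = cs Y p" "p - x j \<in> Y + B j" by blast
      have "(p - x j) - (l - x j) \<in> Y + B j" by (rule subspace_diff[OF YB(1) p(3) lx])
      then have "p - l \<in> Y + B j" by simp
      then obtain w b where w: "w \<in> Y" "b \<in> B j" "p - l = w + b" by (rule set_plus_elim)
      have "p - (b + l) = w" using w(3) by (simp add: algebra_simps)
      then have "z = cs Y (b + l)" using p(2) w(1) Y(1) by (simp add: cs_eq_iff)
      then show "z \<in> U" using C(2) w j B(2) by blast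
    qed
  qed (use l in auto)
  then show "\<exists>l. limitin (vtop ?Q) (\<lambda>x. x) l F" by blast
qed

definition open_fin_cod :: "'b set \<Rightarrow> 'b set \<Rightarrow> bool" where
  "open_fin_cod P Y \<longleftrightarrow> (\<forall>M. subspace M \<and> Y \<subseteq> M \<and> M \<subseteq> P \<and> rel_open P M \<longrightarrow> (\<exists>n. has_cod P M n))"

text \<open>Completeness, separation and the linear base hold for every such quotient, so finite
  codimension of open subspaces is the only condition left to test.\<close>

lemma linearly_compact_iff:
  assumes P: "complete_seq P" and Y: "subspace Y" "Y \<subseteq> P" "closedin (vtop V) Y"
  shows "linearly_compact (sq P Y) \<longleftrightarrow> open_fin_cod P Y"
proof -
  let ?Q = "sq P Y"
  have sP: "subspace P" using P by (simp add: complete_seq_def)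
  interpret Q: presented scale P Y ?Q "cs Y" by (rule presented_subquot[OF sP Y(1,2)])
  have base: "\<exists>U. vsubspace ?Q U \<and> openin (vtop ?Q) U \<and> U \<subseteq> N"
    if N: "openin (vtop ?Q) N \<and> \<zero>\<^bsub>?Q\<^esub> \<in> N" for N
  proof -
    obtain B where B: "B \<in> Bs" "qim Y (B \<inter> P) \<subseteq> N"
      using subquot_linear_base[OF sP Y(1,2), of N] N by (auto simp: subquot_simps)
    have "subspace (B \<inter> P)" using B Bs_sub sP by (simp add: subspace_inter)
    moreover from this have "openin (vtop ?Q) (qim Y (B \<inter> P))"
      using openin_qim_of_rel_open[OF sP Y(1,2)] rel_open_subspace_iff[of "B \<inter> P" P] B(1) sP by blast
    ultimately show ?thesis using B Q.vsubspace_image[of "B \<inter> P"] by blast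
  qed
  have fd: "fin_dimensional (quot_tvs ?Q (qim Y M)) \<longleftrightarrow> (\<exists>n. has_cod P M n)"
    if "subspace M" "Y \<subseteq> M" "M \<subseteq> P" for M
    using presented.fin_dimensional_iff[OF presented_quot_subquot[OF sP Y(1) that]] .
  have "(\<forall>U. vsubspace ?Q U \<and> openin (vtop ?Q) U \<longrightarrow> fin_dimensional (quot_tvs ?Q U)) \<longleftrightarrow> open_fin_cod P Y"
  proof
    assume L: "\<forall>U. vsubspace ?Q U \<and> openin (vtop ?Q) U \<longrightarrow> fin_dimensional (quot_tvs ?Q U)"
    show "open_fin_cod P Y"
      unfolding open_fin_cod_def
    proof (intro allI impI, elim conjE)
      fix M assume M: "subspace M" "Y \<subseteq> M" "M \<subseteq> P" "rel_open P M"
      then show "\<exists>n. has_cod P M n"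
        using L fd[OF M(1-3)] Q.vsubspace_image[OF M(1,3)] openin_qim_iff[OF sP Y(1) M(1-3)] by blast
    qed
  next
    assume L: "open_fin_cod P Y"
    show "\<forall>U. vsubspace ?Q U \<and> openin (vtop ?Q) U \<longrightarrow> fin_dimensional (quot_tvs ?Q U)"
    proof (intro allI impI, elim conjE)
      fix U assume U: "vsubspace ?Q U" "openin (vtop ?Q) U"
      obtain M where M: "subspace M" "Y \<subseteq> M" "M \<subseteq> P" "U = qim Y M"
        by (rule Q.vsubspace_conv_image[OF U(1)])
      then show "fin_dimensional (quot_tvs ?Q U)"
        using L U(2) fd[OF M(1-3)] openin_qim_iff[OF sP Y(1) M(1-3)] unfolding open_fin_cod_def by blast
    qed
  qed
  then show ?thesis
    using base complete_subquot[OF P Y(1,2)] Hausdorff_subquot[OF sP Y]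
    unfolding linearly_compact_def by blast
qed

section \<open>Open linearly compact subspaces of a subquotient\<close>

lemma rel_open_trans:
  assumes "subspace X" "subspace P" "P \<subseteq> X" "rel_open X P" "E \<subseteq> P"
  shows "rel_open P E \<longleftrightarrow> rel_open X E"
proof
  assume R: "rel_open X E"
  show "rel_open P E"
    unfolding rel_open_def
  proof (intro conjI ballI)
    fix x assume "x \<in> E"
    then obtain B where "B \<in> Bs" "\<forall>b\<in>B \<inter> X. b + x \<in> E" using R unfolding rel_open_def by meson
    then show "\<exists>B\<in>Bs. \<forall>b\<in>B \<inter> P. b + x \<in> E" using assms(3) by (intro bexI[of _ B]) auto
  qed (rule assms)
next
  assume R: "rel_open P E"
  obtain B where B: "B \<in> Bs" "B \<inter> X \<subseteq> P"
    using assms(4) rel_open_subspace_iff[OF assms(2,1,3)] by (elim iffD1[THEN bexE]) auto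
  show "rel_open X E"
    unfolding rel_open_def
  proof (intro conjI ballI)
    fix x assume "x \<in> E"
    then obtain C where C: "C \<in> Bs" "\<forall>b\<in>C \<inter> P. b + x \<in> E" using R unfolding rel_open_def by meson
    obtain D where "D \<in> Bs" "D \<subseteq> B \<inter> C" using Bs_dir[OF B(1) C(1)] by (elim bexE)
    then show "\<exists>B\<in>Bs. \<forall>b\<in>B \<inter> X. b + x \<in> E" using B C by (intro bexI[of _ D]) auto
  qed (use assms in auto)
qed

text \<open>For open \<open>P\<close> the topology induced from \<open>X / Y\<close> is the quotient
  topology of \<open>P / Y\<close>. Stated as an equality of records, it lets \<open>rel_dim\<close>
  and linear compactness be rewritten to simple subquotients.\<close>

lemma sub_subquot:
  assumes X: "subspace X" and Y: "subspace Y" and P: "subspace P" "Y \<subseteq> P" "P \<subseteq> X" "rel_open X P"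
  shows "sub_tvs (sq X Y) (qim Y P) = sq P Y"
proof -
  have "subtopology (vtop (sq X Y)) (qim Y P) = vtop (sq P Y)"
    unfolding topology_eq
  proof (intro allI)
    fix S
    have opP: "openin (vtop (sq X Y)) (qim Y P)" using openin_qim_iff[OF X Y P(1-3)] P(4) by simp
    have "openin (subtopology (vtop (sq X Y)) (qim Y P)) S \<longleftrightarrow>
        openin (vtop (sq X Y)) S \<and> S \<subseteq> qim Y P"
      using opP by (simp add: openin_open_subtopology)
    also have "\<dots> \<longleftrightarrow> S \<subseteq> qim Y P \<and> rel_open X {x \<in> X. cs Y x \<in> S}"
      using image_mono[OF P(3), of "cs Y"] by (auto simp: openin_subquot[OF X])
    also have "\<dots> \<longleftrightarrow> S \<subseteq> qim Y P \<and> rel_open P {x \<in> P. cs Y x \<in> S}"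
    proof (intro conj_cong refl)
      assume S: "S \<subseteq> qim Y P"
      have eq: "{x \<in> X. cs Y x \<in> S} = {x \<in> P. cs Y x \<in> S}"
        using S P cs_mem_qim_iff[OF Y P(1,2)] by blast
      have "{x \<in> P. cs Y x \<in> S} \<subseteq> P" by auto
      then show "rel_open X {x \<in> X. cs Y x \<in> S} \<longleftrightarrow> rel_open P {x \<in> P. cs Y x \<in> S}"
        unfolding eq using rel_open_trans[OF X P(1,3,4)] by simp
    qed
    also have "\<dots> \<longleftrightarrow> openin (vtop (sq P Y)) S" by (simp add: openin_subquot[OF P(1)])
    finally show "openin (subtopology (vtop (sq X Y)) (qim Y P)) S = openin (vtop (sq P Y)) S" .
  qed
  then have t: "vtop (sub_tvs (sq X Y) (qim Y P)) = vtop (sq P Y)"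
    by (simp add: sub_tvs_def)
  \<comment> \<open>Zero, addition and scaling come from \<open>V\<close> and \<open>Y\<close> alone
    and the carriers agree, so only the topologies had to be compared.\<close>
  have "sub_tvs (sq X Y) (qim Y P) = (sq P Y)\<lparr>vtop := vtop (sub_tvs (sq X Y) (qim Y P))\<rparr>"
    by (simp add: sub_tvs_def subquot_def quot_tvs_def a_rcosets_conv coset_conv cs_def[abs_def]
        V_simps set_add_def set_mult_def)
  then show ?thesis unfolding t by simp
qed

text \<open>The open linearly compact subspaces of \<open>X / Y\<close>, represented by their preimages in \<open>X\<close>.\<close>

definition OLC :: "'b set \<Rightarrow> 'b set \<Rightarrow> 'b set set" where
  "OLC X Y = {P. subspace P \<and> Y \<subseteq> P \<and> P \<subseteq> X \<and> rel_open X P \<and> open_fin_cod P Y}"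

text \<open>Hypotheses under which \<open>X / Y\<close> and its open subspaces are automatically
  complete and Hausdorff.\<close>

definition cpair :: "'b set \<Rightarrow> 'b set \<Rightarrow> bool" where
  "cpair X Y \<longleftrightarrow> complete_seq X \<and> subspace Y \<and> Y \<subseteq> X \<and> closedin (vtop V) Y"

lemma cpairD: "cpair X Y \<Longrightarrow> subspace X" "cpair X Y \<Longrightarrow> subspace Y" "cpair X Y \<Longrightarrow> Y \<subseteq> X"
  by (auto simp: cpair_def complete_seq_def)

lemma OLCD: "P \<in> OLC X Y \<Longrightarrow> subspace P" "P \<in> OLC X Y \<Longrightarrow> Y \<subseteq> P" "P \<in> OLC X Y \<Longrightarrow> P \<subseteq> X"
  "P \<in> OLC X Y \<Longrightarrow> rel_open X P" "P \<in> OLC X Y \<Longrightarrow> open_fin_cod P Y"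
  by (auto simp: OLC_def)

lemma open_lin_compact_eq:
  assumes XY: "cpair X Y"
  shows "open_lin_compact (sq X Y) = qim Y ` OLC X Y"
proof -
  have s: "subspace X" "subspace Y" "Y \<subseteq> X" using cpairD[OF XY] .
  interpret Q: presented scale X Y "sq X Y" "cs Y" by (rule presented_subquot[OF s])
  have key: "linearly_compact (sub_tvs (sq X Y) (qim Y P)) \<longleftrightarrow> open_fin_cod P Y"
    if P: "subspace P" "Y \<subseteq> P" "P \<subseteq> X" "rel_open X P" for P
    unfolding sub_subquot[OF s(1,2) P]
    by (rule linearly_compact_iff) (use XY P in \<open>auto simp: cpair_def intro: complete_seq_rel_open\<close>)
  show ?thesis
  proof (intro equalityI subsetI)
    fix U assume "U \<in> open_lin_compact (sq X Y)"
    then have U: "vsubspace (sq X Y) U" "openin (vtop (sq X Y)) U"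
        "linearly_compact (sub_tvs (sq X Y) U)" by (auto simp: open_lin_compact_def)
    obtain P where P: "subspace P" "Y \<subseteq> P" "P \<subseteq> X" "U = qim Y P" by (rule Q.vsubspace_conv_image[OF U(1)])
    then have "rel_open X P" using U openin_qim_iff[OF s(1,2) P(1-3)] by simp
    then show "U \<in> qim Y ` OLC X Y" using P U key[OF P(1-3)] by (auto simp: OLC_def)
  next
    fix U assume "U \<in> qim Y ` OLC X Y"
    then obtain P where P: "U = qim Y P" "P \<in> OLC X Y" by auto
    note D = OLCD[OF P(2)]
    show "U \<in> open_lin_compact (sq X Y)"
      unfolding open_lin_compact_def P
      using Q.vsubspace_image[OF D(1,3)] openin_qim_iff[OF s(1,2) D(1-3)] key[OF D(1-4)] D by simp
  qed
qed

end

section \<open>Dimension theories and their tensor product\<close>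

context lin_tvs
begin

lemma rel_open_Int:
  assumes "rel_open X P" "rel_open X Q"
  shows "rel_open X (P \<inter> Q)"
  unfolding rel_open_def
proof (intro conjI ballI)
  fix x assume x: "x \<in> P \<inter> Q"
  obtain B where B: "B \<in> Bs" "\<forall>b\<in>B \<inter> X. b + x \<in> P" using assms(1) x unfolding rel_open_def by auto
  obtain C where C: "C \<in> Bs" "\<forall>b\<in>C \<inter> X. b + x \<in> Q" using assms(2) x unfolding rel_open_def by auto
  obtain D where "D \<in> Bs" "D \<subseteq> B \<inter> C" using Bs_dir[OF B(1) C(1)] by (elim bexE)
  then show "\<exists>B\<in>Bs. \<forall>b\<in>B \<inter> X. b + x \<in> P \<inter> Q" using B C by (intro bexI[of _ D]) auto
qed (use assms in \<open>auto simp: rel_open_def\<close>)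

lemma OLC_has_cod:
  assumes "cpair X Y" "P \<in> OLC X Y" "subspace M" "Y \<subseteq> M" "M \<subseteq> P" "rel_open X M"
  obtains n where "has_cod P M n"
proof -
  have "rel_open P M" using rel_open_trans[OF cpairD(1)[OF assms(1)] OLCD(1,3,4)[OF assms(2)] assms(5)] assms(6) by simp
  then show thesis using OLCD(5)[OF assms(2)] assms that unfolding open_fin_cod_def by auto
qed

lemma OLC_I:
  assumes "cpair X Y" "subspace P" "Y \<subseteq> P" "P \<subseteq> X" "rel_open X P"
    and "\<And>M. subspace M \<Longrightarrow> Y \<subseteq> M \<Longrightarrow> M \<subseteq> P \<Longrightarrow> rel_open X M \<Longrightarrow> \<exists>n. has_cod P M n"
  shows "P \<in> OLC X Y"
  using assms(2-) rel_open_trans[OF cpairD(1)[OF assms(1)] assms(2,4,5)] by (auto simp: OLC_def open_fin_cod_def)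

text \<open>The intersection is open in both, and linear compactness bounds the codimension of open
  subspaces.\<close>

lemma OLC_commens:
  assumes "cpair X Y" "P \<in> OLC X Y" "Q \<in> OLC X Y"
  shows "commens P Q"
proof -
  note P = OLCD[OF assms(2)] and Q = OLCD[OF assms(3)]
  have PQ: "subspace (P \<inter> Q)" "Y \<subseteq> P \<inter> Q" "rel_open X (P \<inter> Q)"
    using P Q by (auto simp: subspace_inter rel_open_Int)
  obtain a where "has_cod P (P \<inter> Q) a" using OLC_has_cod[OF assms(1,2) PQ(1,2) _ PQ(3)] by auto
  moreover obtain b where "has_cod Q (P \<inter> Q) b" using OLC_has_cod[OF assms(1,3) PQ(1,2) _ PQ(3)] by auto
  ultimately show ?thesis by (auto simp: commens_def)
qed

lemma qim_Int:
  assumes "subspace Y" "subspace P" "Y \<subseteq> P" "subspace Q" "Y \<subseteq> Q"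
  shows "qim Y P \<inter> qim Y Q = qim Y (P \<inter> Q)"
  using cs_mem_qim_iff[OF assms(1-3)] by auto

lemma rel_dim_subquot:
  assumes XY: "cpair X Y" and P: "P \<in> OLC X Y" and Q: "Q \<in> OLC X Y"
  shows "rel_dim (sq X Y) (qim Y P) (qim Y Q) = reldim P Q"
proof -
  note s = cpairD[OF XY] and P' = OLCD[OF P] and Q' = OLCD[OF Q]
  have PQ: "subspace (P \<inter> Q)" "Y \<subseteq> P \<inter> Q" "P \<inter> Q \<subseteq> P" "P \<inter> Q \<subseteq> Q"
    using P' Q' by (auto simp: subspace_inter)
  show ?thesis
    unfolding rel_dim_def reldim_def qim_Int[OF s(2) P'(1,2) Q'(1,2)]
      sub_subquot[OF s(1,2) P'(1-4)] sub_subquot[OF s(1,2) Q'(1-4)]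
      presented.vdim_eq_cod[OF presented_quot_subquot[OF P'(1) s(2) PQ(1,2,3)]]
      presented.vdim_eq_cod[OF presented_quot_subquot[OF Q'(1) s(2) PQ(1,2,4)]] ..
qed

lemma Dim_iff:
  assumes XY: "cpair X Y"
  shows "d \<in> Dim (sq X Y) \<longleftrightarrow> d \<in> extensional (open_lin_compact (sq X Y)) \<and>
    (\<forall>P\<in>OLC X Y. \<forall>Q\<in>OLC X Y. d (qim Y Q) = d (qim Y P) + reldim P Q)"
  unfolding Dim_def by (auto simp: open_lin_compact_eq[OF XY] rel_dim_subquot[OF XY] PiE_def)

lemma Dim_value: "cpair X Y \<Longrightarrow> d \<in> Dim (sq X Y) \<Longrightarrow> P \<in> OLC X Y \<Longrightarrow> Q \<in> OLC X Y \<Longrightarrow>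
    d (qim Y Q) = d (qim Y P) + reldim P Q"
  by (rule Dim_iff[THEN iffD1, THEN conjunct2, rule_format])

lemma olc_ext:
  assumes "cpair X Y" "d \<in> extensional (open_lin_compact (sq X Y))"
    "d' \<in> extensional (open_lin_compact (sq X Y))"
    "\<And>P. P \<in> OLC X Y \<Longrightarrow> d (qim Y P) = d' (qim Y P)"
  shows "d = d'"
  by (rule extensionalityI[OF assms(2,3)]) (use assms(4) in \<open>auto simp: open_lin_compact_eq[OF assms(1)]\<close>)

lemma Dim_ext: "d \<in> Dim W \<Longrightarrow> d \<in> extensional (open_lin_compact W)"
  by (auto simp: Dim_def PiE_def)

text \<open>A dimension theory is determined by a single value.\<close>

lemma Dim_eqI:
  assumes "cpair X Y" "d \<in> Dim (sq X Y)" "d' \<in> Dim (sq X Y)" "P \<in> OLC X Y"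
    "d (qim Y P) = d' (qim Y P)"
  shows "d = d'"
proof (rule olc_ext[OF assms(1) Dim_ext[OF assms(2)] Dim_ext[OF assms(3)]])
  fix Q assume "Q \<in> OLC X Y"
  then show "d (qim Y Q) = d' (qim Y Q)"
    using Dim_value[OF assms(1,2,4)] Dim_value[OF assms(1,3,4)] assms(5) by simp
qed

lemma qim_in_olc: "cpair X Y \<Longrightarrow> P \<in> OLC X Y \<Longrightarrow> qim Y P \<in> open_lin_compact (sq X Y)"
  by (simp add: open_lin_compact_eq)

lemma dim_shift_qim:
  "cpair X Y \<Longrightarrow> P \<in> OLC X Y \<Longrightarrow> dim_shift (sq X Y) n d (qim Y P) = d (qim Y P) + n"
  by (simp add: dim_shift_def qim_in_olc)

lemma dim_shift_Dim:
  assumes XY: "cpair X Y" and d: "d \<in> Dim (sq X Y)"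
  shows "dim_shift (sq X Y) n d \<in> Dim (sq X Y)"
  unfolding Dim_iff[OF XY]
proof (intro conjI ballI)
  fix P Q assume P: "P \<in> OLC X Y" and Q: "Q \<in> OLC X Y"
  show "dim_shift (sq X Y) n d (qim Y Q) = dim_shift (sq X Y) n d (qim Y P) + reldim P Q"
    unfolding dim_shift_qim[OF XY P] dim_shift_qim[OF XY Q] Dim_value[OF XY d P Q] by simp
qed (simp add: dim_shift_def)

text \<open>The candidate adds the relative dimension from \<open>P\<close> to the constant
  \<open>c\<close>; transitivity of \<open>reldim\<close> makes it a dimension theory.\<close>

lemma Dim_exists:
  assumes XY: "cpair X Y" and P: "P \<in> OLC X Y"
  obtains d where "d \<in> Dim (sq X Y)" "d (qim Y P) = c"
proof
  let ?d = "\<lambda>U\<in>open_lin_compact (sq X Y). c + rel_dim (sq X Y) (qim Y P) U"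
  have v: "?d (qim Y Q) = c + reldim P Q" if "Q \<in> OLC X Y" for Q
    using that by (simp add: qim_in_olc[OF XY] rel_dim_subquot[OF XY P])
  show "?d \<in> Dim (sq X Y)"
    unfolding Dim_iff[OF XY]
  proof (intro conjI ballI)
    fix Q R assume Q: "Q \<in> OLC X Y" and R: "R \<in> OLC X Y"
    show "?d (qim Y R) = ?d (qim Y Q) + reldim Q R"
      unfolding v[OF Q] v[OF R] reldim_trans[OF OLC_commens[OF XY P Q] OLC_commens[OF XY Q R]] by simp
  qed simp
  have "reldim P P = 0" using reldim_eq[OF has_cod_refl has_cod_refl] OLCD(1)[OF P] by simp
  then show "?d (qim Y P) = c" using v[OF P] by simp
qed

lemma Dim_torsor:
  assumes XY: "cpair X Y" and P: "P \<in> OLC X Y" and d: "d \<in> Dim (sq X Y)" "d' \<in> Dim (sq X Y)"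
  shows "d' = dim_shift (sq X Y) (d' (qim Y P) - d (qim Y P)) d"
  by (rule Dim_eqI[OF XY d(2) dim_shift_Dim[OF XY d(1)] P]) (simp add: dim_shift_qim[OF XY P])

text \<open>One open linearly compact subspace yields arbitrarily small ones, because its open
  subspaces are linearly compact again.\<close>

lemma linearly_locally_compact_iff:
  assumes XY: "cpair X Y"
  shows "linearly_locally_compact (sq X Y) \<longleftrightarrow> OLC X Y \<noteq> {}"
proof
  note s = cpairD[OF XY]
  assume L: "linearly_locally_compact (sq X Y)"
  have "openin (vtop (sq X Y)) (qim Y X) \<and> \<zero>\<^bsub>sq X Y\<^esub> \<in> qim Y X"
    using openin_topspace[of "vtop (sq X Y)"] topspace_subquot[OF s(1)] subspace_0[OF s(1)]
      image_eqI[of Y "cs Y" 0 X] by (simp add: subquot_simps cs_def)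
  then have "open_lin_compact (sq X Y) \<noteq> {}" using L unfolding linearly_locally_compact_def by blast
  then show "OLC X Y \<noteq> {}" by (simp add: open_lin_compact_eq[OF XY])
next
  note s = cpairD[OF XY]
  assume "OLC X Y \<noteq> {}"
  then obtain P where P: "P \<in> OLC X Y" by auto
  note P' = OLCD[OF P]
  show "linearly_locally_compact (sq X Y)"
    unfolding linearly_locally_compact_def
  proof (intro allI impI)
    fix N assume N: "openin (vtop (sq X Y)) N \<and> \<zero>\<^bsub>sq X Y\<^esub> \<in> N"
    obtain B where B: "B \<in> Bs" "qim Y (B \<inter> X) \<subseteq> N"
      using subquot_linear_base[OF s(1,2,3), of N] N by (auto simp: subquot_simps)
    \<comment> \<open>\<open>P\<close> is shrunk into the given neighbourhood; adding
      \<open>Y\<close> does not change the image in the quotient.\<close>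
    let ?Q = "Y + (B \<inter> P)"
    have sBP: "subspace (B \<inter> P)" using Bs_sub[OF B(1)] P' by (simp add: subspace_inter)
    have Q: "subspace ?Q" "Y \<subseteq> ?Q" "?Q \<subseteq> P" "B \<inter> P \<subseteq> ?Q"
      using subspace_set_plus[OF s(2) sBP] set_plus_supset_left[OF sBP, of Y]
        set_plus_least[OF P'(1) P'(2), of "B \<inter> P"] set_plus_supset_right[OF s(2), of "B \<inter> P"] by auto
    have roB: "rel_open X (B \<inter> X)"
      using rel_open_subspace_iff[of "B \<inter> X" X] B(1) s(1) Bs_sub[OF B(1)] by (auto simp: subspace_inter)
    have "rel_open X (B \<inter> X \<inter> P)" by (rule rel_open_Int[OF roB P'(4)])
    moreover have "B \<inter> X \<inter> P = B \<inter> P" using P' by auto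
    ultimately obtain C where "C \<in> Bs" "C \<inter> X \<subseteq> B \<inter> P"
      using rel_open_subspace_iff[OF sBP s(1)] P' by auto
    then have roQ: "rel_open X ?Q" using rel_open_subspace_iff[OF Q(1) s(1)] Q P' by blast
    have "?Q \<in> OLC X Y"
    proof (rule OLC_I[OF XY Q(1,2) _ roQ])
      fix M assume M: "subspace M" "Y \<subseteq> M" "M \<subseteq> ?Q" "rel_open X M"
      then have MP: "M \<subseteq> P" using Q by auto
      obtain n where "has_cod P M n" using OLC_has_cod[OF XY P M(1,2) MP M(4)] by auto
      then show "\<exists>n. has_cod ?Q M n" using has_cod_split[OF _ Q(1) M(3) Q(3)] by metis
    qed (use Q P' in auto)
    moreover have "qim Y ?Q \<subseteq> N"
    proof
      fix A assume "A \<in> qim Y ?Q"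
      then obtain y b where "y \<in> Y" "b \<in> B" "b \<in> P" "A = cs Y (y + b)" by (auto elim: set_plus_elim)
      moreover from this have "A = cs Y b" using cs_eq_iff[OF s(2)] by auto
      moreover have "cs Y b \<in> qim Y (B \<inter> X)" if "b \<in> B" "b \<in> P" using that P' by auto
      ultimately show "A \<in> N" using B by auto
    qed
    ultimately show "\<exists>U\<in>open_lin_compact (sq X Y). U \<subseteq> N" using qim_in_olc[OF XY] by blast
  qed
qed

section \<open>Exact sequences and tensor products of dimension theories\<close>

definition cchain :: "'b set \<Rightarrow> 'b set \<Rightarrow> 'b set \<Rightarrow> bool" where
  "cchain X Y Z \<longleftrightarrow> cpair X Y \<and> cpair Y Z \<and> cpair X Z"

lemma cchainI:
  "complete_seq X \<Longrightarrow> subspace Y \<Longrightarrow> closedin (vtop V) Y \<Longrightarrow> subspace Z \<Longrightarrow> closedin (vtop V) Z \<Longrightarrow>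
    Z \<subseteq> Y \<Longrightarrow> Y \<subseteq> X \<Longrightarrow> cchain X Y Z"
  using complete_seq_closedin[of X Y] by (auto simp: cchain_def cpair_def)

lemma cchainD: "cchain X Y Z \<Longrightarrow> cpair X Y" "cchain X Y Z \<Longrightarrow> cpair Y Z" "cchain X Y Z \<Longrightarrow> cpair X Z"
  by (auto simp: cchain_def)

text \<open>A subspace \<open>N\<close> open in \<open>Y\<close> need not be open in
  \<open>X\<close>. It is enlarged to \<open>N + (B \<inter> P)\<close>, which is open in
  \<open>X\<close> and whose trace on \<open>Y\<close> is \<open>N\<close> again by the modular
  law.\<close>

lemma OLC_Int:
  assumes ch: "cchain X Y Z" and P: "P \<in> OLC X Z"
  shows "P \<inter> Y \<in> OLC Y Z"
proof -
  note XZ = cpairD[OF cchainD(3)[OF ch]] and YZ = cpairD[OF cchainD(2)[OF ch]]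
    and XY = cpairD[OF cchainD(1)[OF ch]] and P' = OLCD[OF P]
  have sPY: "subspace (P \<inter> Y)" using P' YZ by (simp add: subspace_inter)
  obtain C where C: "C \<in> Bs" "C \<inter> X \<subseteq> P" using P'(4) rel_open_subspace_iff[OF P'(1) XZ(1) P'(3)] by auto
  show ?thesis
  proof (rule OLC_I[OF cchainD(2)[OF ch] sPY])
    show "rel_open Y (P \<inter> Y)"
      using rel_open_subspace_iff[OF sPY YZ(1)] C XY(3) by auto
    fix N assume N: "subspace N" "Z \<subseteq> N" "N \<subseteq> P \<inter> Y" "rel_open Y N"
    then obtain B where B: "B \<in> Bs" "B \<inter> Y \<subseteq> N" using rel_open_subspace_iff[OF N(1) YZ(1)] by auto
    have sB: "subspace (B \<inter> P)" using Bs_sub[OF B(1)] P' by (simp add: subspace_inter)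
    let ?N = "N + (B \<inter> P)"
    have N': "subspace ?N" "Z \<subseteq> ?N" "?N \<subseteq> P" "B \<inter> P \<subseteq> ?N"
      using subspace_set_plus[OF N(1) sB] set_plus_supset_left[OF sB, of N] N
        set_plus_least[OF P'(1), of N "B \<inter> P"] set_plus_supset_right[OF N(1), of "B \<inter> P"] by auto
    obtain D where D: "D \<in> Bs" "D \<subseteq> B \<inter> C" using Bs_dir[OF B(1) C(1)] by (elim bexE)
    have "D \<inter> X \<subseteq> ?N" using D C N'(4) by auto
    then have "rel_open X ?N" using rel_open_subspace_iff[OF N'(1) XZ(1)] N' P' D(1) by auto
    then obtain n where n: "has_cod P ?N n" using OLC_has_cod[OF cchainD(3)[OF ch] P N'(1,2,3)] by auto
    have "?N \<inter> Y = N + (B \<inter> P \<inter> Y)" using subspace_modular[OF N(1) YZ(1)] N by auto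
    also have "\<dots> = N"
    proof -
      have "subspace (B \<inter> P \<inter> Y)" using sB YZ by (simp add: subspace_inter)
      moreover have "B \<inter> P \<inter> Y \<subseteq> N" using B by auto
      ultimately show ?thesis using set_plus_absorb[of "B \<inter> P \<inter> Y" N] N by (simp add: add.commute)
    qed
    finally have eq: "?N \<inter> Y = N" .
    show "\<exists>n. has_cod (P \<inter> Y) N n" using has_cod_exact[OF n YZ(1)] unfolding eq by metis
  qed (use P' YZ in auto)
qed

text \<open>An open \<open>M\<close> between \<open>Y\<close> and \<open>P + Y\<close> is pulled
  back to \<open>P \<inter> M\<close>, and the second isomorphism theorem transfers the
  codimension.\<close>

lemma OLC_plus:
  assumes ch: "cchain X Y Z" and P: "P \<in> OLC X Z"
  shows "P + Y \<in> OLC X Y"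
proof -
  note XZ = cpairD[OF cchainD(3)[OF ch]] and YZ = cpairD[OF cchainD(2)[OF ch]]
    and XY = cpairD[OF cchainD(1)[OF ch]] and P' = OLCD[OF P]
  have PY: "subspace (P + Y)" "Y \<subseteq> P + Y" "P + Y \<subseteq> X" "P \<subseteq> P + Y"
    using subspace_set_plus[OF P'(1) YZ(1)] set_plus_supset_right[OF P'(1)]
      set_plus_least[OF XY(1) P'(3) XY(3)] set_plus_supset_left[OF YZ(1)] by auto
  obtain C where C: "C \<in> Bs" "C \<inter> X \<subseteq> P" using P'(4) rel_open_subspace_iff[OF P'(1) XZ(1) P'(3)] by auto
  show ?thesis
  proof (rule OLC_I[OF cchainD(1)[OF ch] PY(1-3)])
    show "rel_open X (P + Y)" using rel_open_subspace_iff[OF PY(1) XZ(1) PY(3)] C PY(4) by auto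
    fix M assume M: "subspace M" "Y \<subseteq> M" "M \<subseteq> P + Y" "rel_open X M"
    have PM: "subspace (P \<inter> M)" "Z \<subseteq> P \<inter> M" "P \<inter> M \<subseteq> P" "rel_open X (P \<inter> M)"
      using P' M YZ rel_open_Int[OF P'(4) M(4)] by (auto simp: subspace_inter)
    obtain n where n: "has_cod P (P \<inter> M) n" using OLC_has_cod[OF cchainD(3)[OF ch] P PM(1-4)] by auto
    then have "has_cod (P + M) M n" using has_cod_second_iso[OF P'(1) M(1)] by simp
    moreover have "P + M = P + Y"
    proof (rule subset_antisym)
      show "P + M \<subseteq> P + Y" by (rule set_plus_least[OF PY(1,4) M(3)])
      show "P + Y \<subseteq> P + M" using M(2) by (simp add: set_plus_mono2)
    qed
    ultimately show "\<exists>n. has_cod (P + Y) M n" by auto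
  qed
qed

lemma OLC_chain_nonempty:
  assumes "cchain X Y Z" "OLC X Z \<noteq> {}"
  shows "OLC X Y \<noteq> {}" "OLC Y Z \<noteq> {}"
  using OLC_plus[OF assms(1)] OLC_Int[OF assms(1)] assms(2) by auto

lemma cs_plus: "subspace Y \<Longrightarrow> subspace Z \<Longrightarrow> Z \<subseteq> Y \<Longrightarrow> cs Z x <+>\<^bsub>V\<^esub> Y = cs Y x"
proof -
  assume a: "subspace Y" "subspace Z" "Z \<subseteq> Y"
  have "cs Z x <+>\<^bsub>V\<^esub> Y = (\<Union>z\<in>Z. (\<lambda>y. z + x + y) ` Y)"
    by (auto simp: set_add_conv cs_def V_simps)
  also have "\<dots> = cs Y x"
  proof (intro equalityI subsetI)
    fix w assume "w \<in> (\<Union>z\<in>Z. (\<lambda>y. z + x + y) ` Y)"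
    then obtain z y where zy: "z \<in> Z" "y \<in> Y" "w = (z + y) + x" by (auto simp: ac_simps)
    then have "z + y \<in> Y" using a by (auto simp: subspace_add)
    then show "w \<in> cs Y x" using zy by (auto simp: cs_def)
  next
    fix w assume "w \<in> cs Y x"
    then obtain y where "y \<in> Y" "w = 0 + x + y" by (auto simp: cs_def add.commute)
    then show "w \<in> (\<Union>z\<in>Z. (\<lambda>y. z + x + y) ` Y)" using subspace_0[OF a(2)] by blast
  qed
  finally show ?thesis .
qed

lemma qim_plus:
  assumes "subspace Y" "subspace P"
  shows "qim Y (P + Y) = qim Y P"
proof (intro equalityI subsetI)
  fix A assume "A \<in> qim Y (P + Y)"
  then obtain p y where "p \<in> P" "y \<in> Y" "A = cs Y (p + y)" by (auto elim: set_plus_elim)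
  then show "A \<in> qim Y P" using cs_eq_iff[OF assms(1), of "p + y" p] by auto
qed (use set_plus_supset_left[OF assms(1), of P] in auto)

lemma dim_tensor_qim:
  assumes ch: "cchain X Y Z" and P: "P \<in> OLC X Z"
  shows "tens X Y Z e d (qim Z P) = e (qim Z (P \<inter> Y)) + d (qim Y (P + Y))"
proof -
  note YZ = cpairD[OF cchainD(2)[OF ch]] and P' = OLCD[OF P]
  have "qim Z P \<inter> carrier (sq Y Z) = qim Z (P \<inter> Y)"
    by (simp add: subquot_simps qim_Int[OF YZ(2) P'(1,2) YZ(1,3)])
  moreover have "(\<lambda>A. A <+>\<^bsub>V\<^esub> Y) ` qim Z P = qim Y (P + Y)"
    by (simp add: image_image cs_plus[OF YZ] qim_plus[OF YZ(1) P'(1)])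
  ultimately show ?thesis using P by (simp add: dim_tensor_def qim_in_olc[OF cchainD(3)[OF ch]])
qed

lemma dim_tensor_ext: "tens X Y Z e d \<in> extensional (open_lin_compact (sq X Z))"
  by (simp add: dim_tensor_def)

lemma dim_tensor_Dim:
  assumes ch: "cchain X Y Z" and e: "e \<in> Dim (sq Y Z)" and d: "d \<in> Dim (sq X Y)"
  shows "tens X Y Z e d \<in> Dim (sq X Z)"
  unfolding Dim_iff[OF cchainD(3)[OF ch]]
proof (intro conjI ballI dim_tensor_ext)
  fix P Q assume P: "P \<in> OLC X Z" and Q: "Q \<in> OLC X Z"
  show "tens X Y Z e d (qim Z Q) = tens X Y Z e d (qim Z P) + reldim P Q"
    using Dim_value[OF cchainD(2)[OF ch] e OLC_Int[OF ch P] OLC_Int[OF ch Q]]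
      Dim_value[OF cchainD(1)[OF ch] d OLC_plus[OF ch P] OLC_plus[OF ch Q]]
      reldim_exact[OF OLC_commens[OF cchainD(3)[OF ch] P Q] cpairD(2)[OF cchainD(1)[OF ch]]]
    by (simp add: dim_tensor_qim[OF ch P] dim_tensor_qim[OF ch Q])
qed

text \<open>For fixed \<open>e\<close> the equation is solved for one value of \<open>d'\<close> at
  a single lattice. With \<open>dim_tensor_cancel\<close>, tensoring with \<open>e\<close> becomes a
  bijection, the mechanism behind every change of index in the inverse limit.\<close>

lemma dim_tensor_surj:
  assumes ch: "cchain X Y Z" and ne: "OLC X Z \<noteq> {}"
    and e: "e \<in> Dim (sq Y Z)" and d: "d \<in> Dim (sq X Z)"
  obtains d' where "d' \<in> Dim (sq X Y)" "d = tens X Y Z e d'"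
proof -
  obtain P where P: "P \<in> OLC X Z" using ne by auto
  obtain d' where d': "d' \<in> Dim (sq X Y)" "d' (qim Y (P + Y)) = d (qim Z P) - e (qim Z (P \<inter> Y))"
    using Dim_exists[OF cchainD(1)[OF ch] OLC_plus[OF ch P]] by blast
  have "d = tens X Y Z e d'"
    by (rule Dim_eqI[OF cchainD(3)[OF ch] d dim_tensor_Dim[OF ch e d'(1)] P])
      (simp add: dim_tensor_qim[OF ch P] d')
  then show thesis using d' that by blast
qed

lemma dim_tensor_cancel:
  assumes ch: "cchain X Y Z" and ne: "OLC X Z \<noteq> {}"
    and d: "d \<in> Dim (sq X Y)" "d' \<in> Dim (sq X Y)"
    and eq: "tens X Y Z e d = tens X Y Z e d'"
  shows "d = d'"
proof -
  obtain P where P: "P \<in> OLC X Z" using ne by auto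
  show ?thesis
    by (rule Dim_eqI[OF cchainD(1)[OF ch] d OLC_plus[OF ch P]])
      (use fun_cong[OF eq, of "qim Z P"] in \<open>simp add: dim_tensor_qim[OF ch P]\<close>)
qed

lemma dim_shift_ext: "dim_shift W n d \<in> extensional (open_lin_compact W)"
  by (simp add: dim_shift_def)

lemma dim_tensor_shift:
  assumes ch: "cchain X Y Z"
  shows "tens X Y Z e (dim_shift (sq X Y) n d) = dim_shift (sq X Z) n (tens X Y Z e d)"
    and "tens X Y Z (dim_shift (sq Y Z) n e) d = dim_shift (sq X Z) n (tens X Y Z e d)"
  by (rule olc_ext[OF cchainD(3)[OF ch] dim_tensor_ext dim_shift_ext], simp add: dim_tensor_qim[OF ch]
      dim_shift_qim[OF cchainD(3)[OF ch]] dim_shift_qim[OF cchainD(1)[OF ch] OLC_plus[OF ch]]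
      dim_shift_qim[OF cchainD(2)[OF ch] OLC_Int[OF ch]])+

text \<open>Both sides evaluate \<open>e\<close> on \<open>P \<inter> W\<close>, \<open>d\<close> on
  \<open>P + Y\<close>, and \<open>e'\<close> on a middle term that the modular law identifies:
  \<open>(P + W) \<inter> Y = (P \<inter> Y) + W\<close>.\<close>

lemma dim_tensor_assoc:
  assumes c: "cchain X Y W" "cchain Y W Z" "cchain X W Z" "cchain X Y Z"
  shows "tens X W Z e (tens X Y W e' d) = tens X Y Z (tens Y W Z e e') d"
proof (rule olc_ext[OF cchainD(3)[OF c(4)] dim_tensor_ext dim_tensor_ext])
  fix P assume P: "P \<in> OLC X Z"
  note W = cpairD[OF cchainD(1)[OF c(2)]]
  note PW = OLC_plus[OF c(3) P] and PY = OLC_Int[OF c(4) P]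
  have 1: "(P + W) \<inter> Y = (P \<inter> Y) + W"
    using subspace_modular[OF W(2,1,3), of P] by (simp add: add.commute)
  have 2: "P + W + Y = P + Y" using set_plus_absorb[OF W(2,1,3)] by (simp add: add.assoc)
  have 3: "P \<inter> Y \<inter> W = P \<inter> W" using W(3) by auto
  show "tens X W Z e (tens X Y W e' d) (qim Z P) = tens X Y Z (tens Y W Z e e') d (qim Z P)"
    by (simp add: dim_tensor_qim[OF c(3) P] dim_tensor_qim[OF c(4) P] dim_tensor_qim[OF c(1) PW]
        dim_tensor_qim[OF c(2) PY] 1 2 3)
qed

text \<open>A dimension theory on the zero space \<open>Y / Y\<close> is just the integer
  \<open>e (qim Y Y)\<close>.\<close>

lemma dim_tensor_unit:
  assumes ch: "cchain X Y Y"
  shows "tens X Y Y e d = dim_shift (sq X Y) (e (qim Y Y)) d"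
proof (rule olc_ext[OF cchainD(3)[OF ch] dim_tensor_ext dim_shift_ext])
  fix P assume P: "P \<in> OLC X Y"
  note P' = OLCD[OF P] and Y = cpairD(2)[OF cchainD(1)[OF ch]]
  have "P \<inter> Y = Y" "P + Y = P" using P' set_plus_absorb[OF Y P'(1,2)] by (auto simp: add.commute)
  then show "tens X Y Y e d (qim Y P) = dim_shift (sq X Y) (e (qim Y Y)) d (qim Y P)"
    by (simp add: dim_tensor_qim[OF ch P] dim_shift_qim[OF cchainD(3)[OF ch] P])
qed

end

section \<open>Relative torsors and transport of structure\<close>

abbreviation ginv :: "('b \<Rightarrow> 'b) \<Rightarrow> 'b \<Rightarrow> 'b" where
  "ginv \<equiv> inv_into UNIV"

context lin_tvs
begin

lemma admissible_iff:
  assumes "complete_seq W1" "complete_seq W2"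
  shows "W \<in> adm W1 W2 \<longleftrightarrow> subspace W \<and> closedin (vtop V) W \<and> W \<subseteq> W1 \<inter> W2 \<and>
    OLC W1 W \<noteq> {} \<and> OLC W2 W \<noteq> {}"
proof -
  have "linearly_locally_compact (sq U W) \<longleftrightarrow> OLC U W \<noteq> {}"
    if "subspace W" "closedin (vtop V) W" "W \<subseteq> U" "complete_seq U" for U
    using that by (intro linearly_locally_compact_iff) (simp add: cpair_def)
  then show ?thesis using assms by (auto simp: admissible_def vsubspace_V_iff)
qed

text \<open>
  Every index of the inverse limit lies below \<open>W1 \<inter> W2\<close>, so this one component determines an
  element of the relative torsor. There is no cofinal family below: the admissible subspaces are not
  directed downwards, and some of them contain no \<open>\<O> p\<close>.
\<close>

definition has_top :: "'b set \<Rightarrow> 'b set \<Rightarrow> bool" where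
  "has_top W1 W2 \<longleftrightarrow> complete_seq W1 \<and> complete_seq W2 \<and> W1 \<inter> W2 \<in> adm W1 W2"

lemma has_topD: "has_top W1 W2 \<Longrightarrow> complete_seq W1" "has_top W1 W2 \<Longrightarrow> complete_seq W2"
  "has_top W1 W2 \<Longrightarrow> W1 \<inter> W2 \<in> adm W1 W2"
  by (auto simp: has_top_def)

lemma admissibleD:
  assumes "W \<in> adm W1 W2" "complete_seq W1" "complete_seq W2"
  shows "subspace W" "closedin (vtop V) W" "W \<subseteq> W1 \<inter> W2" "OLC W1 W \<noteq> {}" "OLC W2 W \<noteq> {}"
    "cpair W1 W" "cpair W2 W"
  using assms by (auto simp: admissible_iff cpair_def)

lemma admissible_chain:
  assumes "W \<in> adm W1 W2" "W' \<in> adm W1 W2" "W' \<subseteq> W" "complete_seq W1" "complete_seq W2"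
  shows "cchain W1 W W'" "cchain W2 W W'"
  using admissibleD[OF assms(1,4,5)] admissibleD[OF assms(2,4,5)] assms(3-5) by (auto intro!: cchainI)

lemma dim_homD:
  assumes "h \<in> dim_hom A B" "d \<in> Dim A"
  shows "h d \<in> Dim B" "h (dim_shift A n d) = dim_shift B n (h d)"
  using assms by (auto simp: dim_hom_def)

lemma rel_torsorD:
  assumes "h \<in> rel_torsor V W1 W2" "W \<in> adm W1 W2"
  shows "h W \<in> dim_hom (sq W1 W) (sq W2 W)"
    and "W' \<in> adm W1 W2 \<Longrightarrow> W' \<subseteq> W \<Longrightarrow> d \<in> Dim (sq W1 W) \<Longrightarrow> e \<in> Dim (sq W W') \<Longrightarrow>
      h W' (tens W1 W W' e d) = tens W2 W W' e (h W d)"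
  using assms by (auto simp: rel_torsor_def)

lemma Dim_ne:
  assumes "cpair X Y" "OLC X Y \<noteq> {}"
  obtains d where "d \<in> Dim (sq X Y)"
proof -
  obtain P where P: "P \<in> OLC X Y" using assms by auto
  show thesis using Dim_exists[OF assms(1) P, of 0] that by blast
qed

text \<open>Equality at \<open>Y\<close> rises to the greatest index by cancelling a theory on
  \<open>(W1 \<inter> W2) / Y\<close>; from there it descends to every \<open>W\<close>, since each
  theory on \<open>W1 / W\<close> is a tensor product.\<close>

lemma rel_torsor_eqI:
  assumes g: "has_top W1 W2" and h: "h \<in> rel_torsor V W1 W2" "h' \<in> rel_torsor V W1 W2"
    and Y: "Y \<in> adm W1 W2" and eq: "\<And>d. d \<in> Dim (sq W1 Y) \<Longrightarrow> h Y d = h' Y d"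
  shows "h = h'"
proof -
  note c = has_topD(1,2)[OF g] and W0 = has_topD(3)[OF g]
  note aY = admissibleD[OF Y c]
  have ch: "cchain W1 (W1 \<inter> W2) Y" "cchain W2 (W1 \<inter> W2) Y"
    using admissible_chain[OF W0 Y _ c] aY by auto
  obtain e where e: "e \<in> Dim (sq (W1 \<inter> W2) Y)"
    using Dim_ne[OF cchainD(2)[OF ch(1)] OLC_chain_nonempty(2)[OF ch(1) aY(4)]] by blast
  have 0: "h (W1 \<inter> W2) d = h' (W1 \<inter> W2) d" if d: "d \<in> Dim (sq W1 (W1 \<inter> W2))" for d
  proof (rule dim_tensor_cancel[OF ch(2) aY(5)])
    show "h (W1 \<inter> W2) d \<in> Dim (sq W2 (W1 \<inter> W2))" "h' (W1 \<inter> W2) d \<in> Dim (sq W2 (W1 \<inter> W2))"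
      using dim_homD(1)[OF rel_torsorD(1)[OF h(1) W0] d] dim_homD(1)[OF rel_torsorD(1)[OF h(2) W0] d] .
    show "tens W2 (W1 \<inter> W2) Y e (h (W1 \<inter> W2) d) = tens W2 (W1 \<inter> W2) Y e (h' (W1 \<inter> W2) d)"
      using rel_torsorD(2)[OF h(1) W0 Y aY(3) d e] rel_torsorD(2)[OF h(2) W0 Y aY(3) d e]
        eq[OF dim_tensor_Dim[OF ch(1) e d]] by simp
  qed
  have all: "h W d = h' W d" if W: "W \<in> adm W1 W2" and d: "d \<in> Dim (sq W1 W)" for W d
  proof -
    note aW = admissibleD[OF W c]
    have ch: "cchain W1 (W1 \<inter> W2) W" "cchain W2 (W1 \<inter> W2) W"
      using admissible_chain[OF W0 W _ c] aW by auto
    obtain e where e: "e \<in> Dim (sq (W1 \<inter> W2) W)"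
      using Dim_ne[OF cchainD(2)[OF ch(1)] OLC_chain_nonempty(2)[OF ch(1) aW(4)]] by blast
    obtain d' where d': "d' \<in> Dim (sq W1 (W1 \<inter> W2))" "d = tens W1 (W1 \<inter> W2) W e d'"
      using dim_tensor_surj[OF ch(1) aW(4) e d] by blast
    show ?thesis
      using rel_torsorD(2)[OF h(1) W0 W aW(3) d'(1) e] rel_torsorD(2)[OF h(2) W0 W aW(3) d'(1) e] 0[OF d'(1)] d'(2) by simp
  qed
  show ?thesis
  proof (rule extensionalityI)
    show "h \<in> extensional (adm W1 W2)" "h' \<in> extensional (adm W1 W2)"
      using h by (auto simp: rel_torsor_def PiE_def)
    fix W assume W: "W \<in> adm W1 W2"
    show "h W = h' W"
    proof (rule extensionalityI)
      show "h W \<in> extensional (Dim (sq W1 W))" "h' W \<in> extensional (Dim (sq W1 W))"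
        using rel_torsorD(1)[OF h(1) W] rel_torsorD(1)[OF h(2) W] by (auto simp: dim_hom_def PiE_def)
    qed (rule all[OF W])
  qed
qed

lemma dim_shift_0: "d \<in> Dim W \<Longrightarrow> dim_shift W 0 d = d"
  using Dim_ext[of d W] by (auto simp: dim_shift_def extensional_def)

text \<open>The component at \<open>W\<close> must send \<open>tens W1 W0 W e d\<close> to
  \<open>tens W2 W0 W e (\<phi> d)\<close>. This is well defined because \<open>\<phi>\<close>
  commutes with shifts.\<close>

lemma rel_torsor_exists_greatest:
  assumes g: "has_top W1 W2" and W0: "W0 = W1 \<inter> W2"
    and \<phi>: "\<phi> \<in> dim_hom (sq W1 W0) (sq W2 W0)"
  obtains h where "h \<in> rel_torsor V W1 W2" "\<And>d. d \<in> Dim (sq W1 W0) \<Longrightarrow> h W0 d = \<phi> d"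
proof -
  note c = has_topD(1,2)[OF g]
  have W0a: "W0 \<in> adm W1 W2" using has_topD(3)[OF g] W0 by simp
  have ch: "cchain W1 W0 W" "cchain W2 W0 W" if "W \<in> adm W1 W2" for W
    using admissible_chain[OF W0a that _ c] admissibleD[OF that c] W0 by auto
  \<comment> \<open>An arbitrary reference theory on \<open>W0 / W\<close>, with respect to which
    theories on \<open>W1 / W\<close> are decomposed.\<close>
  define eW where "eW W = (SOME e. e \<in> Dim (sq W0 W))" for W
  have eW: "eW W \<in> Dim (sq W0 W)" if W: "W \<in> adm W1 W2" for W
  proof -
    obtain e where "e \<in> Dim (sq W0 W)"
      using Dim_ne[OF cchainD(2)[OF ch(1)[OF W]] OLC_chain_nonempty(2)[OF ch(1)[OF W] admissibleD(4)[OF W c]]] by blast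
    then show ?thesis unfolding eW_def by (rule someI[where P = "\<lambda>e. e \<in> Dim (sq W0 W)"])
  qed
  define h where "h = (\<lambda>W\<in>adm W1 W2. \<lambda>d\<in>Dim (sq W1 W). tens W2 W0 W (eW W)
     (\<phi> (SOME d'. d' \<in> Dim (sq W1 W0) \<and> d = tens W1 W0 W (eW W) d')))"
  have key: "h W (tens W1 W0 W e d) = tens W2 W0 W e (\<phi> d)"
    if W: "W \<in> adm W1 W2" and e: "e \<in> Dim (sq W0 W)" and d: "d \<in> Dim (sq W1 W0)" for W e d
  proof -
    note aW = admissibleD[OF W c] and chW = ch[OF W]
    obtain P where P: "P \<in> OLC W0 W" using OLC_chain_nonempty(2)[OF chW(1) aW(4)] by auto
    \<comment> \<open>Replacing \<open>e\<close> by \<open>eW W\<close> costs a shift, which is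
      moved onto \<open>d\<close>; \<open>\<phi>\<close> commutes with it, so the choice of
      \<open>eW W\<close> does no harm.\<close>
    obtain n where n: "e = dim_shift (sq W0 W) n (eW W)"
      using Dim_torsor[OF cchainD(2)[OF chW(1)] P eW[OF W] e] by blast
    have sd: "dim_shift (sq W1 W0) n d \<in> Dim (sq W1 W0)"
      by (rule dim_shift_Dim[OF cchainD(1)[OF chW(1)] d])
    have ed: "tens W1 W0 W e d = tens W1 W0 W (eW W) (dim_shift (sq W1 W0) n d)"
      unfolding n by (simp add: dim_tensor_shift[OF chW(1)])
    have "(SOME d'. d' \<in> Dim (sq W1 W0) \<and> tens W1 W0 W e d = tens W1 W0 W (eW W) d')
        = dim_shift (sq W1 W0) n d"
    proof (rule some_equality)
      fix d' assume d': "d' \<in> Dim (sq W1 W0) \<and> tens W1 W0 W e d = tens W1 W0 W (eW W) d'"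
      show "d' = dim_shift (sq W1 W0) n d"
        by (rule dim_tensor_cancel[OF chW(1) aW(4) conjunct1[OF d'] sd, of "eW W"]) (use d' ed in simp)
    qed (use sd ed in simp)
    then have "h W (tens W1 W0 W e d) = tens W2 W0 W (eW W) (\<phi> (dim_shift (sq W1 W0) n d))"
      using W dim_tensor_Dim[OF chW(1) e d] by (simp add: h_def)
    also have "\<dots> = tens W2 W0 W e (\<phi> d)"
      unfolding n dim_homD(2)[OF \<phi> d] by (simp add: dim_tensor_shift[OF chW(2)])
    finally show ?thesis .
  qed
  have "h \<in> rel_torsor V W1 W2"
    unfolding rel_torsor_def
  proof (intro CollectI conjI PiE_I ballI impI)
    fix W assume W: "W \<in> adm W1 W2"
    note aW = admissibleD[OF W c] and chW = ch[OF W]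
    have split: "\<exists>d'\<in>Dim (sq W1 W0). d = tens W1 W0 W (eW W) d'" if d: "d \<in> Dim (sq W1 W)" for d
      using dim_tensor_surj[OF chW(1) aW(4) eW[OF W] d] by blast
    show "h W \<in> dim_hom (sq W1 W) (sq W2 W)"
      unfolding dim_hom_def
    proof (intro CollectI conjI PiE_I ballI allI)
      fix d assume d: "d \<in> Dim (sq W1 W)"
      obtain d' where d': "d' \<in> Dim (sq W1 W0)" "d = tens W1 W0 W (eW W) d'"
        using split[OF d] by (elim bexE)
      show "h W d \<in> Dim (sq W2 W)"
        unfolding d'(2) key[OF W eW[OF W] d'(1)]
        by (rule dim_tensor_Dim[OF chW(2) eW[OF W] dim_homD(1)[OF \<phi> d'(1)]])
      fix n
      have sd: "dim_shift (sq W1 W0) n d' \<in> Dim (sq W1 W0)"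
        by (rule dim_shift_Dim[OF cchainD(1)[OF chW(1)] d'(1)])
      show "h W (dim_shift (sq W1 W) n d) = dim_shift (sq W2 W) n (h W d)"
        unfolding d'(2) dim_tensor_shift(1)[OF chW(1), symmetric] key[OF W eW[OF W] d'(1)] key[OF W eW[OF W] sd]
          dim_homD(2)[OF \<phi> d'(1)] dim_tensor_shift(1)[OF chW(2)] ..
    qed (use W in \<open>simp add: h_def\<close>)
    fix W' d e assume W': "W' \<in> adm W1 W2" "W' \<subseteq> W" and d: "d \<in> Dim (sq W1 W)"
      and e: "e \<in> Dim (sq W W')"
    obtain d' where d': "d' \<in> Dim (sq W1 W0)" "d = tens W1 W0 W (eW W) d'"
      using split[OF d] by (elim bexE)
    note aW' = admissibleD[OF W'(1) c]
    have c0: "cchain W0 W W'"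
      using cchainD(2)[OF chW(1)] aW aW' W' by (intro cchainI) (auto simp: cpair_def)
    note c1 = admissible_chain[OF W W' c]
    \<comment> \<open>By associativity both sides are instances of \<open>key\<close> for the theory
      \<open>tens W0 W W' e (eW W)\<close> on \<open>W0 / W'\<close>.\<close>
    show "h W' (tens W1 W W' e d) = tens W2 W W' e (h W d)"
      unfolding d'(2) key[OF W eW[OF W] d'(1)]
        dim_tensor_assoc[OF chW(1) c0 c1(1) ch(1)[OF W'(1)]] dim_tensor_assoc[OF chW(2) c0 c1(2) ch(2)[OF W'(1)]]
      by (rule key[OF W'(1) dim_tensor_Dim[OF c0 e eW[OF W]] d'(1)])
  qed (simp add: h_def)
  moreover have "h W0 d = \<phi> d" if d: "d \<in> Dim (sq W1 W0)" for d
  proof -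
    note c0 = ch[OF W0a]
    \<comment> \<open>\<open>W0 / W0\<close> is the zero space, and its theory with value
      \<open>0\<close> is neutral for the tensor product.\<close>
    obtain P where P: "P \<in> OLC W0 W0" using OLC_chain_nonempty(2)[OF c0(1) admissibleD(4)[OF W0a c]] by auto
    have "P = W0" using OLCD(2,3)[OF P] by auto
    then obtain e where e: "e \<in> Dim (sq W0 W0)" "e (qim W0 W0) = 0"
      using Dim_exists[OF cchainD(2)[OF c0(1)] P, of 0] by auto
    show ?thesis
      using key[OF W0a e(1) d] dim_shift_0[OF d] dim_shift_0[OF dim_homD(1)[OF \<phi> d]]
      unfolding dim_tensor_unit[OF c0(1)] dim_tensor_unit[OF c0(2)] e(2) by simp
  qed
  ultimately show thesis by (rule that)
qed

text \<open>The morphism \<open>\<psi>\<close> is first lifted from \<open>Y\<close> to the greatest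
  index by cancelling a fixed \<open>e\<close>, then extended from there.\<close>

lemma rel_torsor_exists:
  assumes g: "has_top W1 W2" and Y: "Y \<in> adm W1 W2"
    and \<psi>: "\<psi> \<in> dim_hom (sq W1 Y) (sq W2 Y)"
  obtains h where "h \<in> rel_torsor V W1 W2" "\<And>d. d \<in> Dim (sq W1 Y) \<Longrightarrow> h Y d = \<psi> d"
proof -
  define W0 where "W0 = W1 \<inter> W2"
  note c = has_topD(1,2)[OF g]
  have W0a: "W0 \<in> adm W1 W2" using has_topD(3)[OF g] W0_def by simp
  note aY = admissibleD[OF Y c]
  have YW: "Y \<subseteq> W0" using aY W0_def by simp
  have ch: "cchain W1 W0 Y" "cchain W2 W0 Y" using admissible_chain[OF W0a Y YW c] by auto
  obtain e where e: "e \<in> Dim (sq W0 Y)"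
    using Dim_ne[OF cchainD(2)[OF ch(1)] OLC_chain_nonempty(2)[OF ch(1) aY(4)]] by blast
  have ex: "\<exists>d''. d'' \<in> Dim (sq W2 W0) \<and> \<psi> (tens W1 W0 Y e d') = tens W2 W0 Y e d''"
    if d': "d' \<in> Dim (sq W1 W0)" for d'
    using dim_tensor_surj[OF ch(2) aY(5) e dim_homD(1)[OF \<psi> dim_tensor_Dim[OF ch(1) e d']]] by blast
  define \<phi> where "\<phi> = (\<lambda>d'\<in>Dim (sq W1 W0).
     SOME d''. d'' \<in> Dim (sq W2 W0) \<and> \<psi> (tens W1 W0 Y e d') = tens W2 W0 Y e d'')"
  have \<phi>: "\<phi> d' \<in> Dim (sq W2 W0) \<and> \<psi> (tens W1 W0 Y e d') = tens W2 W0 Y e (\<phi> d')"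
    if d': "d' \<in> Dim (sq W1 W0)" for d'
    using someI_ex[OF ex[OF d']] d' by (simp add: \<phi>_def)
  have "\<phi> \<in> dim_hom (sq W1 W0) (sq W2 W0)"
    unfolding dim_hom_def
  proof (intro CollectI conjI PiE_I ballI allI)
    fix d n assume d: "d \<in> Dim (sq W1 W0)"
    have sd: "dim_shift (sq W1 W0) n d \<in> Dim (sq W1 W0)"
      by (rule dim_shift_Dim[OF cchainD(1)[OF ch(1)] d])
    show "\<phi> (dim_shift (sq W1 W0) n d) = dim_shift (sq W2 W0) n (\<phi> d)"
    proof (rule dim_tensor_cancel[OF ch(2) aY(5)])
      show "\<phi> (dim_shift (sq W1 W0) n d) \<in> Dim (sq W2 W0)" using \<phi>[OF sd] by (rule conjunct1)
      show "dim_shift (sq W2 W0) n (\<phi> d) \<in> Dim (sq W2 W0)"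
        by (rule dim_shift_Dim[OF cchainD(1)[OF ch(2)] conjunct1[OF \<phi>[OF d]]])
      show "tens W2 W0 Y e (\<phi> (dim_shift (sq W1 W0) n d)) =
          tens W2 W0 Y e (dim_shift (sq W2 W0) n (\<phi> d))"
        unfolding conjunct2[OF \<phi>[OF sd], symmetric] dim_tensor_shift(1)[OF ch(2)] dim_tensor_shift(1)[OF ch(1)]
          dim_homD(2)[OF \<psi> dim_tensor_Dim[OF ch(1) e d]] conjunct2[OF \<phi>[OF d]] ..
    qed
  qed (use \<phi> in \<open>auto simp: \<phi>_def\<close>)
  then obtain h where h: "h \<in> rel_torsor V W1 W2" "\<And>d. d \<in> Dim (sq W1 W0) \<Longrightarrow> h W0 d = \<phi> d"
    using rel_torsor_exists_greatest[OF g W0_def] by blast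
  have "h Y d = \<psi> d" if d: "d \<in> Dim (sq W1 Y)" for d
  proof -
    obtain d' where d': "d' \<in> Dim (sq W1 W0)" "d = tens W1 W0 Y e d'"
      using dim_tensor_surj[OF ch(1) aY(4) e d] by blast
    show ?thesis
      using rel_torsorD(2)[OF h(1) W0a Y YW d'(1) e] conjunct2[OF \<phi>[OF d'(1)]] h(2)[OF d'(1)] d'(2) by simp
  qed
  then show thesis using h(1) that by blast
qed

text \<open>\<open>T\<close> is the greatest index common to both factors. Extending the composite
  at \<open>T\<close> gives existence in the definite description, and the component at
  \<open>T\<close> gives uniqueness.\<close>

lemma rel_comp_props:
  assumes g: "has_top W1 W2" "has_top W2 W3" "has_top W1 W3"
    and T: "T = W1 \<inter> W2 \<inter> W3" "T \<in> adm W1 W2" "T \<in> adm W2 W3"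
    and h: "h \<in> rel_torsor V W1 W2" "h' \<in> rel_torsor V W2 W3"
  shows "rel_comp V W1 W2 W3 h h' \<in> rel_torsor V W1 W3"
    and "d \<in> Dim (sq W1 T) \<Longrightarrow> rel_comp V W1 W2 W3 h h' T d = h' T (h T d)"
proof -
  note c1 = has_topD(1)[OF g(1)] and c2 = has_topD(2)[OF g(1)] and c3 = has_topD(2)[OF g(2)]
  have adm13: "W \<in> adm W1 W3" if "W \<in> adm W1 W2" "W \<in> adm W2 W3" for W
    using that by (auto simp: admissible_def)
  note T13 = adm13[OF T(2,3)]
  have comp: "h' W (h W d) \<in> Dim (sq W3 W)"
    if "W \<in> adm W1 W2" "W \<in> adm W2 W3" "d \<in> Dim (sq W1 W)" for W d
    using dim_homD(1)[OF rel_torsorD(1)[OF h(2) that(2)] dim_homD(1)[OF rel_torsorD(1)[OF h(1) that(1)] that(3)]] .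
  have "(\<lambda>d\<in>Dim (sq W1 T). h' T (h T d)) \<in> dim_hom (sq W1 T) (sq W3 T)"
    unfolding dim_hom_def
  proof (intro CollectI conjI PiE_I ballI allI)
    fix d n assume d: "d \<in> Dim (sq W1 T)"
    have sd: "dim_shift (sq W1 T) n d \<in> Dim (sq W1 T)"
      by (rule dim_shift_Dim[OF admissibleD(6)[OF T(2) c1 c2] d])
    show "(\<lambda>d\<in>Dim (sq W1 T). h' T (h T d)) (dim_shift (sq W1 T) n d) =
        dim_shift (sq W3 T) n ((\<lambda>d\<in>Dim (sq W1 T). h' T (h T d)) d)"
      using d sd dim_homD(2)[OF rel_torsorD(1)[OF h(1) T(2)] d, of n]
        dim_homD(2)[OF rel_torsorD(1)[OF h(2) T(3)] dim_homD(1)[OF rel_torsorD(1)[OF h(1) T(2)] d], of n] by simp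
  qed (use comp[OF T(2,3)] in auto)
  note ex = rel_torsor_exists[OF g(3) T13 this]
  obtain k where k: "k \<in> rel_torsor V W1 W3"
      "\<And>d. d \<in> Dim (sq W1 T) \<Longrightarrow> k T d = (\<lambda>d\<in>Dim (sq W1 T). h' T (h T d)) d"
    using ex by blast
  have k: "k \<in> rel_torsor V W1 W3" "\<And>d. d \<in> Dim (sq W1 T) \<Longrightarrow> k T d = h' T (h T d)"
    using k by simp_all
  have "rel_comp V W1 W2 W3 h h' = k"
    unfolding rel_comp_def
  proof (rule the_equality)
    show "k \<in> rel_torsor V W1 W3 \<and> (\<forall>W\<in>adm W1 W2 \<inter> adm W2 W3. \<forall>d\<in>Dim (sq W1 W).
        k W d = h' W (h W d))"
    proof (intro conjI ballI k(1))
      fix W d assume "W \<in> adm W1 W2 \<inter> adm W2 W3" and d: "d \<in> Dim (sq W1 W)"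
      then have W: "W \<in> adm W1 W2" "W \<in> adm W2 W3" by auto
      note W13 = adm13[OF W] and aW = admissibleD[OF W(1) c1 c2]
      \<comment> \<open>Every common index lies below \<open>T\<close>, so the composition formula
        spreads from \<open>T\<close> by tensoring with a theory on \<open>T / W\<close>.\<close>
      have WT: "W \<subseteq> T" using aW(3) admissibleD(3)[OF W(2) c2 c3] T(1) by auto
      note ch = admissible_chain(1)[OF T(2) W(1) WT c1 c2]
      obtain e where e: "e \<in> Dim (sq T W)"
        using Dim_ne[OF cchainD(2)[OF ch] OLC_chain_nonempty(2)[OF ch aW(4)]] by blast
      obtain d' where d': "d' \<in> Dim (sq W1 T)" "d = tens W1 T W e d'"
        using dim_tensor_surj[OF ch aW(4) e d] by blast
      note hd = dim_homD(1)[OF rel_torsorD(1)[OF h(1) T(2)] d'(1)]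
      show "k W d = h' W (h W d)"
        using rel_torsorD(2)[OF k(1) T13 W13 WT d'(1) e] rel_torsorD(2)[OF h(1) T(2) W(1) WT d'(1) e]
          rel_torsorD(2)[OF h(2) T(3) W(2) WT hd e] k(2)[OF d'(1)] d'(2) by simp
    qed
  next
    fix k' assume k': "k' \<in> rel_torsor V W1 W3 \<and> (\<forall>W\<in>adm W1 W2 \<inter> adm W2 W3.
        \<forall>d\<in>Dim (sq W1 W). k' W d = h' W (h W d))"
    have eq: "k' T d = k T d" if "d \<in> Dim (sq W1 T)" for d
      using conjunct2[OF k', rule_format, OF IntI[OF T(2,3)] that] k(2)[OF that] by simp
    show "k' = k" by (rule rel_torsor_eqI[OF g(3) conjunct1[OF k'] k(1) T13 eq])
  qed
  then show "rel_comp V W1 W2 W3 h h' \<in> rel_torsor V W1 W3"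
    and "d \<in> Dim (sq W1 T) \<Longrightarrow> rel_comp V W1 W2 W3 h h' T d = h' T (h T d)"
    using k by auto
qed

lemma rel_int_rel_torsor:
  assumes "complete_seq W"
  shows "rel_int V W n \<in> rel_torsor V W W"
  unfolding rel_torsor_def
proof (intro CollectI conjI PiE_I ballI impI)
  fix X assume X: "X \<in> adm W W"
  note p = admissibleD(6)[OF X assms assms]
  show "rel_int V W n X \<in> dim_hom (sq W X) (sq W X)"
    unfolding dim_hom_def
  proof (intro CollectI conjI PiE_I ballI allI)
    fix d m assume d: "d \<in> Dim (sq W X)"
    have "dim_shift (sq W X) n (dim_shift (sq W X) m d) = dim_shift (sq W X) m (dim_shift (sq W X) n d)"
      by (auto simp: dim_shift_def)
    then show "rel_int V W n X (dim_shift (sq W X) m d) = dim_shift (sq W X) m (rel_int V W n X d)"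
      using X d dim_shift_Dim[OF p d] by (simp add: rel_int_def)
  qed (use X dim_shift_Dim[OF p] in \<open>auto simp: rel_int_def\<close>)
  fix X' d e assume X': "X' \<in> adm W W" "X' \<subseteq> X" and d: "d \<in> Dim (sq W X)"
    and e: "e \<in> Dim (sq X X')"
  note ch = admissible_chain(1)[OF X X' assms assms]
  show "rel_int V W n X' (tens W X X' e d) = tens W X X' e (rel_int V W n X d)"
    using X X' d dim_tensor_Dim[OF ch e d] by (simp add: rel_int_def dim_tensor_shift[OF ch])
qed (simp add: rel_int_def)

section \<open>Transport of structure along linear homeomorphisms\<close>

definition homeo :: "('b \<Rightarrow> 'b) \<Rightarrow> bool" where
  "homeo g \<longleftrightarrow> Vector_Spaces.linear scale scale g \<and> bij g \<and>
     (\<forall>B\<in>Bs. \<exists>C\<in>Bs. g ` C \<subseteq> B) \<and> (\<forall>B\<in>Bs. \<exists>C\<in>Bs. C \<subseteq> g ` B)"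

lemma homeo_inv_image: "homeo g \<Longrightarrow> ginv g ` g ` A = A" "homeo g \<Longrightarrow> g ` ginv g ` A = A" "homeo g \<Longrightarrow> g -` A = ginv g ` A"
  by (auto simp: homeo_def bij_is_inj bij_is_surj image_f_inv_f image_inv_f_f bij_vimage_eq_inv_image)

lemma homeo_inv:
  assumes g: "homeo g"
  shows "homeo (ginv g)"
  unfolding homeo_def
proof (intro conjI ballI)
  show "Vector_Spaces.linear scale scale (ginv g)"
    using g bij_module_hom_imp_inv_module_hom[of scale scale g] by (simp add: homeo_def module_hom_iff_linear)
  show "bij (ginv g)" using g by (simp add: homeo_def bij_imp_bij_inv)
  fix B assume B: "B \<in> Bs"
  obtain C where "C \<in> Bs" "C \<subseteq> g ` B" using g B by (auto simp: homeo_def)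
  then show "\<exists>C\<in>Bs. ginv g ` C \<subseteq> B" using image_mono[of C "g ` B" "ginv g"] homeo_inv_image(1)[OF g] by auto
  obtain C where "C \<in> Bs" "g ` C \<subseteq> B" using g B by (auto simp: homeo_def)
  then show "\<exists>C\<in>Bs. C \<subseteq> ginv g ` B" using image_mono[of "g ` C" B "ginv g"] homeo_inv_image(1)[OF g] by auto
qed

lemma homeo_simps:
  assumes "homeo g"
  shows "g (x + y) = g x + g y" "g (x - y) = g x - g y" "subspace A \<Longrightarrow> subspace (g ` A)" "inj g"
    "g ` (A \<inter> B) = g ` A \<inter> g ` B" "g ` (A + B) = g ` A + g ` B"
proof -
  interpret g: Vector_Spaces.linear scale scale g using assms by (simp add: homeo_def)
  show "inj g" using assms by (simp add: homeo_def bij_is_inj)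
  then show "g ` (A \<inter> B) = g ` A \<inter> g ` B" by (rule image_Int)
  show "g (x + y) = g x + g y" "g (x - y) = g x - g y" "subspace A \<Longrightarrow> subspace (g ` A)"
    using g.add g.diff g.subspace_image by auto
  show "g ` (A + B) = g ` A + g ` B"
  proof (intro equalityI subsetI)
    fix z assume "z \<in> g ` (A + B)"
    then show "z \<in> g ` A + g ` B" by (auto simp: g.add elim!: set_plus_elim intro!: set_plus_intro)
  next
    fix z assume "z \<in> g ` A + g ` B"
    then obtain a b where "a \<in> A" "b \<in> B" "z = g (a + b)" by (auto simp: g.add elim!: set_plus_elim)
    then show "z \<in> g ` (A + B)" by auto
  qed
qed

lemma homeo_closedin:
  assumes g: "homeo g" and W: "closedin (vtop V) W"
  shows "closedin (vtop V) (g ` W)"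
  unfolding closedin_V_iff
proof (intro allI impI)
  fix x assume x: "\<forall>B\<in>Bs. \<exists>w\<in>g ` W. w - x \<in> B"
  obtain y where y: "x = g y" using g by (metis homeo_def bij_pointE)
  have "\<exists>w\<in>W. w - y \<in> B" if B: "B \<in> Bs" for B
  proof -
    obtain C where C: "C \<in> Bs" "C \<subseteq> g ` B" using g B by (auto simp: homeo_def)
    then obtain w where w: "w \<in> W" "g w - g y \<in> C" using x y by auto
    then have "g (w - y) \<in> g ` B" using C homeo_simps(2)[OF g] by auto
    then show ?thesis using w(1) inj_image_mem_iff[OF homeo_simps(4)[OF g]] by auto
  qed
  then show "x \<in> g ` W" using W y by (auto simp: closedin_V_iff)
qed

lemma homeo_base_Int:
  assumes g: "homeo g" and B: "B \<in> Bs" "B \<inter> X \<subseteq> M"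
  shows "\<exists>C\<in>Bs. C \<inter> g ` X \<subseteq> g ` M"
proof -
  obtain C where C: "C \<in> Bs" "C \<subseteq> g ` B" using g B by (auto simp: homeo_def)
  have "g ` B \<inter> g ` X \<subseteq> g ` M" using image_mono[OF B(2), of g] by (simp add: homeo_simps(5)[OF g])
  then show ?thesis using C by (intro bexI[of _ C]) auto
qed

lemma homeo_ro:
  assumes g: "homeo g" and s: "subspace M" "subspace X" "M \<subseteq> X" and r: "rel_open X M"
  shows "rel_open (g ` X) (g ` M)"
proof -
  obtain B where B: "B \<in> Bs" "B \<inter> X \<subseteq> M" using r rel_open_subspace_iff[OF s] by auto
  show ?thesis
    using rel_open_subspace_iff[OF homeo_simps(3)[OF g s(1)] homeo_simps(3)[OF g s(2)] image_mono[OF s(3)]]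
      homeo_base_Int[OF g B] by simp
qed

lemma homeo_complete_seq:
  assumes g: "homeo g" and X: "complete_seq X"
  shows "complete_seq (g ` X)"
proof -
  obtain B :: "nat \<Rightarrow> 'b set" where
    B: "\<And>j. subspace (B j)" "\<And>j. B j \<subseteq> X" "\<And>j. \<exists>C\<in>Bs. C \<inter> X \<subseteq> B j"
      "\<And>C. C \<in> Bs \<Longrightarrow> \<exists>j. B j \<subseteq> C" "\<And>j. B (Suc j) \<subseteq> B j"
      "\<And>x. (\<And>j. x j \<in> X \<and> x (Suc j) - x j \<in> B j) \<Longrightarrow> \<exists>l\<in>X. \<forall>j. l - x j \<in> B j"
    using X unfolding complete_seq_def by metis
  show ?thesis
    unfolding complete_seq_def
  proof (intro conjI exI[of _ "\<lambda>j. g ` B j"] allI ballI impI)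
    show "subspace (g ` X)" using X homeo_simps(3)[OF g] by (simp add: complete_seq_def)
    fix j
    show "subspace (g ` B j)" using B(1) homeo_simps(3)[OF g] by simp
    show "g ` B j \<subseteq> g ` X" using B(2) by (rule image_mono)
    show "g ` B (Suc j) \<subseteq> g ` B j" using B(5) by (rule image_mono)
    obtain C where "C \<in> Bs" "C \<inter> X \<subseteq> B j" using B(3)[of j] by (elim bexE)
    then show "\<exists>C\<in>Bs. C \<inter> g ` X \<subseteq> g ` B j" by (rule homeo_base_Int[OF g])
  next
    fix C assume "C \<in> Bs"
    then obtain D where D: "D \<in> Bs" "g ` D \<subseteq> C" using g by (auto simp: homeo_def)
    obtain j where "B j \<subseteq> D" using B(4)[OF D(1)] by (elim exE)
    then show "\<exists>j. g ` B j \<subseteq> C" using D(2) by (intro exI[of _ j]) auto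
  next
    fix x assume x: "\<forall>j. x j \<in> g ` X \<and> x (Suc j) - x j \<in> g ` B j"
    define y where "y j = ginv g (x j)" for j
    have gy: "g (y j) = x j" for j using g by (simp add: y_def homeo_def bij_is_surj surj_f_inv_f)
    have "y j \<in> X \<and> y (Suc j) - y j \<in> B j" for j
      using x[rule_format, of j] unfolding gy[symmetric] homeo_simps(2)[OF g, symmetric]
        inj_image_mem_iff[OF homeo_simps(4)[OF g]] .
    then obtain l where l: "l \<in> X" "\<forall>j. l - y j \<in> B j" using B(6)[of y] by blast
    have "g l - x j \<in> g ` B j" for j
      using l(2) unfolding gy[symmetric] homeo_simps(2)[OF g, symmetric] by simp
    then show "\<exists>l\<in>g ` X. \<forall>j. l - x j \<in> g ` B j" using l(1) by blast
  qed
qed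

lemma homeo_pair: "homeo g \<Longrightarrow> cpair X Y \<Longrightarrow> cpair (g ` X) (g ` Y)"
  using homeo_complete_seq[of g X] homeo_closedin[of g Y] homeo_simps(3)[of g Y] by (auto simp: cpair_def)

lemma homeo_chain: "homeo g \<Longrightarrow> cchain X Y Z \<Longrightarrow> cchain (g ` X) (g ` Y) (g ` Z)"
  by (simp add: cchain_def homeo_pair)

lemma homeo_OLC:
  assumes g: "homeo g" and XY: "cpair X Y" and P: "P \<in> OLC X Y"
  shows "g ` P \<in> OLC (g ` X) (g ` Y)"
proof -
  note s = cpairD[OF XY] and P' = OLCD[OF P] and gi = homeo_inv[OF g]
  have lin: "Vector_Spaces.linear scale scale g" using g by (simp add: homeo_def)
  show ?thesis
  proof (rule OLC_I[OF homeo_pair[OF g XY] homeo_simps(3)[OF g P'(1)] image_mono[OF P'(2)] image_mono[OF P'(3)]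
        homeo_ro[OF g P'(1) s(1) P'(3,4)]])
    fix M assume M: "subspace M" "g ` Y \<subseteq> M" "M \<subseteq> g ` P" "rel_open (g ` X) M"
    have MX: "M \<subseteq> g ` X" using M(3) P'(3) by auto
    have "rel_open (ginv g ` g ` X) (ginv g ` M)" by (rule homeo_ro[OF gi M(1) homeo_simps(3)[OF g s(1)] MX M(4)])
    then have 1: "rel_open X (ginv g ` M)" by (simp add: homeo_inv_image[OF g])
    have 2: "Y \<subseteq> ginv g ` M" "ginv g ` M \<subseteq> P"
      using image_mono[OF M(2), of "ginv g"] image_mono[OF M(3), of "ginv g"] by (simp_all add: homeo_inv_image[OF g])
    obtain n where "has_cod P (ginv g ` M) n" using OLC_has_cod[OF XY P homeo_simps(3)[OF gi M(1)] 2 1] by blast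
    from has_cod_image[OF lin homeo_simps(4)[OF g] this]
    show "\<exists>n. has_cod (g ` P) M n" by (auto simp: homeo_inv_image[OF g])
  qed
qed

lemma homeo_OLC_eq:
  assumes g: "homeo g" and XY: "cpair X Y"
  shows "OLC (g ` X) (g ` Y) = (\<lambda>P. g ` P) ` OLC X Y"
proof (intro equalityI subsetI)
  fix Q assume Q: "Q \<in> OLC (g ` X) (g ` Y)"
  have "ginv g ` Q \<in> OLC X Y"
    using homeo_OLC[OF homeo_inv[OF g] homeo_pair[OF g XY] Q] by (simp add: homeo_inv_image[OF g])
  then show "Q \<in> (\<lambda>P. g ` P) ` OLC X Y"
    using homeo_inv_image(2)[OF g, of Q] by (intro image_eqI[of _ _ "ginv g ` Q"]) auto
qed (use homeo_OLC[OF g XY] in auto)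

lemma homeo_vimage_qim:
  assumes g: "homeo g"
  shows "(\<lambda>A. g -` A) ` qim (g ` Y) (g ` P) = qim Y P"
proof -
  have "g -` cs (g ` Y) (g x) = cs Y x" for x
  proof -
    have "cs (g ` Y) (g x) = g ` cs Y x" by (auto simp: cs_def image_image homeo_simps(1)[OF g])
    then show ?thesis by (simp add: homeo_inv_image[OF g])
  qed
  then show ?thesis by (simp add: image_image)
qed

lemma dim_push_ext: "dim_push V g X Y d \<in> extensional (open_lin_compact (sq (g ` X) (g ` Y)))"
  by (simp add: dim_push_def)

lemma dim_push_qim:
  assumes g: "homeo g" and XY: "cpair X Y" and P: "P \<in> OLC X Y"
  shows "dim_push V g X Y d (qim (g ` Y) (g ` P)) = d (qim Y P)"
  using qim_in_olc[OF homeo_pair[OF g XY] homeo_OLC[OF g XY P]]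
  by (simp add: dim_push_def homeo_vimage_qim[OF g])

lemma dim_push_eqI:
  assumes g: "homeo g" and XY: "cpair X Y"
    and "d \<in> extensional (open_lin_compact (sq (g ` X) (g ` Y)))"
      "d' \<in> extensional (open_lin_compact (sq (g ` X) (g ` Y)))"
    and "\<And>P. P \<in> OLC X Y \<Longrightarrow> d (qim (g ` Y) (g ` P)) = d' (qim (g ` Y) (g ` P))"
  shows "d = d'"
  by (rule olc_ext[OF homeo_pair[OF g XY] assms(3,4)]) (use assms(5) in \<open>auto simp: homeo_OLC_eq[OF g XY]\<close>)

lemma dim_push_Dim:
  assumes g: "homeo g" and XY: "cpair X Y" and d: "d \<in> Dim (sq X Y)"
  shows "dim_push V g X Y d \<in> Dim (sq (g ` X) (g ` Y))"
  unfolding Dim_iff[OF homeo_pair[OF g XY]] homeo_OLC_eq[OF g XY]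
proof (intro conjI dim_push_ext ballI, elim imageE, hypsubst)
  fix P Q assume P: "P \<in> OLC X Y" and Q: "Q \<in> OLC X Y"
  have "reldim (g ` P) (g ` Q) = reldim P Q"
    using g by (intro reldim_image OLC_commens[OF XY P Q]) (auto simp: homeo_def bij_is_inj)
  then show "dim_push V g X Y d (qim (g ` Y) (g ` Q)) = dim_push V g X Y d (qim (g ` Y) (g ` P)) + reldim (g ` P) (g ` Q)"
    unfolding dim_push_qim[OF g XY P] dim_push_qim[OF g XY Q] using Dim_value[OF XY d P Q] by simp
qed

lemma dim_push_inv:
  assumes g: "homeo g" and XY: "cpair X Y" and d: "d \<in> Dim (sq X Y)"
  shows "dim_push V (ginv g) (g ` X) (g ` Y) (dim_push V g X Y d) = d"
proof (rule olc_ext[OF XY _ Dim_ext[OF d]])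
  show "dim_push V (ginv g) (g ` X) (g ` Y) (dim_push V g X Y d) \<in> extensional (open_lin_compact (sq X Y))"
    using dim_push_ext[of "ginv g" "g ` X" "g ` Y"] by (simp add: homeo_inv_image[OF g])
  fix P assume P: "P \<in> OLC X Y"
  show "dim_push V (ginv g) (g ` X) (g ` Y) (dim_push V g X Y d) (qim Y P) = d (qim Y P)"
    using dim_push_qim[OF homeo_inv[OF g] homeo_pair[OF g XY] homeo_OLC[OF g XY P], of "dim_push V g X Y d"]
    by (simp add: homeo_inv_image[OF g] dim_push_qim[OF g XY P])
qed

lemma dim_push_surj:
  assumes g: "homeo g" and XY: "cpair X Y" and d: "d \<in> Dim (sq (g ` X) (g ` Y))"
  obtains d0 where "d0 \<in> Dim (sq X Y)" "d = dim_push V g X Y d0"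
proof
  let ?d = "dim_push V (ginv g) (g ` X) (g ` Y) d"
  show 1: "?d \<in> Dim (sq X Y)"
    using dim_push_Dim[OF homeo_inv[OF g] homeo_pair[OF g XY] d] by (simp add: homeo_inv_image[OF g])
  show "d = dim_push V g X Y ?d"
  proof (rule dim_push_eqI[OF g XY Dim_ext[OF d] dim_push_ext])
    fix P assume P: "P \<in> OLC X Y"
    show "d (qim (g ` Y) (g ` P)) = dim_push V g X Y ?d (qim (g ` Y) (g ` P))"
      using dim_push_qim[OF homeo_inv[OF g] homeo_pair[OF g XY] homeo_OLC[OF g XY P], of d]
      by (simp add: homeo_inv_image[OF g] dim_push_qim[OF g XY P])
  qed
qed

lemma dim_push_shift:
  assumes g: "homeo g" and XY: "cpair X Y"
  shows "dim_push V g X Y (dim_shift (sq X Y) n d) = dim_shift (sq (g ` X) (g ` Y)) n (dim_push V g X Y d)"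
  by (rule dim_push_eqI[OF g XY dim_push_ext dim_shift_ext])
    (simp add: dim_push_qim[OF g XY] dim_shift_qim[OF XY] dim_shift_qim[OF homeo_pair[OF g XY] homeo_OLC[OF g XY]])

text \<open>A bijective linear map commutes with the two lattice operations
  \<open>P \<inter> Y\<close> and \<open>P + Y\<close> that enter the tensor product.\<close>

lemma dim_push_tensor:
  assumes g: "homeo g" and ch: "cchain X Y Z"
  shows "dim_push V g X Z (tens X Y Z e d) =
    tens (g ` X) (g ` Y) (g ` Z) (dim_push V g Y Z e) (dim_push V g X Y d)"
proof (rule dim_push_eqI[OF g cchainD(3)[OF ch] dim_push_ext dim_tensor_ext])
  fix P assume P: "P \<in> OLC X Z"
  show "dim_push V g X Z (tens X Y Z e d) (qim (g ` Z) (g ` P)) =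
      tens (g ` X) (g ` Y) (g ` Z) (dim_push V g Y Z e) (dim_push V g X Y d) (qim (g ` Z) (g ` P))"
    using dim_push_qim[OF g cchainD(2)[OF ch] OLC_Int[OF ch P], of e]
      dim_push_qim[OF g cchainD(1)[OF ch] OLC_plus[OF ch P], of d]
    by (simp add: dim_push_qim[OF g cchainD(3)[OF ch] P] dim_tensor_qim[OF ch P]
        dim_tensor_qim[OF homeo_chain[OF g ch] homeo_OLC[OF g cchainD(3)[OF ch] P]] homeo_simps(5,6)[OF g])
qed

lemma homeo_admissible:
  assumes g: "homeo g" and c: "complete_seq W1" "complete_seq W2" and W: "W \<in> adm W1 W2"
  shows "g ` W \<in> adm (g ` W1) (g ` W2)"
  using admissibleD[OF W c] homeo_OLC[OF g]
  by (auto simp: admissible_iff[OF homeo_complete_seq[OF g c(1)] homeo_complete_seq[OF g c(2)]]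
      homeo_simps(3)[OF g] homeo_closedin[OF g] homeo_OLC_eq[OF g])

text \<open>The inverse transport in the definition cancels. Since every theory on the image is a
  transported one, this equation determines the component.\<close>

lemma rel_push_value:
  assumes g: "homeo g" and c: "complete_seq W1" "complete_seq W2" and W: "W \<in> adm W1 W2"
    and d: "d \<in> Dim (sq W1 W)"
  shows "rel_push V g W1 W2 h (g ` W) (dim_push V g W1 W d) = dim_push V g W2 W (h W d)"
proof -
  note p = admissibleD(6)[OF W c]
  have "g -` g ` W = W" by (simp add: homeo_inv_image[OF g])
  then show ?thesis
    using homeo_admissible[OF g c W] dim_push_Dim[OF g p d] by (simp add: rel_push_def dim_push_inv[OF g p d])
qed

lemma rel_push_rel_torsor:
  assumes g: "homeo g" and c: "complete_seq W1" "complete_seq W2" and h: "h \<in> rel_torsor V W1 W2"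
  shows "rel_push V g W1 W2 h \<in> rel_torsor V (g ` W1) (g ` W2)"
proof -
  note gc = homeo_complete_seq[OF g c(1)] homeo_complete_seq[OF g c(2)]
  have adm: "\<exists>W\<in>adm W1 W2. X = g ` W" if X: "X \<in> adm (g ` W1) (g ` W2)" for X
    using homeo_admissible[OF homeo_inv[OF g] gc X] homeo_inv_image(2)[OF g, of X]
    by (intro bexI[of _ "ginv g ` X"]) (simp_all add: homeo_inv_image[OF g])
  show ?thesis
    unfolding rel_torsor_def
  proof (intro CollectI conjI PiE_I ballI impI)
    fix X assume X: "X \<in> adm (g ` W1) (g ` W2)"
    obtain W where W: "W \<in> adm W1 W2" "X = g ` W" using adm[OF X] by (elim bexE)
    note p = admissibleD(6,7)[OF W(1) c]
    show "rel_push V g W1 W2 h X \<in> dim_hom (sq (g ` W1) X) (sq (g ` W2) X)"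
      unfolding dim_hom_def W(2)
    proof (intro CollectI conjI PiE_I ballI allI)
      fix d assume d: "d \<in> Dim (sq (g ` W1) (g ` W))"
      obtain d0 where d0: "d0 \<in> Dim (sq W1 W)" "d = dim_push V g W1 W d0"
        by (rule dim_push_surj[OF g p(1) d])
      note hd = dim_homD[OF rel_torsorD(1)[OF h W(1)] d0(1)]
      show "rel_push V g W1 W2 h (g ` W) d \<in> Dim (sq (g ` W2) (g ` W))"
        unfolding d0(2) rel_push_value[OF g c W(1) d0(1)] by (rule dim_push_Dim[OF g p(2) hd(1)])
      fix n
      show "rel_push V g W1 W2 h (g ` W) (dim_shift (sq (g ` W1) (g ` W)) n d) =
          dim_shift (sq (g ` W2) (g ` W)) n (rel_push V g W1 W2 h (g ` W) d)"
        unfolding d0(2) rel_push_value[OF g c W(1) d0(1)] dim_push_shift[OF g p(1), symmetric]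
          rel_push_value[OF g c W(1) dim_shift_Dim[OF p(1) d0(1)]] hd(2) dim_push_shift[OF g p(2)] ..
    qed (use X W(2) in \<open>simp add: rel_push_def\<close>)
    fix X' d e assume X': "X' \<in> adm (g ` W1) (g ` W2)" "X' \<subseteq> X"
      and d: "d \<in> Dim (sq (g ` W1) X)" and e: "e \<in> Dim (sq X X')"
    obtain W' where W': "W' \<in> adm W1 W2" "X' = g ` W'" using adm[OF X'(1)] by (elim bexE)
    have WW: "W' \<subseteq> W" using X'(2) unfolding W(2) W'(2) by (simp add: inj_image_subset_iff[OF homeo_simps(4)[OF g]])
    note ch = admissible_chain[OF W(1) W'(1) WW c]
    obtain d0 where d0: "d0 \<in> Dim (sq W1 W)" "d = dim_push V g W1 W d0"
      using dim_push_surj[OF g p(1)] d W(2) by blast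
    obtain e0 where e0: "e0 \<in> Dim (sq W W')" "e = dim_push V g W W' e0"
      using dim_push_surj[OF g cchainD(2)[OF ch(1)]] e W(2) W'(2) by blast
    show "rel_push V g W1 W2 h X' (tens (g ` W1) X X' e d) = tens (g ` W2) X X' e (rel_push V g W1 W2 h X d)"
      unfolding W(2) W'(2) d0(2) e0(2) dim_push_tensor[OF g ch(1), symmetric] rel_push_value[OF g c W(1) d0(1)]
        rel_push_value[OF g c W'(1) dim_tensor_Dim[OF ch(1) e0(1) d0(1)]]
        rel_torsorD(2)[OF h W(1) W'(1) WW d0(1) e0(1)] dim_push_tensor[OF g ch(2)] ..
  qed (simp add: rel_push_def)
qed

end

section \<open>The filtration of the two-dimensional local field\<close>

notation fls_nth (infixl "$$" 75)

lemma fls_lattice_iff: "f \<in> fls_lattice n \<longleftrightarrow> (\<forall>i<n. f $$ i = 0)"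
proof
  assume "f \<in> fls_lattice n"
  then obtain p where "f = fls_X_intpow n * fps_to_fls p" by (auto simp: fls_lattice_def)
  then show "\<forall>i<n. f $$ i = 0" by (simp add: fls_X_intpow_times_conv_shift)
next
  assume f: "\<forall>i<n. f $$ i = 0"
  have "fls_subdegree (fls_shift n f) \<ge> 0"
    by (rule fls_subdegree_ge0I) (use f in simp)
  then have "fps_to_fls (fls_regpart (fls_shift n f)) = fls_shift n f" by (simp add: fls_regpart_to_fls_trivial)
  then have "f = fls_X_intpow n * fps_to_fls (fls_regpart (fls_shift n f))"
    by (simp add: fls_X_intpow_times_conv_shift)
  then show "f \<in> fls_lattice n" unfolding fls_lattice_def by blast
qed

lemma fls_lattice_0 [simp]: "0 \<in> fls_lattice n"
  by (simp add: fls_lattice_iff)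

lemma fls_lattice_add: "f \<in> fls_lattice n \<Longrightarrow> g \<in> fls_lattice n \<Longrightarrow> f + g \<in> fls_lattice n"
  by (simp add: fls_lattice_iff)

lemma fls_lattice_diff: "f \<in> fls_lattice n \<Longrightarrow> g \<in> fls_lattice n \<Longrightarrow> f - g \<in> fls_lattice n"
  by (simp add: fls_lattice_iff)

lemma fls_lattice_mono: "m \<le> n \<Longrightarrow> fls_lattice n \<subseteq> fls_lattice m"
  by (auto simp: fls_lattice_iff)

lemma fls_lattice_sum: "(\<And>i. i \<in> A \<Longrightarrow> f i \<in> fls_lattice n) \<Longrightarrow> sum f A \<in> fls_lattice n"
  by (induction A rule: infinite_finite_induct) (auto intro: fls_lattice_add)

lemma fls_in_lattice_subdegree: "f \<in> fls_lattice (fls_subdegree f)"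
  by (simp add: fls_lattice_iff)

text \<open>The convolution with summation bounds from the lattices instead of the exact orders: the
  added terms vanish, and zero factors need no separate treatment later.\<close>

lemma fls_times_nth_lattice:
  fixes x y :: "'b::field fls"
  assumes x: "x \<in> fls_lattice m" and y: "y \<in> fls_lattice n"
  shows "(x * y) $$ k = (\<Sum>i=m..k - n. x $$ i * y $$ (k - i))"
proof (cases "x = 0 \<or> y = 0")
  case False
  then have le: "m \<le> fls_subdegree x" "n \<le> fls_subdegree y"
    using x y by (meson fls_lattice_iff linorder_not_less nth_fls_subdegree_nonzero)+
  have "(x * y) $$ k = (\<Sum>i=fls_subdegree x..k - fls_subdegree y. x $$ i * y $$ (k - i))"
    by (rule fls_times_nth(2))
  also have "\<dots> = (\<Sum>i=m..k - n. x $$ i * y $$ (k - i))"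
  proof (rule sum.mono_neutral_left)
    show "\<forall>i\<in>{m..k - n} - {fls_subdegree x..k - fls_subdegree y}. x $$ i * y $$ (k - i) = 0"
      by (auto simp: not_le)
  qed (use le in auto)
  finally show ?thesis .
qed auto

lemma fls_lattice_mult:
  fixes x y :: "'b::field fls"
  assumes "x \<in> fls_lattice m" "y \<in> fls_lattice n"
  shows "x * y \<in> fls_lattice (m + n)"
  unfolding fls_lattice_iff by (auto simp: fls_times_nth_lattice[OF assms])

lemma fls_times_nth_lowest:
  fixes x y :: "'b::field fls"
  assumes "x \<in> fls_lattice m" "y \<in> fls_lattice n"
  shows "(x * y) $$ (m + n) = x $$ m * y $$ n"
  by (simp add: fls_times_nth_lattice[OF assms])

lemma fls_inverse_lattice: "f \<noteq> 0 \<Longrightarrow> inverse f \<in> fls_lattice (- fls_subdegree (f :: 'b::field fls))"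
  using fls_in_lattice_subdegree[of "inverse f"] by (simp add: fls_inverse_subdegree)

lemma fls_mult_lattice_image:
  fixes f :: "'b::field fls"
  assumes "f \<noteq> 0"
  shows "(\<lambda>x. f * x) ` fls_lattice m = fls_lattice (m + fls_subdegree f)"
proof (intro equalityI subsetI)
  fix y assume "y \<in> (\<lambda>x. f * x) ` fls_lattice m"
  then show "y \<in> fls_lattice (m + fls_subdegree f)"
    using fls_lattice_mult[OF fls_in_lattice_subdegree[of f]] by (auto simp: add.commute)
next
  fix y :: "'b fls" assume "y \<in> fls_lattice (m + fls_subdegree f)"
  then have "inverse f * y \<in> fls_lattice m"
    using fls_lattice_mult[OF fls_inverse_lattice[OF assms], of y] by fastforce
  moreover have "y = f * (inverse f * y)" using assms by (simp flip: mult.assoc)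
  ultimately show "y \<in> (\<lambda>x. f * x) ` fls_lattice m" by blast
qed

text \<open>Truncation, a linear choice of representatives modulo
  \<open>fls_lattice m\<close>.\<close>

definition fls_low :: "int \<Rightarrow> 'b::zero fls \<Rightarrow> 'b fls" where
  "fls_low m f = Abs_fls (\<lambda>i. if i < m then f $$ i else 0)"

lemma fls_low_nth [simp]: "fls_low m f $$ i = (if i < m then f $$ i else 0)"
  unfolding fls_low_def
  by (rule nth_Abs_fls_lower_bound[of "fls_subdegree f"]) auto

lemma L_nbhd_iff: "h \<in> L_nbhd l m \<longleftrightarrow> (\<forall>i<m. h $$ i \<in> fls_lattice (l i))"
proof
  assume "h \<in> L_nbhd l m"
  then show "\<forall>i<m. h $$ i \<in> fls_lattice (l i)" by (auto simp: L_nbhd_def fls_lattice_iff)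
next
  assume h: "\<forall>i<m. h $$ i \<in> fls_lattice (l i)"
  have "h = fls_low m h + (h - fls_low m h)" by simp
  moreover have "\<forall>i. fls_low m h $$ i \<in> fls_lattice (l i)" using h by simp
  moreover have "h - fls_low m h \<in> \<O> m" by (simp add: fls_lattice_iff)
  ultimately show "h \<in> L_nbhd l m" unfolding L_nbhd_def by blast
qed

lemma openin_nbhd_topology:
  assumes dir: "\<And>N N'. N \<in> \<B> \<Longrightarrow> N' \<in> \<B> \<Longrightarrow> \<exists>M\<in>\<B>. M \<subseteq> N \<inter> N'"
  shows "openin (nbhd_topology W \<B>) U \<longleftrightarrow> U \<subseteq> carrier W \<and> (\<forall>x\<in>U. \<exists>N\<in>\<B>. N +>\<^bsub>W\<^esub> x \<subseteq> U)"
proof -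
  let ?P = "\<lambda>U. U \<subseteq> carrier W \<and> (\<forall>x\<in>U. \<exists>N\<in>\<B>. N +>\<^bsub>W\<^esub> x \<subseteq> U)"
  have "istopology ?P"
    unfolding istopology_def
  proof (intro conjI allI impI)
    fix S T assume S: "?P S" and T: "?P T"
    show "S \<inter> T \<subseteq> carrier W" using S by auto
    show "\<forall>x\<in>S \<inter> T. \<exists>N\<in>\<B>. N +>\<^bsub>W\<^esub> x \<subseteq> S \<inter> T"
    proof
      fix x assume x: "x \<in> S \<inter> T"
      obtain N where N: "N \<in> \<B>" "N +>\<^bsub>W\<^esub> x \<subseteq> S" using x S by auto
      obtain N' where N': "N' \<in> \<B>" "N' +>\<^bsub>W\<^esub> x \<subseteq> T" using x T by auto
      obtain M where "M \<in> \<B>" "M \<subseteq> N \<inter> N'" using dir[OF N(1) N'(1)] by (elim bexE)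
      then show "\<exists>N\<in>\<B>. N +>\<^bsub>W\<^esub> x \<subseteq> S \<inter> T"
        using N N' by (intro bexI[of _ M]) (auto simp: coset_conv image_subset_iff subset_iff)
    qed
  next
    fix \<K> assume K: "\<forall>S\<in>\<K>. ?P S"
    show "\<Union>\<K> \<subseteq> carrier W" using K by auto
    show "\<forall>x\<in>\<Union>\<K>. \<exists>N\<in>\<B>. N +>\<^bsub>W\<^esub> x \<subseteq> \<Union>\<K>"
    proof
      fix x assume "x \<in> \<Union>\<K>"
      then obtain S where "S \<in> \<K>" "x \<in> S" by auto
      then obtain N where "N \<in> \<B>" "N +>\<^bsub>W\<^esub> x \<subseteq> S" using K by meson
      then show "\<exists>N\<in>\<B>. N +>\<^bsub>W\<^esub> x \<subseteq> \<Union>\<K>" using \<open>S \<in> \<K>\<close> by (intro bexI[of _ N]) auto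
    qed
  qed
  then show ?thesis by (simp add: nbhd_topology_def topology_inverse')
qed

definition Lbase :: "'a::field fls fls set set" where
  "Lbase = {L_nbhd l m | l m. True}"

lemma LbaseI: "L_nbhd l m \<in> Lbase"
  unfolding Lbase_def by blast

lemma LbaseE: "B \<in> Lbase \<Longrightarrow> (\<And>l m. B = L_nbhd l m \<Longrightarrow> thesis) \<Longrightarrow> thesis"
  unfolding Lbase_def by blast

locale two_dim =
  fixes \<iota> :: "'k::field \<Rightarrow> 'a::field"
  assumes fe: "finite_extension \<iota>"
begin

lemma iota: "\<iota> 1 = 1" "\<iota> (x + y) = \<iota> x + \<iota> y" "\<iota> (x * y) = \<iota> x * \<iota> y"
  using fe by (auto simp: finite_extension_def)

lemma L_scale_nth [simp]: "L_scale \<iota> c x $$ i $$ j = \<iota> c * x $$ i $$ j"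
  by (simp add: L_scale_def)

lemma vector_space_L: "vector_space (L_scale \<iota>)"
  by unfold_locales (auto simp: fls_eq_iff iota algebra_simps)

lemma vector_space_k: "vector_space (\<lambda>c x. \<iota> c * x)"
  by unfold_locales (auto simp: iota algebra_simps)

lemma L_tvs_simps: "carrier (L_tvs \<iota>) = UNIV" "\<zero>\<^bsub>L_tvs \<iota>\<^esub> = 0" "add (L_tvs \<iota>) = (+)" "smult (L_tvs \<iota>) = L_scale \<iota>"
  "vtop (L_tvs \<iota>) = nbhd_topology (L_module \<iota>) Lbase"
  by (simp_all add: L_tvs_def L_module_def module.extend_def tvs.fields_def Lbase_def)

lemma L_nbhd_subspace: "module.subspace (L_scale \<iota>) (L_nbhd l m)"
proof -
  interpret vector_space "L_scale \<iota>" by (rule vector_space_L)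
  show ?thesis by (rule subspaceI) (auto simp: L_nbhd_iff fls_lattice_iff)
qed

lemma Lbase_dir: "B \<in> Lbase \<Longrightarrow> C \<in> Lbase \<Longrightarrow> \<exists>D\<in>Lbase. D \<subseteq> B \<inter> C"
proof -
  assume "B \<in> Lbase" "C \<in> Lbase"
  then obtain l m l' m' where "B = L_nbhd l m" "C = L_nbhd l' m'" by (auto elim!: LbaseE)
  then have "L_nbhd (\<lambda>i. max (l i) (l' i)) (max m m') \<subseteq> B \<inter> C"
    by (auto simp: L_nbhd_iff fls_lattice_iff less_max_iff_disj)
  then show ?thesis using LbaseI by blast
qed

lemma openin_L: "openin (vtop (L_tvs \<iota>)) U \<longleftrightarrow> (\<forall>x\<in>U. \<exists>B\<in>Lbase. \<forall>b\<in>B. b + x \<in> U)"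
  using openin_nbhd_topology[of Lbase "L_module \<iota>" U, OF Lbase_dir]
  by (simp add: L_tvs_simps L_module_def coset_conv image_subset_iff)

lemma Lbase_subspace: "B \<in> Lbase \<Longrightarrow> module.subspace (L_scale \<iota>) B"
  by (erule LbaseE) (simp add: L_nbhd_subspace)

lemma Lbase_nonempty: "Lbase \<noteq> {}"
  using LbaseI by blast

sublocale lin_tvs "L_scale \<iota>" "L_tvs \<iota>" Lbase
proof -
  interpret vector_space "L_scale \<iota>" by (rule vector_space_L)
  show "lin_tvs (L_scale \<iota>) (L_tvs \<iota>) Lbase"
    by unfold_locales (fact L_tvs_simps(1-4) Lbase_nonempty Lbase_subspace Lbase_dir openin_L)+
qed

lemma O_subspace: "subspace (\<O> m)"
  by (rule subspaceI) (auto simp: fls_lattice_iff fls_eq_iff)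

lemma O_closed: "closedin (vtop (L_tvs \<iota>)) (\<O> m)"
  unfolding closedin_V_iff
proof (intro allI impI)
  fix x :: "'a fls fls" assume x: "\<forall>B\<in>Lbase. \<exists>w\<in>\<O> m. w - x \<in> B"
  show "x \<in> \<O> m"
    unfolding fls_lattice_iff
  proof (intro allI impI fls_eqI)
    fix i k assume i: "i < m"
    \<comment> \<open>This neighbourhood forces the coefficient of \<open>t^k u^i\<close> to
      vanish.\<close>
    obtain w where w: "w \<in> \<O> m" "w - x \<in> L_nbhd (\<lambda>_. k + 1) (i + 1)" using x LbaseI by blast
    have "(w - x) $$ i $$ k = 0" using w(2) by (simp add: L_nbhd_iff fls_lattice_iff)
    moreover have "w $$ i = 0" using w(1) i by (simp add: fls_lattice_iff)
    ultimately show "x $$ i $$ k = 0 $$ k" by simp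
  qed
qed

lemma O_mono: "m \<le> n \<Longrightarrow> (\<O> n :: 'a fls fls set) \<subseteq> \<O> m"
  by (rule fls_lattice_mono)

text \<open>Inside \<open>\<O> m\<close> a basic neighbourhood constrains only finitely many powers
  of \<open>u\<close>, so the neighbourhoods with one bound \<open>j\<close> for all of them form a
  countable base, although \<open>L\<close> itself has uncountably many bound functions. Limits are
  taken coefficientwise.\<close>

lemma O_complete: "complete_seq (\<O> m)"
  unfolding complete_seq_def
proof (intro conjI O_subspace exI[of _ "\<lambda>j. L_nbhd (\<lambda>_. int j) (m + int j) \<inter> \<O> m"] allI ballI impI)
  fix j
  show "L_nbhd (\<lambda>_. int j) (m + int j) \<inter> \<O> m \<subseteq> (\<O> m :: 'a fls fls set)" by auto
  show "subspace (L_nbhd (\<lambda>_. int j) (m + int j) \<inter> \<O> m)"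
    by (intro subspace_inter L_nbhd_subspace O_subspace)
  show "\<exists>C\<in>Lbase. C \<inter> \<O> m \<subseteq> L_nbhd (\<lambda>_. int j) (m + int j) \<inter> \<O> m"
    by (rule bexI[OF _ LbaseI[of "\<lambda>_. int j" "m + int j"]]) auto
  show "L_nbhd (\<lambda>_. int (Suc j)) (m + int (Suc j)) \<inter> \<O> m \<subseteq> L_nbhd (\<lambda>_. int j) (m + int j) \<inter> \<O> m"
    by (auto simp: L_nbhd_iff fls_lattice_iff)
next
  fix C :: "'a fls fls set" assume "C \<in> Lbase"
  then obtain l q where C: "C = L_nbhd l q" by (rule LbaseE)
  \<comment> \<open>The index dominates the finitely many bounds in rows \<open>m\<close> to
    \<open>q - 1\<close>; the entry \<open>q - m\<close> makes the window \<open>i < m + j\<close>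
    reach \<open>q\<close>.\<close>
  define j where "j = nat (Max (insert (q - m) (l ` {m..<q})))"
  have j: "q - m \<le> int j" "\<And>i. i \<in> {m..<q} \<Longrightarrow> l i \<le> int j"
  proof -
    have le: "z \<le> int j" if "z \<in> insert (q - m) (l ` {m..<q})" for z
      using Max_ge[OF _ that] by (simp add: j_def)
    show "q - m \<le> int j" by (rule le) simp
    show "l i \<le> int j" if "i \<in> {m..<q}" for i using that by (intro le) auto
  qed
  have "L_nbhd (\<lambda>_. int j) (m + int j) \<inter> \<O> m \<subseteq> C"
    unfolding C
  proof
    fix h assume h: "h \<in> L_nbhd (\<lambda>_. int j) (m + int j) \<inter> (\<O> m :: 'a fls fls set)"
    show "h \<in> L_nbhd l q"
      unfolding L_nbhd_iff
    proof (intro allI impI)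
      fix i assume i: "i < q"
      show "h $$ i \<in> fls_lattice (l i)"
      proof (cases "i < m")
        case True then show ?thesis using h by (simp add: fls_lattice_iff)
      next
        case False
        then have "h $$ i \<in> fls_lattice (int j)" using h i j(1) by (simp add: L_nbhd_iff)
        then show ?thesis using fls_lattice_mono[OF j(2)[of i]] False i by auto
      qed
    qed
  qed
  then show "\<exists>j. L_nbhd (\<lambda>_. int j) (m + int j) \<inter> \<O> m \<subseteq> C" by blast
next
  fix x :: "nat \<Rightarrow> 'a fls fls"
  assume x: "\<forall>j. x j \<in> \<O> m \<and> x (Suc j) - x j \<in> L_nbhd (\<lambda>_. int j) (m + int j) \<inter> \<O> m"
  have step: "x (Suc j) $$ i $$ k = x j $$ i $$ k" if "i < m + int j" "k < int j" for i j k
  proof -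
    have "x (Suc j) - x j \<in> L_nbhd (\<lambda>_. int j) (m + int j)" using x by blast
    then have "(x (Suc j) - x j) $$ i $$ k = 0" using that unfolding L_nbhd_iff fls_lattice_iff by blast
    then show ?thesis by simp
  qed
  have stable: "x j $$ i $$ k = x j0 $$ i $$ k" if "j0 \<le> j" "i < m + int j0" "k < int j0" for i j k j0
    using that(1)
  proof (induction j rule: dec_induct)
    case (step j)
    then show ?case using that \<open>\<And>i j k. i < m + int j \<Longrightarrow> k < int j \<Longrightarrow> x (Suc j) $$ i $$ k = x j $$ i $$ k\<close>[of i j k] by simp
  qed simp
  \<comment> \<open>The first stage from which the coefficient of \<open>t^k u^i\<close> is frozen:
    both \<open>i < m + J\<close> and \<open>k < J\<close> must hold.\<close>
  define J where "J i k = nat (max (i - m + 1) (k + 1))" for i k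
  define c where "c i = Abs_fls (\<lambda>k. x (J i k) $$ i $$ k)" for i
  have J: "x j $$ i $$ k = x (J i k) $$ i $$ k" if "i < m + int j" "k < int j" for i j k
  proof -
    have "J i k \<le> j" "i < m + int (J i k)" "k < int (J i k)" using that by (auto simp: J_def)
    then show ?thesis by (rule stable)
  qed
  have c: "c i $$ k = x (J i k) $$ i $$ k" for i k
    unfolding c_def
  proof (rule nth_Abs_fls_lower_bound)
    \<comment> \<open>For negative \<open>k\<close> the stage is \<open>?j\<close>, or
      \<open>0\<close> in a row below \<open>m\<close>. A single Laurent series thus bounds the pole
      order of \<open>c i\<close>.\<close>
    let ?j = "nat (i - m + 1)"
    show "\<forall>k<min 0 (fls_subdegree (x ?j $$ i)). x (J i k) $$ i $$ k = 0"
    proof (intro allI impI)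
      fix k assume k: "k < min 0 (fls_subdegree (x ?j $$ i))"
      have "J i k = ?j \<or> J i k = 0"
        using k by (auto simp: J_def max_def)
      then show "x (J i k) $$ i $$ k = 0"
      proof
        assume "J i k = ?j" then show ?thesis using k by simp
      next
        assume J0: "J i k = 0"
        then have "i < m" by (auto simp: J_def)
        then show ?thesis using x J0 by (simp add: fls_lattice_iff)
      qed
    qed
  qed
  define l where "l = Abs_fls c"
  have low: "c i = 0" if "i < m" for i
  proof (rule fls_eqI)
    fix k
    have "x (J i k) $$ i = 0" using x that by (auto simp: fls_lattice_iff)
    then show "c i $$ k = 0 $$ k" by (simp add: c)
  qed
  have l: "l $$ i = c i" for i
    unfolding l_def by (rule nth_Abs_fls_lower_bound[of m]) (use low in auto)
  show "\<exists>l\<in>\<O> m. \<forall>j. l - x j \<in> L_nbhd (\<lambda>_. int j) (m + int j) \<inter> \<O> m"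
  proof (intro bexI[of _ l] allI IntI)
    show lO: "l \<in> \<O> m" using low by (simp add: fls_lattice_iff l)
    fix j
    show "l - x j \<in> \<O> m" using lO x by (auto intro: fls_lattice_diff)
    show "l - x j \<in> L_nbhd (\<lambda>_. int j) (m + int j)"
      using J by (simp add: L_nbhd_iff fls_lattice_iff l c)
  qed
qed

lemma cpair_O: "m \<le> p \<Longrightarrow> cpair (\<O> m) (\<O> p)"
  using O_complete O_subspace O_closed O_mono by (simp add: cpair_def)

text \<open>The preimage in \<open>\<O> m\<close> of the product of the lattices
  \<open>t^(s i) k'[[t]]\<close> over the rows \<open>m \<le> i < p\<close>; rows below
  \<open>m\<close> vanish anyway.\<close>

definition box :: "int \<Rightarrow> int \<Rightarrow> (int \<Rightarrow> int) \<Rightarrow> 'a fls fls set" where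
  "box m p s = {f \<in> \<O> m. \<forall>i<p. f $$ i \<in> fls_lattice (s i)}"

lemma box_subspace: "subspace (box m p s)"
  by (rule subspaceI) (auto simp: box_def fls_lattice_iff fls_eq_iff)

abbreviation "D \<equiv> ext_degree \<iota>"

text \<open>Raising one exponent by \<open>1\<close> removes a single coefficient, that is, a copy
  of \<open>k'\<close>. This is where the degree \<open>D\<close> enters.\<close>

lemma box_step:
  assumes i: "m \<le> i" "i < p"
  shows "has_cod (box m p s) (box m p (s(i := s i + 1))) D"
proof -
  interpret k: vector_space "\<lambda>c x. \<iota> c * x" by (rule vector_space_k)
  \<comment> \<open>\<open>\<psi> c\<close> is the monomial \<open>c t^(s i) u^i\<close>, which
    embeds \<open>k'\<close> as a complement of the smaller box.\<close>
  define \<psi> :: "'a \<Rightarrow> 'a fls fls" where "\<psi> c = fls_shift (- i) (fls_const (fls_shift (- s i) (fls_const c)))" for c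
  have \<psi>: "\<psi> c $$ j $$ n = (if j = i \<and> n = s i then c else 0)" for c j n
    by (auto simp: \<psi>_def)
  have lin: "Vector_Spaces.linear (\<lambda>c x. \<iota> c * x) (L_scale \<iota>) \<psi>"
    by unfold_locales (auto simp: fls_eq_iff \<psi>)
  interpret \<psi>: Vector_Spaces.linear "\<lambda>c x. \<iota> c * x" "L_scale \<iota>" \<psi> by (rule lin)
  have inj: "inj \<psi>"
  proof (rule injI)
    fix c d assume "\<psi> c = \<psi> d"
    then have "\<psi> c $$ i $$ s i = \<psi> d $$ i $$ s i" by simp
    then show "c = d" by (simp add: \<psi>)
  qed
  obtain B0 where B0: "finite B0" "k.span B0 = UNIV" using fe by (auto simp: finite_extension_def)
  obtain B where B: "B \<subseteq> UNIV" "k.independent B" "UNIV \<subseteq> k.span B"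
    by (rule k.maximal_independent_subset[of UNIV])
  note B = B(2,3)
  have finB: "finite B" using k.independent_span_bound[OF B0(1) B(1)] B0(2) by simp
  have card: "card B = D"
    using k.basis_card_eq_dim[of B UNIV] B by (simp add: ext_degree_def)
  have span: "span (\<psi> ` B) = range \<psi>" using B(2) by (simp add: \<psi>.span_image top.extremum_unique)
  have in_box: "\<psi> c \<in> box m p s" for c
    using i by (auto simp: box_def fls_lattice_iff fls_eq_iff \<psi>)
  have "qbasis (box m p s) (box m p (s(i := s i + 1))) (\<psi> ` B)"
    unfolding qbasis_def span
  proof (intro conjI ballI)
    show "finite (\<psi> ` B)" using finB by simp
    show "independent (\<psi> ` B)" using B(1) inj by (rule \<psi>.independent_inj_image)
    show "\<psi> ` B \<subseteq> box m p s" using in_box by auto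
    show "range \<psi> \<inter> box m p (s(i := s i + 1)) \<subseteq> {0}"
    proof clarify
      fix c assume "\<psi> c \<in> box m p (s(i := s i + 1))"
      then have "\<psi> c $$ i $$ s i = 0" using i(2) by (auto simp: box_def fls_lattice_iff)
      then have "c = 0" by (simp add: \<psi>)
      then show "\<psi> c = 0" by simp
    qed
    fix x assume x: "x \<in> box m p s"
    have "x - \<psi> (x $$ i $$ s i) \<in> box m p (s(i := s i + 1))"
      unfolding box_def
    proof (intro CollectI conjI allI impI)
      show "x - \<psi> (x $$ i $$ s i) \<in> \<O> m" using x in_box by (auto simp: box_def intro: fls_lattice_diff)
      fix j assume j: "j < p"
      have "x $$ j $$ n = 0" if "n < s j" for n using x j that by (auto simp: box_def fls_lattice_iff)
      then show "(x - \<psi> (x $$ i $$ s i)) $$ j \<in> fls_lattice ((s(i := s i + 1)) j)"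
        by (auto simp: fls_lattice_iff \<psi> zless_add1_eq)
    qed
    then show "\<exists>y\<in>range \<psi>. x - y \<in> box m p (s(i := s i + 1))" by blast
  qed
  moreover have "card (\<psi> ` B) = D" using card inj by (metis card_image inj_on_subset subset_UNIV)
  moreover have "box m p (s(i := s i + 1)) \<subseteq> box m p s"
    by (auto simp: box_def fls_lattice_iff split: if_splits)
  ultimately show ?thesis using box_subspace unfolding has_cod_def by blast
qed

lemma box_row:
  assumes "finite I" "I \<subseteq> {m..<p}"
  shows "has_cod (box m p s) (box m p (\<lambda>i. if i \<in> I then s i + 1 else s i)) (card I * D)"
  using assms
proof (induction I rule: finite_induct)
  case empty
  then show ?case using has_cod_refl[OF box_subspace] by simp
next
  case (insert i I)
  let ?s = "\<lambda>i. if i \<in> I then s i + 1 else s i"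
  have "has_cod (box m p ?s) (box m p (?s(i := ?s i + 1))) D"
    using insert by (intro box_step) auto
  moreover have "?s(i := ?s i + 1) = (\<lambda>j. if j \<in> insert i I then s j + 1 else s j)"
    using insert by auto
  ultimately have "has_cod (box m p s) (box m p (\<lambda>j. if j \<in> insert i I then s j + 1 else s j)) (card I * D + D)"
    using has_cod_trans[of "box m p s" "box m p ?s"] insert by auto
  then show ?case using insert by (simp add: add.commute)
qed

lemma box_const:
  "has_cod (box m p (\<lambda>_. a)) (box m p (\<lambda>_. a + int n)) (n * (nat (p - m) * D))"
proof (induction n)
  case 0
  then show ?case using has_cod_refl[OF box_subspace] by simp
next
  case (Suc n)
  \<comment> \<open>Outside the rows \<open>m\<close> to \<open>p - 1\<close> the raised and
    unraised conditions agree: rows below \<open>m\<close> are zero and rows from \<open>p\<close>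
    on are free.\<close>
  have "box m p (\<lambda>i. if i \<in> {m..<p} then a + int n + 1 else a + int n) = box m p (\<lambda>_. a + int (Suc n))"
  proof -
    have "f $$ i \<in> fls_lattice (if i \<in> {m..<p} then a + int n + 1 else a + int n) \<longleftrightarrow>
        f $$ i \<in> fls_lattice (a + int (Suc n))" if "f \<in> \<O> m" "i < p" for f :: "'a fls fls" and i
    proof (cases "i < m")
      case True
      then have "f $$ i = 0" using that(1) by (simp add: fls_lattice_iff)
      then show ?thesis by simp
    next
      case False
      then show ?thesis using that(2) by (simp add: ac_simps)
    qed
    then show ?thesis unfolding box_def by blast
  qed
  then have "has_cod (box m p (\<lambda>_. a + int n)) (box m p (\<lambda>_. a + int (Suc n))) (nat (p - m) * D)"
    using box_row[of "{m..<p}" m p "\<lambda>_. a + int n"] by simp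
  from has_cod_trans[OF Suc this] show ?case by (simp add: add.commute)
qed

text \<open>Which of the two lattices is smaller depends on the sign of \<open>a\<close>, hence two
  cases with one signed answer.\<close>

lemma reldim_box: "m \<le> p \<Longrightarrow> reldim (box m p (\<lambda>_. a)) (box m p (\<lambda>_. 0)) = int D * a * (p - m)"
proof (cases "a \<ge> 0")
  case True
  assume "m \<le> p"
  then show ?thesis
    using reldim_eq[OF has_cod_refl[OF box_subspace] box_const[of m p 0 "nat a"]] True by simp
next
  case False
  assume "m \<le> p"
  then show ?thesis
    using reldim_eq[OF box_const[of m p a "nat (- a)"]] False has_cod_refl[OF box_subspace[of m p "\<lambda>_. 0"]] by simp
qed

abbreviation reflat :: "int \<Rightarrow> int \<Rightarrow> 'a fls fls set" where
  "reflat m p \<equiv> box m p (\<lambda>_. 0)"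

text \<open>An open \<open>N\<close> containing \<open>\<O> p\<close> contains the box with a
  sufficiently large constant exponent, and that box has finite codimension.\<close>

lemma reflat_OLC:
  assumes mp: "m \<le> p"
  shows "reflat m p \<in> OLC (\<O> m) (\<O> p)"
proof (rule OLC_I[OF cpair_O[OF mp] box_subspace])
  show "\<O> p \<subseteq> reflat m p" using mp by (auto simp: box_def fls_lattice_iff)
  show sub: "reflat m p \<subseteq> \<O> m" by (auto simp: box_def)
  have "L_nbhd (\<lambda>_. 0) p \<inter> \<O> m \<subseteq> reflat m p" by (auto simp: box_def L_nbhd_iff)
  then show "rel_open (\<O> m) (reflat m p)" using rel_open_subspace_iff[OF box_subspace O_subspace sub] LbaseI by blast
  fix N assume N: "subspace N" "\<O> p \<subseteq> N" "N \<subseteq> reflat m p" "rel_open (\<O> m) N"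
  then obtain l q where lq: "L_nbhd l q \<inter> \<O> m \<subseteq> N"
    using rel_open_subspace_iff[OF N(1) O_subspace, of m] sub by (auto elim!: LbaseE)
  \<comment> \<open>Only the finitely many rows below \<open>p\<close> matter modulo
    \<open>\<O> p\<close>; the entry \<open>0\<close> makes \<open>a\<close> a natural number even
    when all bounds are negative.\<close>
  define a where "a = nat (Max (insert 0 (l ` {m..<p})))"
  have a: "l i \<le> int a" if "i \<in> {m..<p}" for i
  proof -
    have "l i \<in> insert 0 (l ` {m..<p})" using that by auto
    then have "l i \<le> Max (insert 0 (l ` {m..<p}))" by (intro Max_ge) auto
    then show ?thesis unfolding a_def by linarith
  qed
  have "box m p (\<lambda>_. 0 + int a) \<subseteq> N"
  proof
    fix h assume h: "h \<in> box m p (\<lambda>_. 0 + int a)"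
    have "fls_low p h $$ i \<in> fls_lattice (l i)" for i
    proof (cases "i \<in> {m..<p}")
      case True
      then have "h $$ i \<in> fls_lattice (int a)" using h by (simp add: box_def)
      then show ?thesis using fls_lattice_mono[OF a[OF True]] True by auto
    next
      case False
      then have "fls_low p h $$ i = 0" using h by (auto simp: box_def fls_lattice_iff)
      then show ?thesis by simp
    qed
    then have "fls_low p h \<in> L_nbhd l q \<inter> \<O> m" using h by (auto simp: L_nbhd_iff box_def fls_lattice_iff)
    moreover have "h - fls_low p h \<in> \<O> p" by (simp add: fls_lattice_iff)
    ultimately have "fls_low p h + (h - fls_low p h) \<in> N" using lq N by (intro subspace_add[OF N(1)]) auto
    then show "h \<in> N" by simp
  qed
  from has_cod_split[OF box_const N(1) this N(3)] show "\<exists>n. has_cod (reflat m p) N n" by metis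
qed

lemma reflat_Int: "m \<le> n \<Longrightarrow> reflat m p \<inter> \<O> n = reflat n p"
  by (auto simp: box_def fls_lattice_iff)

text \<open>With \<open>reflat_Int\<close> this makes the reference lattices compatible with the
  exact sequences of the filtration, so tensor products can be evaluated on them.\<close>

lemma reflat_plus:
  assumes "m \<le> n" "n \<le> p"
  shows "reflat m p + \<O> n = reflat m n"
proof (intro equalityI subsetI)
  fix x assume "x \<in> reflat m p + \<O> n"
  then show "x \<in> reflat m n"
    using assms by (auto simp: box_def fls_lattice_iff elim!: set_plus_elim)
next
  fix x assume x: "x \<in> reflat m n"
  have "fls_low n x \<in> reflat m p" using x by (auto simp: box_def fls_lattice_iff)
  moreover have "x - fls_low n x \<in> \<O> n" by (simp add: fls_lattice_iff)
  ultimately have "fls_low n x + (x - fls_low n x) \<in> reflat m p + \<O> n" by (rule set_plus_intro)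
  then show "x \<in> reflat m p + \<O> n" by simp
qed

lemma O_admissible:
  assumes "m \<le> p" "n \<le> p"
  shows "\<O> p \<in> admissible (L_tvs \<iota>) (\<O> m) (\<O> n)"
  unfolding admissible_iff[OF O_complete O_complete]
  using reflat_OLC[OF assms(1)] reflat_OLC[OF assms(2)] O_subspace O_closed O_mono[OF assms(1)] O_mono[OF assms(2)] by auto

lemma O_Int: "(\<O> m \<inter> \<O> n :: 'a fls fls set) = \<O> (max m n)"
  by (auto simp: fls_lattice_iff less_max_iff_disj)

lemma has_top_O: "has_top (\<O> m) (\<O> n)"
  unfolding has_top_def O_Int using O_complete O_admissible[of m "max m n" n] by simp

lemma cchain_O: "m \<le> n \<Longrightarrow> n \<le> p \<Longrightarrow> cchain (\<O> m) (\<O> n) (\<O> p)"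
  using cpair_O by (simp add: cchain_def)

end

section \<open>Multiplication operators\<close>

lemma nu1_conv: "nu1 f = fls_subdegree (f $$ nu2 f)"
  unfolding nu1_def fls_X_intpow_times_conv_shift by simp

lemma nu2_mult: "f \<noteq> 0 \<Longrightarrow> g \<noteq> 0 \<Longrightarrow> nu2 (f * g) = nu2 f + nu2 g"
  by (simp add: nu2_def)

lemma nu1_mult:
  assumes "f \<noteq> 0" "g \<noteq> 0"
  shows "nu1 (f * g) = nu1 f + nu1 g"
proof -
  have "(f * g) $$ (nu2 f + nu2 g) = f $$ nu2 f * g $$ nu2 g"
    unfolding nu2_def by (rule fls_times_nth_lowest[OF fls_in_lattice_subdegree fls_in_lattice_subdegree])
  moreover have "f $$ nu2 f \<noteq> 0" "g $$ nu2 g \<noteq> 0" using assms by (simp_all add: nu2_def)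
  ultimately show ?thesis using assms by (simp add: nu1_conv nu2_mult)
qed

lemma nu_1: "nu1 1 = 0" "nu2 1 = 0"
  by (simp_all add: nu1_conv nu2_def)

lemma nu_inverse:
  assumes "f \<noteq> 0"
  shows "nu1 (inverse f) = - nu1 f" "nu2 (inverse f) = - nu2 f"
  using nu1_mult[OF assms nonzero_imp_inverse_nonzero[OF assms]]
    nu2_mult[OF assms nonzero_imp_inverse_nonzero[OF assms]] assms by (simp_all add: nu_1)

context two_dim
begin

abbreviation M :: "'a fls fls \<Rightarrow> 'a fls fls \<Rightarrow> 'a fls fls" where
  "M f \<equiv> (\<lambda>x. f * x)"

lemma M_image_O: "f \<noteq> 0 \<Longrightarrow> M f ` \<O> m = \<O> (m + nu2 f)"
  unfolding nu2_def by (rule fls_mult_lattice_image)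

lemma M_linear: "Vector_Spaces.linear (L_scale \<iota>) (L_scale \<iota>) (M f)"
  by unfold_locales (auto simp: L_scale_def algebra_simps)

lemma M_inverse: "f \<noteq> 0 \<Longrightarrow> M (inverse f) (M f x) = x" "f \<noteq> 0 \<Longrightarrow> M f (M (inverse f) x) = x"
  by (simp_all flip: mult.assoc)

lemma M_nth_lattice:
  assumes h: "\<And>j. fls_subdegree f \<le> j \<Longrightarrow> h $$ (i - j) \<in> fls_lattice (l - fls_subdegree (f $$ j))"
  shows "(M f h) $$ i \<in> fls_lattice l"
  unfolding fls_times_nth_lattice[OF fls_in_lattice_subdegree[of f] fls_in_lattice_subdegree[of h]]
proof (rule fls_lattice_sum)
  fix j assume "j \<in> {fls_subdegree f..i - fls_subdegree h}"
  then have "f $$ j * h $$ (i - j) \<in> fls_lattice (fls_subdegree (f $$ j) + (l - fls_subdegree (f $$ j)))"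
    by (intro fls_lattice_mult[OF fls_in_lattice_subdegree h]) auto
  then show "f $$ j * h $$ (i - j) \<in> fls_lattice l" by simp
qed

lemma M_continuous:
  assumes "B \<in> Lbase"
  shows "\<exists>C\<in>Lbase. M f ` C \<subseteq> B"
proof -
  obtain l m where B: "B = L_nbhd l m" using assms by (rule LbaseE)
  \<comment> \<open>\<open>S b\<close> collects the conditions on row \<open>b\<close> of
    \<open>h\<close>: it meets a constrained row \<open>i < m\<close> through the coefficient
    \<open>i - b\<close> of \<open>f\<close>, which vanishes below the order of \<open>f\<close>. So
    finitely many \<open>i\<close> occur; the entry \<open>0\<close> keeps \<open>Max\<close>
    defined.\<close>
  define S where "S b = insert 0 ((\<lambda>i. l i - fls_subdegree (f $$ (i - b))) ` {b + fls_subdegree f..<m})" for b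
  have S: "z \<le> Max (S b)" if "z \<in> S b" for z b by (rule Max_ge[OF _ that]) (simp add: S_def)
  have "M f ` L_nbhd (\<lambda>b. Max (S b)) (m - fls_subdegree f) \<subseteq> B"
    unfolding B
  proof (rule image_subsetI)
    fix h :: "'a fls fls" assume h: "h \<in> L_nbhd (\<lambda>b. Max (S b)) (m - fls_subdegree f)"
    show "f * h \<in> L_nbhd l m"
      unfolding L_nbhd_iff
    proof (intro allI impI)
      fix i assume i: "i < m"
      show "(f * h) $$ i \<in> fls_lattice (l i)"
      proof (rule M_nth_lattice)
        fix j assume j: "fls_subdegree f \<le> j"
        have "l i - fls_subdegree (f $$ j) \<in> S (i - j)"
          using i j by (auto simp: S_def intro!: image_eqI[of _ _ i])
        from fls_lattice_mono[OF S[OF this]]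
        show "h $$ (i - j) \<in> fls_lattice (l i - fls_subdegree (f $$ j))"
          using h i j unfolding L_nbhd_iff by auto
      qed
    qed
  qed
  then show ?thesis using LbaseI by blast
qed

lemma homeo_M:
  assumes f: "f \<noteq> 0"
  shows "homeo (M f)"
  unfolding homeo_def
proof (intro conjI ballI M_linear M_continuous)
  show "bij (M f)" by (rule o_bij[of "M (inverse f)"]) (auto simp: fun_eq_iff M_inverse[OF f])
  fix B :: "'a fls fls set" assume "B \<in> Lbase"
  then obtain C where C: "C \<in> Lbase" "M (inverse f) ` C \<subseteq> B" using M_continuous by blast
  have "C \<subseteq> M f ` B"
  proof
    fix x assume "x \<in> C"
    then have "M (inverse f) x \<in> B" using C by auto
    then show "x \<in> M f ` B" using M_inverse(2)[OF f, of x] by (metis imageI)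
  qed
  then show "\<exists>C\<in>Lbase. C \<subseteq> M f ` B" using C by blast
qed

lemma box_one: "f \<in> box m (m + 1) s \<longleftrightarrow> f \<in> \<O> m \<and> f $$ m \<in> fls_lattice (s m)"
proof -
  have "f $$ i \<in> fls_lattice (s i)" if "f \<in> \<O> m" "f $$ m \<in> fls_lattice (s m)" "i < m + 1" for i
    using that by (cases "i = m") (auto simp: fls_lattice_iff)
  then show ?thesis by (auto simp: box_def)
qed

text \<open>Membership in a box with one row depends only on the lowest coefficient, and that of
  \<open>f * x\<close> is the product of the lowest coefficients.\<close>

lemma M_image_box:
  assumes f: "f \<noteq> 0"
  shows "M f ` reflat m (m + 1) = box (m + nu2 f) (m + nu2 f + 1) (\<lambda>_. nu1 f)"
proof -
  have key: "f * x \<in> box (m + nu2 f) (m + nu2 f + 1) (\<lambda>_. nu1 f) \<longleftrightarrow> x \<in> reflat m (m + 1)" if x: "x \<in> \<O> m" for x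
  proof -
    have fO: "f \<in> \<O> (nu2 f)" by (simp add: nu2_def fls_in_lattice_subdegree)
    have 1: "(f * x) $$ (m + nu2 f) = f $$ nu2 f * x $$ m"
      using fls_times_nth_lowest[OF fO x] by (simp add: add.commute)
    have 2: "f * x \<in> \<O> (m + nu2 f)" using fls_lattice_mult[OF fO x] by (simp add: add.commute)
    have nz: "f $$ nu2 f \<noteq> 0" using f by (simp add: nu2_def)
    have "f $$ nu2 f * x $$ m \<in> fls_lattice (nu1 f) \<longleftrightarrow> x $$ m \<in> fls_lattice 0"
    proof -
      have "f $$ nu2 f * x $$ m \<in> (\<lambda>z. f $$ nu2 f * z) ` fls_lattice 0 \<longleftrightarrow> x $$ m \<in> fls_lattice 0"
        using nz by auto
      then show ?thesis using fls_mult_lattice_image[OF nz, of 0] by (simp add: nu1_conv)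
    qed
    then show ?thesis unfolding box_one 1 using 2 x by simp
  qed
  show ?thesis
  proof (intro equalityI subsetI)
    fix y assume "y \<in> M f ` reflat m (m + 1)"
    then obtain x where x: "x \<in> reflat m (m + 1)" "y = f * x" by auto
    then show "y \<in> box (m + nu2 f) (m + nu2 f + 1) (\<lambda>_. nu1 f)" using key[of x] by (simp add: box_def)
  next
    fix y assume y: "y \<in> box (m + nu2 f) (m + nu2 f + 1) (\<lambda>_. nu1 f)"
    then have "y \<in> M f ` \<O> m" unfolding M_image_O[OF f] box_one by blast
    then obtain x where x: "x \<in> \<O> m" "y = f * x" by auto
    then show "y \<in> M f ` reflat m (m + 1)" using key[OF x(1)] y by auto
  qed
qed

lemma M_reflat_OLC:
  assumes f: "f \<noteq> 0" and mq: "m \<le> q"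
  shows "M f ` reflat m q \<in> OLC (\<O> (m + nu2 f)) (\<O> (q + nu2 f))"
  using homeo_OLC[OF homeo_M[OF f] cpair_O[OF mq] reflat_OLC[OF mq]] by (simp add: M_image_O[OF f])

text \<open>The image of a reference lattice is in general no box, since higher coefficients of
  \<open>f\<close> may have large poles in \<open>t\<close>. Downward induction on \<open>m\<close>
  splits off the lowest layer by \<open>reldim_exact\<close>, and each layer contributes
  \<open>D * nu1 f\<close>.\<close>

lemma reldim_M_reflat:
  assumes f: "f \<noteq> 0" and mq: "m \<le> q"
  shows "reldim (M f ` reflat m q) (reflat (m + nu2 f) (q + nu2 f)) = int D * nu1 f * (q - m)"
  using mq
proof (induction rule: int_le_induct)
  case base
  have "reflat r r = \<O> r" for r by (auto simp: box_def fls_lattice_iff)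
  moreover have "reldim P P = 0" if "subspace P" for P using reldim_eq[OF has_cod_refl[OF that] has_cod_refl[OF that]] by simp
  ultimately show ?case using O_subspace by (simp add: M_image_O[OF f])
next
  case (step m)
  let ?\<nu> = "nu2 f" and ?P = "M f ` reflat (m - 1) q"
  note g = homeo_M[OF f]
  have le: "m - 1 \<le> q" "m - 1 + ?\<nu> \<le> q + ?\<nu>" "m - 1 \<le> m" "m - 1 + ?\<nu> \<le> m + ?\<nu>" "m + ?\<nu> \<le> q + ?\<nu>" using step by auto
  have com: "commens ?P (reflat (m - 1 + ?\<nu>) (q + ?\<nu>))"
    by (rule OLC_commens[OF cpair_O[OF le(2)] M_reflat_OLC[OF f le(1)] reflat_OLC[OF le(2)]])
  have Y: "\<O> (m + ?\<nu>) = M f ` \<O> m" by (simp add: M_image_O[OF f])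
  have 1: "?P \<inter> \<O> (m + ?\<nu>) = M f ` reflat m q"
    unfolding Y homeo_simps(5)[OF g, symmetric] reflat_Int[OF le(3)] ..
  have 2: "?P + \<O> (m + ?\<nu>) = box (m - 1 + ?\<nu>) (m + ?\<nu>) (\<lambda>_. nu1 f)"
    unfolding Y homeo_simps(6)[OF g, symmetric] reflat_plus[OF le(3) step(1)]
    using M_image_box[OF f, of "m - 1"] by simp
  have "reldim ?P (reflat (m - 1 + ?\<nu>) (q + ?\<nu>)) =
      reldim (M f ` reflat m q) (reflat (m + ?\<nu>) (q + ?\<nu>)) + reldim (box (m - 1 + ?\<nu>) (m + ?\<nu>) (\<lambda>_. nu1 f)) (reflat (m - 1 + ?\<nu>) (m + ?\<nu>))"
    unfolding reldim_exact[OF com O_subspace[of "m + ?\<nu>"]] 1 2 reflat_Int[OF le(4)] reflat_plus[OF le(4,5)] ..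
  also have "\<dots> = int D * nu1 f * (q - m) + int D * nu1 f" using step reldim_box[OF le(4), of "nu1 f"] by simp
  finally show ?case by (simp add: algebra_simps)
qed

text \<open>The set \<open>t^l u^m k'[[t,u]]\<close>.\<close>

definition cube :: "int \<Rightarrow> int \<Rightarrow> 'a fls fls set" where
  "cube m l = {f \<in> \<O> m. \<forall>i. f $$ i \<in> fls_lattice l}"

lemma L_quot_nbhd_eq: "L_quot_nbhd \<iota> m n l = qim (\<O> n) (cube m l)"
proof -
  let ?T = "\<lambda>m l h. fls_const (fls_X_intpow l) * fls_X_intpow m * h :: 'a fls fls"
  have nth: "?T m l h $$ i = fls_shift (- l) (h $$ (i - m))" for m l h i
    unfolding mult.assoc fls_X_intpow_times_conv_shift(1) fls_mult_const_nth by simp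
  have nth2: "?T m l h $$ i $$ k = h $$ (i - m) $$ (k - l)" for m l h i k
    unfolding nth by simp
  have "?T m l ` power_series2 = cube m l"
  proof (intro equalityI subsetI)
    fix x assume "x \<in> ?T m l ` power_series2"
    then obtain h where h: "h \<in> power_series2" "x = ?T m l h" by auto
    show "x \<in> cube m l"
      unfolding h(2) cube_def using h(1)
      by (auto simp: fls_lattice_iff power_series2_def nth2 nth)
  next
    fix x assume x: "x \<in> cube m l"
    have "?T (- m) (- l) x \<in> power_series2"
      using x unfolding cube_def fls_lattice_iff power_series2_def mem_Collect_eq nth by simp
    moreover have "x = ?T m l (?T (- m) (- l) x)"
      by (intro fls_eqI) (simp only: nth2, simp)
    ultimately show "x \<in> ?T m l ` power_series2" by blast
  qed
  moreover have "L_quot_nbhd \<iota> m n l = cs (\<O> n) ` (?T m l ` power_series2)"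
    by (simp add: L_quot_nbhd_def coset_conv L_tvs_simps cs_def image_image)
  ultimately show ?thesis by simp
qed

lemma openin_L_quot:
  assumes mn: "m \<le> n"
  shows "openin (vtop (L_quot \<iota> m n)) S \<longleftrightarrow> S \<subseteq> qim (\<O> n) (\<O> m) \<and>
    (\<forall>x\<in>\<O> m. cs (\<O> n) x \<in> S \<longrightarrow> (\<exists>l. \<forall>s\<in>cube m l. cs (\<O> n) (s + x) \<in> S))"
proof -
  let ?Q = "subquot (L_tvs \<iota>) (\<O> m) (\<O> n)"
  interpret Q: presented "L_scale \<iota>" "\<O> m" "\<O> n" ?Q "cs (\<O> n)"
    by (rule presented_subquot[OF O_subspace O_subspace O_mono[OF mn]])
  have cm: "cube m l \<subseteq> cube m l'" if "l' \<le> l" for l l'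
    using fls_lattice_mono[OF that] by (auto simp: cube_def)
  have "\<exists>K\<in>range (L_quot_nbhd \<iota> m n). K \<subseteq> N \<inter> N'"
    if N: "N \<in> range (L_quot_nbhd \<iota> m n)" "N' \<in> range (L_quot_nbhd \<iota> m n)" for N N'
  proof -
    obtain l l' where "N = qim (\<O> n) (cube m l)" "N' = qim (\<O> n) (cube m l')" using N by (auto simp: L_quot_nbhd_eq)
    then have "L_quot_nbhd \<iota> m n (max l l') \<subseteq> N \<inter> N'"
      using cm[of l "max l l'"] cm[of l' "max l l'"] by (auto simp: L_quot_nbhd_eq)
    then show ?thesis by blast
  qed
  note op = openin_nbhd_topology[OF this, of ?Q S]
  have coset: "L_quot_nbhd \<iota> m n l +>\<^bsub>?Q\<^esub> cs (\<O> n) x = (\<lambda>s. cs (\<O> n) (s + x)) ` cube m l" if "x \<in> \<O> m" for l x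
    unfolding L_quot_nbhd_eq coset_conv image_image
    by (rule image_cong) (use that Q.add_eq in \<open>auto simp: cube_def\<close>)
  have "openin (vtop (L_quot \<iota> m n)) S \<longleftrightarrow> S \<subseteq> qim (\<O> n) (\<O> m) \<and> (\<forall>A\<in>S. \<exists>l. L_quot_nbhd \<iota> m n l +>\<^bsub>?Q\<^esub> A \<subseteq> S)"
    using op by (simp add: L_quot_def Q.carrier_eq)
  also have "\<dots> \<longleftrightarrow> S \<subseteq> qim (\<O> n) (\<O> m) \<and> (\<forall>x\<in>\<O> m. cs (\<O> n) x \<in> S \<longrightarrow> (\<exists>l. L_quot_nbhd \<iota> m n l +>\<^bsub>?Q\<^esub> cs (\<O> n) x \<subseteq> S))"
    by blast
  finally show ?thesis by (simp add: coset image_subset_iff)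
qed

lemma topspace_L_quot:
  assumes "m \<le> n"
  shows "topspace (vtop (L_quot \<iota> m n)) = qim (\<O> n) (\<O> m)"
proof -
  have "openin (vtop (L_quot \<iota> m n)) (qim (\<O> n) (\<O> m))"
    unfolding openin_L_quot[OF assms] by (auto simp: cube_def intro!: fls_lattice_add)
  moreover have "topspace (vtop (L_quot \<iota> m n)) \<subseteq> qim (\<O> n) (\<O> m)"
    using openin_topspace[of "vtop (L_quot \<iota> m n)"] unfolding openin_L_quot[OF assms] by simp
  ultimately show ?thesis using openin_subset by blast
qed

text \<open>Modulo \<open>\<O> p\<close> only the coefficients of \<open>f\<close> up to index
  \<open>p - n\<close> act on series starting at \<open>u^n\<close>. Their finitely many orders in
  \<open>t\<close> bound the loss, and \<open>s'\<close> is the truncation of the product.\<close>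

lemma M_cube:
  assumes sub: "M f ` \<O> n \<subseteq> \<O> m"
  shows "\<exists>l'. \<forall>s\<in>cube n l'. \<exists>s'\<in>cube m l. f * s - s' \<in> \<O> p"
proof -
  define S where "S = insert 0 ((\<lambda>j. l - fls_subdegree (f $$ j)) ` {fls_subdegree f..p - n})"
  have S: "z \<le> Max S" if "z \<in> S" for z by (rule Max_ge[OF _ that]) (simp add: S_def)
  have "\<exists>s'\<in>cube m l. f * s - s' \<in> \<O> p" if s: "s \<in> cube n (Max S)" for s
  proof (rule bexI[of _ "fls_low p (f * s)"])
    have fs: "f * s \<in> \<O> m" using sub s by (auto simp: cube_def)
    have "(f * s) $$ i \<in> fls_lattice l" if i: "i < p" for i
    proof (rule M_nth_lattice)
      fix j assume j: "fls_subdegree f \<le> j"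
      show "s $$ (i - j) \<in> fls_lattice (l - fls_subdegree (f $$ j))"
      proof (cases "i - j < n")
        case True
        then have "s $$ (i - j) = 0" using s by (auto simp: cube_def fls_lattice_iff)
        then show ?thesis by simp
      next
        case False
        then have "l - fls_subdegree (f $$ j) \<in> S" using i j by (auto simp: S_def)
        from fls_lattice_mono[OF S[OF this]] show ?thesis using s by (auto simp: cube_def)
      qed
    qed
    then show "fls_low p (f * s) \<in> cube m l" using fs by (auto simp: cube_def fls_lattice_iff[of _ m])
    show "f * s - fls_low p (f * s) \<in> \<O> p" by (simp add: fls_lattice_iff)
  qed
  then show ?thesis by blast
qed

lemma M_L_End:
  assumes f: "f \<noteq> 0"
  shows "M f \<in> L_End \<iota>"
  unfolding L_End_def
proof (intro CollectI conjI allI impI M_linear)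
  fix n show "\<exists>m. M f ` \<O> n \<subseteq> \<O> m" by (rule exI[of _ "n + nu2 f"]) (simp add: M_image_O[OF f])
next
  fix m show "\<exists>n. M f ` \<O> n \<subseteq> \<O> m" by (rule exI[of _ "m - nu2 f"]) (simp add: M_image_O[OF f])
next
  fix n1 n2 m1 m2 assume a: "n1 < n2 \<and> m1 < m2 \<and> M f ` \<O> n1 \<subseteq> \<O> m1 \<and> M f ` \<O> n2 \<subseteq> \<O> m2"
  have n: "n1 \<le> n2" and m: "m1 \<le> m2" and s1: "M f ` \<O> n1 \<subseteq> \<O> m1" and s2: "M f ` \<O> n2 \<subseteq> \<O> m2" using a by auto
  let ?F = "\<lambda>C. M f ` C <+>\<^bsub>L_tvs \<iota>\<^esub> \<O> m2"
  \<comment> \<open>On cosets the induced map multiplies representatives; the summand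
    \<open>\<O> m2\<close> absorbs the image of \<open>\<O> n2\<close>.\<close>
  have F: "?F (cs (\<O> n2) x) = cs (\<O> m2) (f * x)" for x
  proof -
    have "M f ` cs (\<O> n2) x = cs (M f ` \<O> n2) (f * x)"
      by (simp add: cs_def image_image distrib_left)
    then show ?thesis using cs_plus[OF O_subspace homeo_simps(3)[OF homeo_M[OF f] O_subspace] s2] by simp
  qed
  show "continuous_map (vtop (L_quot \<iota> n1 n2)) (vtop (L_quot \<iota> m1 m2)) ?F"
    unfolding continuous_map_def topspace_L_quot[OF n] topspace_L_quot[OF m]
  proof (intro conjI allI impI)
    show "?F \<in> qim (\<O> n2) (\<O> n1) \<rightarrow> qim (\<O> m2) (\<O> m1)" using s1 by (auto simp: F)
    fix U assume U: "openin (vtop (L_quot \<iota> m1 m2)) U"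
    show "openin (vtop (L_quot \<iota> n1 n2)) {A \<in> qim (\<O> n2) (\<O> n1). ?F A \<in> U}"
      unfolding openin_L_quot[OF n]
    proof (intro conjI ballI impI)
      fix x :: "'a fls fls" assume x: "x \<in> \<O> n1" and "cs (\<O> n2) x \<in> {A \<in> qim (\<O> n2) (\<O> n1). ?F A \<in> U}"
      then have fx: "cs (\<O> m2) (f * x) \<in> U" "f * x \<in> \<O> m1" using s1 by (auto simp: F)
      then obtain l where l: "\<forall>s\<in>cube m1 l. cs (\<O> m2) (s + f * x) \<in> U"
        using U unfolding openin_L_quot[OF m] by blast
      obtain l' where l': "\<forall>s\<in>cube n1 l'. \<exists>s'\<in>cube m1 l. f * s - s' \<in> \<O> m2" using M_cube[OF s1] by blast
      have "cs (\<O> n2) (s + x) \<in> {A \<in> qim (\<O> n2) (\<O> n1). ?F A \<in> U}" if s: "s \<in> cube n1 l'" for s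
      proof -
        obtain s' where s': "s' \<in> cube m1 l" "f * s - s' \<in> \<O> m2" using l' s by blast
        have "cs (\<O> m2) (f * (s + x)) = cs (\<O> m2) (s' + f * x)"
          using s'(2) by (simp add: cs_eq_iff[OF O_subspace] algebra_simps)
        then have "?F (cs (\<O> n2) (s + x)) \<in> U" using l s'(1) by (simp add: F)
        moreover have "s + x \<in> \<O> n1" using s x by (auto simp: cube_def intro: fls_lattice_add)
        ultimately show ?thesis by blast
      qed
      then show "\<exists>l. \<forall>s\<in>cube n1 l. cs (\<O> n2) (s + x) \<in> {A \<in> qim (\<O> n2) (\<O> n1). ?F A \<in> U}" by blast
    qed auto
  qed
qed

lemma M_L_GL:
  assumes f: "f \<noteq> 0"
  shows "M f \<in> L_GL \<iota>"
proof -
  have "M (inverse f) \<circ> M f = id" "M f \<circ> M (inverse f) = id"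
    by (auto simp: fun_eq_iff M_inverse[OF f])
  moreover have "M (inverse f) \<in> L_End \<iota>" using f by (intro M_L_End) simp
  ultimately show ?thesis using M_L_End[OF f] unfolding L_GL_def Units_def by auto
qed

end

section \<open>The torsor index and the commutator\<close>

context two_dim
begin

abbreviation "LV \<equiv> L_tvs \<iota>"

text \<open>
  The coordinate on \<open>[\<O> m | \<O> n]\<close> obtained by evaluating dimension theories on \<open>\<O> m / \<O> p\<close> at the
  image of \<open>k'[[t]]((u)) \<inter> \<O> m\<close>; it does not depend on \<open>p\<close>.
\<close>

definition torsor_index :: "int \<Rightarrow> int \<Rightarrow> 'a fls fls rel_elt \<Rightarrow> int \<Rightarrow> bool" where
  "torsor_index m n h c \<longleftrightarrow> h \<in> rel_torsor LV (\<O> m) (\<O> n) \<and>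
     (\<forall>p\<ge>max m n. \<forall>d\<in>Dim (sq (\<O> m) (\<O> p)).
        h (\<O> p) d (qim (\<O> p) (reflat n p)) = d (qim (\<O> p) (reflat m p)) + c)"

lemma torsor_indexD: "torsor_index m n h c \<Longrightarrow> h \<in> rel_torsor LV (\<O> m) (\<O> n)"
  "torsor_index m n h c \<Longrightarrow> max m n \<le> p \<Longrightarrow> d \<in> Dim (sq (\<O> m) (\<O> p)) \<Longrightarrow>
     h (\<O> p) d (qim (\<O> p) (reflat n p)) = d (qim (\<O> p) (reflat m p)) + c"
  by (auto simp: torsor_index_def)

lemma rel_torsor_value_Dim:
  assumes "h \<in> rel_torsor LV (\<O> m) (\<O> n)" "max m n \<le> p" "d \<in> Dim (sq (\<O> m) (\<O> p))"
  shows "h (\<O> p) d \<in> Dim (sq (\<O> n) (\<O> p))"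
    "h (\<O> p) (dim_shift (sq (\<O> m) (\<O> p)) k d) = dim_shift (sq (\<O> n) (\<O> p)) k (h (\<O> p) d)"
  using dim_homD[OF rel_torsorD(1)[OF assms(1) O_admissible] assms(3)] assms(2) by auto

lemma Dim_O_ne:
  assumes "m \<le> p"
  obtains d where "d \<in> Dim (sq (\<O> m) (\<O> p))"
  using Dim_exists[OF cpair_O[OF assms] reflat_OLC[OF assms], of 0] by blast

text \<open>At the greatest index \<open>c\<close> is constant because morphisms commute with
  shifts. For larger \<open>p\<close> a theory on \<open>\<O> p0 / \<O> p\<close> is tensored on; it
  is evaluated at the same lattice \<open>reflat p0 p\<close> on both sides and drops out.\<close>

lemma torsor_index_total:
  assumes h: "h \<in> rel_torsor LV (\<O> m) (\<O> n)"
  obtains c where "torsor_index m n h c"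
proof -
  define p0 where "p0 = max m n"
  have le: "m \<le> p0" "n \<le> p0" "max m n \<le> p0" by (auto simp: p0_def)
  obtain d0 where d0: "d0 \<in> Dim (sq (\<O> m) (\<O> p0))" by (rule Dim_O_ne[OF le(1)])
  define c where "c = h (\<O> p0) d0 (qim (\<O> p0) (reflat n p0)) - d0 (qim (\<O> p0) (reflat m p0))"
  have base: "h (\<O> p0) d (qim (\<O> p0) (reflat n p0)) = d (qim (\<O> p0) (reflat m p0)) + c"
    if d: "d \<in> Dim (sq (\<O> m) (\<O> p0))" for d
  proof -
    obtain k where k: "d = dim_shift (sq (\<O> m) (\<O> p0)) k d0"
      using Dim_torsor[OF cpair_O[OF le(1)] reflat_OLC[OF le(1)] d0 d] by blast
    show ?thesis
      unfolding k rel_torsor_value_Dim(2)[OF h le(3) d0] dim_shift_qim[OF cpair_O[OF le(1)] reflat_OLC[OF le(1)]]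
        dim_shift_qim[OF cpair_O[OF le(2)] reflat_OLC[OF le(2)]]
      by (simp add: c_def)
  qed
  have "h (\<O> p) d (qim (\<O> p) (reflat n p)) = d (qim (\<O> p) (reflat m p)) + c"
    if p: "max m n \<le> p" and d: "d \<in> Dim (sq (\<O> m) (\<O> p))" for p d
  proof -
    have le': "p0 \<le> p" "m \<le> p" "n \<le> p" using p by (auto simp: p0_def)
    obtain e where e: "e \<in> Dim (sq (\<O> p0) (\<O> p))" by (rule Dim_O_ne[OF le'(1)])
    note ch = cchain_O[OF le(1) le'(1)] cchain_O[OF le(2) le'(1)]
    have ne: "OLC (\<O> m) (\<O> p) \<noteq> {}" using reflat_OLC[OF le'(2)] by blast
    obtain d' where d': "d' \<in> Dim (sq (\<O> m) (\<O> p0))" "d = tens (\<O> m) (\<O> p0) (\<O> p) e d'"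
      by (rule dim_tensor_surj[OF ch(1) ne e d])
    have "h (\<O> p) d = tens (\<O> n) (\<O> p0) (\<O> p) e (h (\<O> p0) d')"
      unfolding d'(2)
      by (rule rel_torsorD(2)[OF h O_admissible[OF le(1,2)] O_admissible[OF le'(2,3)] O_mono[OF le'(1)] d'(1) e])
    then show ?thesis
      unfolding d'(2) dim_tensor_qim[OF ch(1) reflat_OLC[OF le'(2)]]
      by (simp add: dim_tensor_qim[OF ch(2) reflat_OLC[OF le'(3)]] reflat_Int[OF le(1)] reflat_Int[OF le(2)]
          reflat_plus[OF le(1) le'(1)] reflat_plus[OF le(2) le'(1)] base[OF d'(1)])
  qed
  then have "torsor_index m n h c" using h by (simp add: torsor_index_def)
  then show thesis by (rule that)
qed

lemma torsor_index_unique: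
  assumes "torsor_index m n h c" "torsor_index m n h c'"
  shows "c = c'"
proof -
  obtain d where d: "d \<in> Dim (sq (\<O> m) (\<O> (max m n)))" using Dim_O_ne[of m "max m n"] by auto
  show ?thesis using torsor_indexD(2)[OF assms(1) order_refl d] torsor_indexD(2)[OF assms(2) order_refl d] by simp
qed

lemma torsor_index_inject:
  assumes h: "torsor_index m n h c" "torsor_index m n h' c"
  shows "h = h'"
proof (rule rel_torsor_eqI[OF has_top_O torsor_indexD(1)[OF h(1)] torsor_indexD(1)[OF h(2)] O_admissible[of m "max m n" n]])
  have le: "n \<le> max m n" by simp
  fix d assume d: "d \<in> Dim (sq (\<O> m) (\<O> (max m n)))"
  show "h (\<O> (max m n)) d = h' (\<O> (max m n)) d"
    by (rule Dim_eqI[OF cpair_O[OF le] rel_torsor_value_Dim(1)[OF torsor_indexD(1)[OF h(1)] order_refl d]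
          rel_torsor_value_Dim(1)[OF torsor_indexD(1)[OF h(2)] order_refl d] reflat_OLC[OF le]])
      (simp add: torsor_indexD(2)[OF h(1) order_refl d] torsor_indexD(2)[OF h(2) order_refl d])
qed auto

text \<open>A value prescribed at one lattice gives a morphism at the greatest index, which extends
  to the whole system. With totality and injectivity the coordinate is a bijection onto the
  integers.\<close>

lemma torsor_index_exists:
  obtains h where "torsor_index m n h c"
proof -
  define p where "p = max m n"
  have le: "m \<le> p" "n \<le> p" "max m n \<le> p" by (auto simp: p_def)
  let ?A = "sq (\<O> m) (\<O> p)" and ?B = "sq (\<O> n) (\<O> p)"
  note pA = cpair_O[OF le(1)] and pB = cpair_O[OF le(2)] and rA = reflat_OLC[OF le(1)] and rB = reflat_OLC[OF le(2)]
  have ex: "\<exists>e. e \<in> Dim ?B \<and> e (qim (\<O> p) (reflat n p)) = d (qim (\<O> p) (reflat m p)) + c" for d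
    using Dim_exists[OF pB rB] by blast
  define \<psi> where "\<psi> = (\<lambda>d\<in>Dim ?A. SOME e. e \<in> Dim ?B \<and> e (qim (\<O> p) (reflat n p)) = d (qim (\<O> p) (reflat m p)) + c)"
  have \<psi>: "\<psi> d \<in> Dim ?B \<and> \<psi> d (qim (\<O> p) (reflat n p)) = d (qim (\<O> p) (reflat m p)) + c" if "d \<in> Dim ?A" for d
    using someI_ex[OF ex[of d]] that by (simp add: \<psi>_def)
  have "\<psi> \<in> dim_hom ?A ?B"
    unfolding dim_hom_def
  proof (intro CollectI conjI PiE_I ballI allI)
    fix d k assume d: "d \<in> Dim ?A"
    note sd = dim_shift_Dim[OF pA d, of k]
    show "\<psi> (dim_shift ?A k d) = dim_shift ?B k (\<psi> d)"
      by (rule Dim_eqI[OF pB conjunct1[OF \<psi>[OF sd]] dim_shift_Dim[OF pB conjunct1[OF \<psi>[OF d]]] rB])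
        (simp add: conjunct2[OF \<psi>[OF sd]] dim_shift_qim[OF pB rB] dim_shift_qim[OF pA rA] conjunct2[OF \<psi>[OF d]])
  qed (use \<psi> in \<open>auto simp: \<psi>_def\<close>)
  note ex = rel_torsor_exists[OF has_top_O O_admissible[OF le(1,2)] this]
  obtain h where h: "h \<in> rel_torsor LV (\<O> m) (\<O> n)" "\<And>d. d \<in> Dim ?A \<Longrightarrow> h (\<O> p) d = \<psi> d"
    using ex by blast
  obtain c' where c': "torsor_index m n h c'" by (rule torsor_index_total[OF h(1)])
  obtain d where d: "d \<in> Dim ?A" by (rule Dim_O_ne[OF le(1)])
  have "c' = c" using torsor_indexD(2)[OF c' le(3) d] h(2)[OF d] \<psi>[OF d] by simp
  then show thesis using c' that by blast
qed

lemma torsor_index_comp: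
  assumes h: "torsor_index m n h c" and h': "torsor_index n q h' c'"
  shows "torsor_index m q (rel_comp LV (\<O> m) (\<O> n) (\<O> q) h h') (c + c')"
proof -
  \<comment> \<open>At \<open>\<O> p\<close>, the intersection of all three spaces, the product is
    literally composition.\<close>
  define p where "p = max (max m n) q"
  have le: "m \<le> p" "n \<le> p" "q \<le> p" "max m n \<le> p" "max n q \<le> p" "max m q \<le> p" by (auto simp: p_def)
  have T: "\<O> p = (\<O> m \<inter> \<O> n \<inter> \<O> q :: 'a fls fls set)" by (simp add: O_Int p_def)
  note props = rel_comp_props[OF has_top_O has_top_O has_top_O T O_admissible[OF le(1,2)] O_admissible[OF le(2,3)] torsor_indexD(1)[OF h] torsor_indexD(1)[OF h']]
  obtain k where k: "torsor_index m q (rel_comp LV (\<O> m) (\<O> n) (\<O> q) h h') k" by (rule torsor_index_total[OF props(1)])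
  obtain d where d: "d \<in> Dim (sq (\<O> m) (\<O> p))" by (rule Dim_O_ne[OF le(1)])
  have "k = c + c'"
    using torsor_indexD(2)[OF k le(6) d] torsor_indexD(2)[OF h le(4) d]
      torsor_indexD(2)[OF h' le(5) rel_torsor_value_Dim(1)[OF torsor_indexD(1)[OF h] le(4) d]] props(2)[OF d] by simp
  then show ?thesis using k by simp
qed

lemma torsor_index_int: "torsor_index m m (rel_int LV (\<O> m) k) k"
  unfolding torsor_index_def
proof (intro conjI allI impI ballI rel_int_rel_torsor[OF O_complete])
  fix p d assume p: "max m m \<le> p" and d: "d \<in> Dim (sq (\<O> m) (\<O> p))"
  have le: "m \<le> p" using p by simp
  show "rel_int LV (\<O> m) k (\<O> p) d (qim (\<O> p) (reflat m p)) = d (qim (\<O> p) (reflat m p)) + k"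
    using d O_admissible[OF le le] by (simp add: rel_int_def dim_shift_qim[OF cpair_O[OF le] reflat_OLC[OF le]])
qed

text \<open>Moving the transported reference lattice back to the standard one costs
  \<open>D * nu1 f * (p - m)\<close> at the source and \<open>D * nu1 f * (p - n)\<close> at the
  target; the auxiliary \<open>p\<close> cancels in the difference.\<close>

lemma torsor_index_push:
  assumes f: "f \<noteq> 0" and h: "torsor_index m n h c"
  shows "torsor_index (m + nu2 f) (n + nu2 f) (rel_push LV (M f) (\<O> m) (\<O> n) h) (c - int D * nu1 f * (n - m))"
proof -
  let ?\<nu> = "nu2 f" and ?h = "rel_push LV (M f) (\<O> m) (\<O> n) h"
  note g = homeo_M[OF f] and im = M_image_O[OF f]
  define p where "p = max m n"
  have le: "m \<le> p" "n \<le> p" "max m n \<le> p" "m + ?\<nu> \<le> p + ?\<nu>" "n + ?\<nu> \<le> p + ?\<nu>" "max (m + ?\<nu>) (n + ?\<nu>) \<le> p + ?\<nu>"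
    by (auto simp: p_def)
  have "?h \<in> rel_torsor LV (\<O> (m + ?\<nu>)) (\<O> (n + ?\<nu>))"
    using rel_push_rel_torsor[OF g O_complete O_complete torsor_indexD(1)[OF h]] by (simp add: im)
  then obtain k where k: "torsor_index (m + ?\<nu>) (n + ?\<nu>) ?h k" by (rule torsor_index_total)
  obtain d where d: "d \<in> Dim (sq (\<O> m) (\<O> p))" by (rule Dim_O_ne[OF le(1)])
  have push: "dim_push LV (M f) (\<O> r) (\<O> p) e \<in> Dim (sq (\<O> (r + ?\<nu>)) (\<O> (p + ?\<nu>)))"
    and val: "dim_push LV (M f) (\<O> r) (\<O> p) e (qim (\<O> (p + ?\<nu>)) (reflat (r + ?\<nu>) (p + ?\<nu>))) =
      e (qim (\<O> p) (reflat r p)) + int D * nu1 f * (p - r)"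
    if r: "r \<le> p" and e: "e \<in> Dim (sq (\<O> r) (\<O> p))" for r e
  proof -
    show 1: "dim_push LV (M f) (\<O> r) (\<O> p) e \<in> Dim (sq (\<O> (r + ?\<nu>)) (\<O> (p + ?\<nu>)))"
      using dim_push_Dim[OF g cpair_O[OF r] e] by (simp add: im)
    have r': "r + ?\<nu> \<le> p + ?\<nu>" using r by simp
    have 2: "dim_push LV (M f) (\<O> r) (\<O> p) e (qim (\<O> (p + ?\<nu>)) (M f ` reflat r p)) = e (qim (\<O> p) (reflat r p))"
      using dim_push_qim[OF g cpair_O[OF r] reflat_OLC[OF r], of e] by (simp add: im)
    show "dim_push LV (M f) (\<O> r) (\<O> p) e (qim (\<O> (p + ?\<nu>)) (reflat (r + ?\<nu>) (p + ?\<nu>))) =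
      e (qim (\<O> p) (reflat r p)) + int D * nu1 f * (p - r)"
      unfolding Dim_value[OF cpair_O[OF r'] 1 M_reflat_OLC[OF f r] reflat_OLC[OF r']] 2 reldim_M_reflat[OF f r] ..
  qed
  note hd = rel_torsor_value_Dim(1)[OF torsor_indexD(1)[OF h] le(3) d]
  have "?h (\<O> (p + ?\<nu>)) (dim_push LV (M f) (\<O> m) (\<O> p) d) = dim_push LV (M f) (\<O> n) (\<O> p) (h (\<O> p) d)"
    using rel_push_value[OF g O_complete O_complete O_admissible[OF le(1,2)] d, of h] by (simp add: im)
  then have "k = c - int D * nu1 f * (n - m)"
    using torsor_indexD(2)[OF k le(6) push[OF le(1) d]] torsor_indexD(2)[OF h le(3) d] val[OF le(1) d] val[OF le(2) hd]
    by (simp add: algebra_simps)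
  then show ?thesis using k by simp
qed

section \<open>Lifts of multiplication operators and their products\<close>

abbreviation "G \<equiv> GL_hat \<iota>"

text \<open>Integer coordinates on the fibre of the extension over \<open>f\<close>; existence and
  injectivity of the index make the description definite.\<close>

definition lift :: "'a fls fls \<Rightarrow> int \<Rightarrow> ('a fls fls \<Rightarrow> 'a fls fls) \<times> 'a fls fls rel_elt" where
  "lift f c = (M f, THE h. torsor_index 0 (nu2 f) h c)"

lemma lift_eq: "torsor_index 0 (nu2 f) h c \<Longrightarrow> lift f c = (M f, h)"
  unfolding lift_def using torsor_index_inject by blast

lemma M_image_O0: "f \<noteq> 0 \<Longrightarrow> M f ` \<O> 0 = \<O> (nu2 f)"
  using M_image_O[of f 0] by simp

lemma lift_carrier:
  assumes f: "f \<noteq> 0"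
  shows "lift f c \<in> carrier G"
proof -
  obtain h where h: "torsor_index 0 (nu2 f) h c" by (rule torsor_index_exists)
  show ?thesis
    unfolding lift_eq[OF h] GL_hat_def using torsor_indexD(1)[OF h] M_L_GL[OF f] by (simp add: M_image_O0[OF f])
qed

lemma carrier_lift:
  assumes f: "f \<noteq> 0" and x: "x \<in> carrier G" "fst x = M f"
  obtains c where "x = lift f c"
proof -
  obtain h where h: "x = (M f, h)" using x(2) by (metis prod.collapse)
  have "h \<in> rel_torsor LV (\<O> 0) (\<O> (nu2 f))" using x(1) by (simp add: h GL_hat_def M_image_O0[OF f])
  then obtain c where "torsor_index 0 (nu2 f) h c" by (rule torsor_index_total)
  then show thesis using that lift_eq h by metis
qed

lemma lift_mult:
  assumes f: "f \<noteq> 0" and g: "g \<noteq> 0"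
  shows "lift f a \<otimes>\<^bsub>G\<^esub> lift g b = lift (f * g) (a + b - int D * nu1 f * nu2 g)"
proof -
  obtain h where h: "torsor_index 0 (nu2 f) h a" by (rule torsor_index_exists)
  obtain k where k: "torsor_index 0 (nu2 g) k b" by (rule torsor_index_exists)
  have fg: "M f \<circ> M g = M (f * g)" by (auto simp: fun_eq_iff mult.assoc)
  have fg0: "f * g \<noteq> 0" using f g by simp
  \<comment> \<open>The second factor lives on \<open>[\<O> 0 | \<O> (nu2 g)]\<close>, so its
    transport by \<open>f\<close> produces the whole cocycle, proportional to
    \<open>nu2 g\<close>.\<close>
  have push: "torsor_index (nu2 f) (nu2 (f * g)) (rel_push LV (M f) (\<O> 0) (\<O> (nu2 g)) k) (b - int D * nu1 f * nu2 g)"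
    using torsor_index_push[OF f k] by (simp add: nu2_mult[OF f g] add.commute)
  have "lift (f * g) (a + b - int D * nu1 f * nu2 g) =
      (M (f * g), rel_comp LV (\<O> 0) (\<O> (nu2 f)) (\<O> (nu2 (f * g))) h (rel_push LV (M f) (\<O> 0) (\<O> (nu2 g)) k))"
    using torsor_index_comp[OF h push] by (intro lift_eq) (simp add: algebra_simps)
  moreover have "lift f a \<otimes>\<^bsub>G\<^esub> lift g b =
      (M f \<circ> M g, rel_comp LV (\<O> 0) (M f ` \<O> 0) ((M f \<circ> M g) ` \<O> 0) h (rel_push LV (M f) (\<O> 0) (M g ` \<O> 0) k))"
    by (simp add: lift_eq[OF h] lift_eq[OF k] GL_hat_def)
  ultimately show ?thesis
    unfolding fg M_image_O0[OF f] M_image_O0[OF g] M_image_O0[OF fg0] by simp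
qed

lemma lift_central: "central \<iota> n = lift 1 n"
  using lift_eq[of 1 "rel_int LV (\<O> 0) n" n] torsor_index_int[of 0 n] by (simp add: central_def nu_1 id_def)

lemma lift_one: "\<one>\<^bsub>G\<^esub> = lift 1 0"
  using lift_central[of 0] by (simp add: central_def GL_hat_def)

lemma lift_inject: "lift f a = lift f b \<longleftrightarrow> a = b"
proof
  assume eq: "lift f a = lift f b"
  obtain h where h: "torsor_index 0 (nu2 f) h a" by (rule torsor_index_exists)
  obtain k where k: "torsor_index 0 (nu2 f) k b" by (rule torsor_index_exists)
  show "a = b" using eq h k torsor_index_unique unfolding lift_eq[OF h] lift_eq[OF k] by auto
qed simp

text \<open>The index is the solution of the multiplication rule for total index \<open>0\<close>;
  the sign of the second term reflects \<open>nu2 (inverse f) = - nu2 f\<close>.\<close>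

lemma lift_inv:
  assumes f: "f \<noteq> 0"
  shows "inv\<^bsub>G\<^esub> (lift f a) = lift (inverse f) (- a - int D * nu1 f * nu2 f)"
  unfolding m_inv_def
proof (rule the_equality)
  have i: "inverse f \<noteq> 0" using f by simp
  show "lift (inverse f) (- a - int D * nu1 f * nu2 f) \<in> carrier G \<and>
      lift f a \<otimes>\<^bsub>G\<^esub> lift (inverse f) (- a - int D * nu1 f * nu2 f) = \<one>\<^bsub>G\<^esub> \<and>
      lift (inverse f) (- a - int D * nu1 f * nu2 f) \<otimes>\<^bsub>G\<^esub> lift f a = \<one>\<^bsub>G\<^esub>"
    using f by (simp add: lift_carrier[OF i] lift_mult[OF f i] lift_mult[OF i f] lift_one nu_inverse[OF f])
  fix y assume y: "y \<in> carrier G \<and> lift f a \<otimes>\<^bsub>G\<^esub> y = \<one>\<^bsub>G\<^esub> \<and> y \<otimes>\<^bsub>G\<^esub> lift f a = \<one>\<^bsub>G\<^esub>"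
  \<comment> \<open>A candidate inverse is not known to be a lift. Its first component is forced to
    be multiplication by \<open>inverse f\<close>, over which every element is a lift.\<close>
  have "fst (lift f a \<otimes>\<^bsub>G\<^esub> y) = M f \<circ> fst y"
    by (cases y) (simp add: GL_hat_def lift_def)
  then have "M f \<circ> fst y = M 1" using y by (simp add: lift_one lift_def)
  then have "f * fst y x = x" for x by (simp add: fun_eq_iff)
  then have "fst y = M (inverse f)"
    using M_inverse(1)[OF f, of "fst y x" for x] by (metis (no_types, lifting) ext)
  then obtain b where b: "y = lift (inverse f) b" using carrier_lift[OF i conjunct1[OF y]] by blast
  have "lift 1 (a + b - int D * nu1 f * nu2 (inverse f)) = lift 1 0"
    using y f unfolding b lift_mult[OF f i] lift_one by simp
  then have "b = - a - int D * nu1 f * nu2 f" unfolding lift_inject nu_inverse[OF f] by simp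
  then show "y = lift (inverse f) (- a - int D * nu1 f * nu2 f)" using b by simp
qed

text \<open>Exchanging the factors changes the index by the difference of the two cocycle values,
  while \<open>a\<close> and \<open>b\<close> cancel. With \<open>g\<close> in front this is
  \<open>- D * nu1 g * nu2 f + D * nu1 f * nu2 g\<close>.\<close>

lemma commutator_lift:
  assumes f: "f \<noteq> 0" and g: "g \<noteq> 0"
  shows "commutator G (lift f a) (lift g b) = central \<iota> (int D * nuL f g)"
proof -
  have i: "inverse f \<noteq> 0" "inverse g \<noteq> 0" "g * f \<noteq> 0" "g * f * inverse g \<noteq> 0" using f g by auto
  have "g * f * inverse g * inverse f = (g * inverse g) * (f * inverse f)" by (simp only: ac_simps)
  also have "\<dots> = 1" using f g by simp
  finally have one: "g * f * inverse g * inverse f = 1" .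
  show ?thesis
    unfolding commutator_def lift_inv[OF f] lift_inv[OF g] lift_mult[OF g f] lift_mult[OF i(3,2)] lift_mult[OF i(4,1)]
      one lift_central lift_inject nu1_mult[OF i(3,2)] nu1_mult[OF g f] nu_inverse[OF f] nu_inverse[OF g] nuL_def
    by (simp add: algebra_simps)
qed

end

theorem theorem1:
  fixes \<iota> :: "'k::field \<Rightarrow> 'a::field" and f g :: "'a fls fls"
  assumes "finite_extension \<iota>" and "f \<noteq> 0" and "g \<noteq> 0"
  shows "L_pairing \<iota> (\<lambda>x. f * x) (\<lambda>x. g * x) = int (ext_degree \<iota>) * nuL f g"
proof -
  interpret two_dim \<iota> by (unfold_locales) (rule assms)
  note f = assms(2) and g = assms(3)
  show ?thesis
    unfolding L_pairing_def
  proof (rule the_equality)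
    show "\<forall>x\<in>carrier G. \<forall>y\<in>carrier G. fst x = M f \<and> fst y = M g \<longrightarrow>
        commutator G x y = central \<iota> (int D * nuL f g)"
    proof (intro ballI impI, elim conjE)
      fix x y assume x: "x \<in> carrier G" "fst x = M f" and y: "y \<in> carrier G" "fst y = M g"
      obtain a where a: "x = lift f a" by (rule carrier_lift[OF f x])
      obtain b where b: "y = lift g b" by (rule carrier_lift[OF g y])
      show "commutator G x y = central \<iota> (int D * nuL f g)" unfolding a b by (rule commutator_lift[OF f g])
    qed
    fix n assume n: "\<forall>x\<in>carrier G. \<forall>y\<in>carrier G. fst x = M f \<and> fst y = M g \<longrightarrow> commutator G x y = central \<iota> n"
    \<comment> \<open>Lifts exist, so a single commutator pins down \<open>n\<close>, by injectivity
      of the index over \<open>1\<close>.\<close>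
    have "fst (lift f 0) = M f \<and> fst (lift g 0) = M g" by (simp add: lift_def)
    then have "commutator G (lift f 0) (lift g 0) = central \<iota> n"
      using n lift_carrier[OF f, of 0] lift_carrier[OF g, of 0] by blast
    then show "n = int D * nuL f g"
      unfolding commutator_lift[OF f g] lift_central lift_inject by simp
  qed
qed

end
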